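(* Let $\mathcal{G}_h$ be a cubical mesh of a bounded domain $\Omega\subset\mathbb{R}^n$. The following are discrete de Rham complexes and commutative diagrams: $$\begin{array}{ccccccccccc} \mathbb{R} & \longrightarrow & V^{\mathcal{Q}}_h\Lambda^0 & \xrightarrow{d^0} & V^{\mathcal{Q}}_h\Lambda^1 & \xrightarrow{d^1} & \cdots & \xrightarrow{d^{n-1}} & V^{\mathcal{Q}}_h\Lambda^n & \xrightarrow{d^n} & 0\\ & & \downarrow \mathbb{I}^{d^0}_h & & \downarrow \mathbb{I}^{d^1}_h & & & & \downarrow \mathbb{I}^{d^n}_h & & \\ \mathbb{R} & \longrightarrow & W^{\rm def}_h\Lambda^0 & \xrightarrow{d^0_h} & W^{\rm def}_h\Lambda^1 & \xrightarrow{d^1_h} & \cdots & \xrightarrow{d^{n-1}_h} & W^{\rm def}_h\Lambda^n & \xrightarrow{d^n_h} & 0 \end{array}$$ and $$\begin{array}{ccccccccccc} 0 & \longrightarrow & V^{\mathcal{Q}}_{h0}\Lambda^0 & \xrightarrow{d^0} & V^{\mathcal{Q}}_{h0}\Lambda^1 & \xrightarrow{d^1} & \cdots & \xrightarrow{d^{n-1}} & V^{\mathcal{Q}}_{h0}\Lambda^n & \xrightarrow{d^n} & 0\\ & & \downarrow \mathbb{I}^{d^0}_h & & \downarrow \mathbb{I}^{d^1}_h & & & & \downarrow \mathbb{I}^{d^n}_h & & \\ 0 & \longrightarrow & W^{\rm def}_{h0}\Lambda^0 & \xrightarrow{d^0_h} & W^{\rm def}_{h0}\Lambda^1 & \xrightarrow{d^1_h}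 & \cdots & \xrightarrow{d^{n-1}_h} & W^{\rm def}_{h0}\Lambda^n & \xrightarrow{d^n_h} & 0 \end{array}$$ That is: every arrow is well defined (each operator maps the indicated source space into the indicated target space), in each row the composition of two consecutive arrows is zero, and all squares commute, i.e. $\mathbb{I}^{d^{k+1}}_h d^k=d^k_h\,\mathbb{I}^{d^k}_h$ on $V^{\mathcal{Q}}_h\Lambda^k$ (respectively on $V^{\mathcal{Q}}_{h0}\Lambda^k$) for $0\le k\le n-1$. The arrows out of $\mathbb{R}$ are the inclusions of constant functions.
   Context: Forms. For a domain $\Xi\subset\mathbb{R}^n$, $L^2\Lambda^k(\Xi)$ is the Hilbert space of differential $k$-forms with $L^2(\Xi)$ coefficients, with the componentwise inner product $\langle\cdot,\cdot\rangle_{L^2\Lambda^k(\Xi)}$; $d^k$ is the exterior derivative on $k$-forms (weak sense; $d^n=0$); $\star$ is the Euclidean Hodge star; the codifferential is $\delta_k=(-1)^{n(k+1)+1}\star d^{n-k}\star$ on $k$-forms, i.e. the formal $L^2$-adjoint of $d^{k-1}$. $H\Lambda^k(\Xi)=\{\omega\in L^2\Lambda^k(\Xi): d^k\omega\in L^2\Lambda^{k+1}(\Xi)\}$ (with $H\Lambda^n=L^2\Lambda^n$), $H^*\Lambda^k(\Xi)=\{\mu\in L^2\Lambda^k(\Xi):\delta_k\mu\in L^2\Lambda^{k-1}(\Xi)\}$, and $H_0\Lambda^k(\Xi)$, $H^*_0\Lambda^k(\Xi)$ are the closures of $\mathcal{C}^\infty_0\Lambda^k(\Xi)$ in $H\Lambda^k(\Xi)$,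 $H^*\Lambda^k(\Xi)$ in the graph norms. Mesh. A cubical mesh $\mathcal{G}_h$ of $\Omega$ is a finite (face-to-face) subdivision of $\Omega$ into $n$-dimensional boxes $K$ (products of intervals, edges parallel to the coordinate axes). A subscript $h$ on an operator means it is applied cell by cell: $(d^k_h\omega_h)|_K=d^k(\omega_h|_K)$. Local spaces. $\mathcal{P}_0\Lambda^k$ is the space of constant-coefficient $k$-forms. The Koszul operator is $\kappa(dx^{\alpha_1}\wedge\dots\wedge dx^{\alpha_k})=\sum_{j=1}^k(-1)^{j+1}x_{\alpha_j}dx^{\alpha_1}\wedge\dots\widehat{dx^{\alpha_j}}\dots\wedge dx^{\alpha_k}$ (linear over functions). Whitney forms: $\mathcal{P}^-_1\Lambda^k=\mathcal{P}_0\Lambda^k+\kappa(\mathcal{P}_0\Lambda^{k+1})$ (so $\mathcal{P}^-_1\Lambda^n=\mathcal{P}_0\Lambda^n$), and $\mathcal{P}^{*,-}_1\Lambda^k=\star(\mathcal{P}^-_1\Lambda^{n-k})$. For a box $K=I_1\times\dots\times I_n$, $\mathcal{Q}^-_1\Lambda^k(K)=\bigoplus_{\alpha}\big[\bigotimes_{i=1}^n\mathcal{P}_{1-\delta_{i,\alpha}}(I_i)\big]dx^{\alpha_1}\wedge\dots\wedge dx^{\alpha_k}$, the sum over $1\le\alpha_1<\dots<\alpha_k\le n$, where $\delta_{i,\alpha}=1$ if $i\in\{\alpha_1,\dots,\alpha_k\}$ and $0$ otherwise, and $\mathcal{P}_r(I)$ denotes univariate polynomials of degree at most $r$. $\mathcal{Q}^{*,-}_1\Lambda^k(K)=\star(\mathcal{Q}^-_1\Lambda^{n-k}(K))$.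 Interpolator. For $0\le k\le n-1$ and a box $K$, $\mathbb{I}^{d^k}_K:H\Lambda^k(K)\to\mathcal{P}^-_1\Lambda^k(K)$ is the (well-defined) operator determined by $$\langle d^k\mathbb{I}^{d^k}_K\omega,\mu\rangle_{L^2\Lambda^{k+1}(K)}-\langle\mathbb{I}^{d^k}_K\omega,\delta_{k+1}\mu\rangle_{L^2\Lambda^k(K)}=\langle d^k\omega,\mu\rangle_{L^2\Lambda^{k+1}(K)}-\langle\omega,\delta_{k+1}\mu\rangle_{L^2\Lambda^k(K)}\quad\forall\mu\in\mathcal{P}^{*,-}_1\Lambda^{k+1}(K).$$ For $k=n$, $\mathbb{I}^{d^n}_K$ is the $L^2$ projection onto $\mathcal{P}_0\Lambda^n$ on $K$. Globally $(\mathbb{I}^{d^k}_h\omega)|_K=\mathbb{I}^{d^k}_K(\omega|_K)$. Global spaces. $\mathcal{P}^-_1\Lambda^k(\mathcal{G}_h)=\prod_{K\in\mathcal{G}_h}\mathcal{P}^-_1\Lambda^k(K)$. $V^{\mathcal{Q}}_h\Lambda^k$ (resp. $V^{\mathcal{Q}}_{h0}\Lambda^k$) is the set of $\omega\in H\Lambda^k(\Omega)$ (resp. $H_0\Lambda^k(\Omega)$) with $\omega|_K\in\mathcal{Q}^-_1\Lambda^k(K)$ for all $K\in\mathcal{G}_h$. $V^{\mathcal{Q},*}_{h}\Lambda^{k}$ (resp. $V^{\mathcal{Q},*}_{h0}\Lambda^{k}$) is the set of $\mu\in H^*\Lambda^{k}(\Omega)$ (resp. $H^*_0\Lambda^{k}(\Omega)$)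 with $\mu|_K\in\mathcal{Q}^{*,-}_1\Lambda^{k}(K)$ for all $K\in\mathcal{G}_h$. Define $$W^{\rm def}_h\Lambda^k=\Big\{\omega_h\in\mathcal{P}^-_1\Lambda^k(\mathcal{G}_h):\sum_{K\in\mathcal{G}_h}\langle d^k\omega_h,\mu_h\rangle_{L^2\Lambda^{k+1}(K)}-\langle\omega_h,\delta_{k+1}\mu_h\rangle_{L^2\Lambda^k(K)}=0\ \ \forall\mu_h\in V^{\mathcal{Q},*}_{h0}\Lambda^{k+1}\Big\},$$ and $W^{\rm def}_{h0}\Lambda^k$ by the same formula with $V^{\mathcal{Q},*}_{h0}\Lambda^{k+1}$ replaced by $V^{\mathcal{Q},*}_{h}\Lambda^{k+1}$. For $k=n$ the condition is void (there are no nonzero $(n+1)$-forms), so $W^{\rm def}_h\Lambda^n=W^{\rm def}_{h0}\Lambda^n=\mathcal{P}_0\Lambda^n(\mathcal{G}_h)$, the piecewise constant $n$-forms. *)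

theory Defs
  imports "HOL-Analysis.Analysis"
begin

section \<open>The exterior algebra of Euclidean space\<close>

text \<open>
  The index type \<open>'n\<close> plays the role of $\{1,\dots,n\}$, with $n$ = \<open>CARD('n)\<close>. An element of the exterior
  algebra is the vector of its coefficients with respect to the basis
  $dx^{\alpha_1}\wedge\dots\wedge dx^{\alpha_k}$, $\alpha_1<\dots<\alpha_k$, which is indexed by the
  set $\{\alpha_1,\dots,\alpha_k\}$. The inner product of \<open>real ^ ('n set)\<close> is then the componentwise one.
\<close>

type_synonym 'n space = "real ^ 'n"
type_synonym 'n ext = "real ^ ('n set)"
type_synonym 'n form = "real ^ 'n \<Rightarrow> real ^ ('n set)"

definition dx :: "'n::finite set \<Rightarrow> 'n ext" where
  "dx S = axis S 1"

definition Alt :: "nat \<Rightarrow> ('n::finite ext) set" where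
  "Alt k = {u. \<forall>S. card S \<noteq> k \<longrightarrow> u $ S = 0}"

text \<open>For disjoint \<open>S\<close>, \<open>T\<close>: the sign of the permutation sorting \<open>S\<close> followed by \<open>T\<close>, so that
  $dx^S\wedge dx^T$ is this sign times $dx^{S\cup T}$.\<close>

definition shuffle_sign :: "'n::{finite,linorder} set \<Rightarrow> 'n set \<Rightarrow> real" where
  "shuffle_sign S T = (-1) ^ card {(i, j). i \<in> S \<and> j \<in> T \<and> j < i}"

definition wedge :: "'n::{finite,linorder} ext \<Rightarrow> 'n ext \<Rightarrow> 'n ext" where
  "wedge u v = (\<Sum>S\<in>UNIV. \<Sum>T\<in>UNIV.
     if S \<inter> T = {} then (u $ S * v $ T * shuffle_sign S T) *\<^sub>R dx (S \<union> T) else 0)"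

text \<open>The Euclidean Hodge star, normalised by $dx^S\wedge\star dx^S = dx^1\wedge\dots\wedge dx^n$.\<close>

definition hodge :: "'n::{finite,linorder} ext \<Rightarrow> 'n ext" where
  "hodge u = (\<Sum>S\<in>UNIV. (u $ S * shuffle_sign S (- S)) *\<^sub>R dx (- S))"

definition koszul :: "'n space \<Rightarrow> 'n::{finite,linorder} ext \<Rightarrow> 'n ext" where
  "koszul x u = (\<Sum>S\<in>UNIV. u $ S *\<^sub>R
     (\<Sum>i\<in>S. ((-1) ^ card {j \<in> S. j < i} * x $ i) *\<^sub>R dx (S - {i})))"

section \<open>Test forms and classical operators\<close>

primrec Ck :: "nat \<Rightarrow> ('a::real_normed_vector \<Rightarrow> 'b::real_normed_vector) \<Rightarrow> bool" where
  "Ck 0 f \<longleftrightarrow> continuous_on UNIV f"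
| "Ck (Suc m) f \<longleftrightarrow> (\<forall>x. f differentiable (at x)) \<and>
     (\<forall>v. Ck m (\<lambda>x. frechet_derivative f (at x) v))"

definition test_forms :: "'n space set \<Rightarrow> nat \<Rightarrow> ('n::finite form) set" where
  "test_forms \<Xi> k = {\<phi>. (\<forall>m. Ck m \<phi>) \<and> (\<forall>x. \<phi> x \<in> Alt k) \<and>
     compact (closure {x. \<phi> x \<noteq> 0}) \<and> closure {x. \<phi> x \<noteq> 0} \<subseteq> \<Xi>}"

definition ext_deriv :: "'n::{finite,linorder} form \<Rightarrow> 'n form" where
  "ext_deriv \<omega> x = (\<Sum>i\<in>UNIV. wedge (dx {i}) (frechet_derivative \<omega> (at x) (axis i 1)))"

definition codiff_sign :: "'n::finite itself \<Rightarrow> nat \<Rightarrow> real" where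
  "codiff_sign _ k = (-1) ^ (CARD('n) * (k + 1) + 1)"

definition codiff :: "nat \<Rightarrow> 'n::{finite,linorder} form \<Rightarrow> 'n form" where
  "codiff k \<phi> x = codiff_sign TYPE('n) k *\<^sub>R hodge (ext_deriv (\<lambda>y. hodge (\<phi> y)) x)"

section \<open>Square integrable forms and weak operators\<close>

text \<open>
  Elements of $L^2\Lambda^k(\Xi)$ are represented by functions, whose values outside \<open>\<Xi>\<close> are
  irrelevant and which are identified when they agree almost everywhere on \<open>\<Xi>\<close> (\<open>eq_on \<Xi>\<close>).
  Hence no restriction operator is needed: $\omega|_K$ is \<open>\<omega>\<close>, regarded as a form on \<open>K\<close>.
\<close>

definition eq_on :: "'n space set \<Rightarrow> 'n::finite form \<Rightarrow> 'n form \<Rightarrow> bool" where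
  "eq_on \<Xi> \<omega> \<eta> \<longleftrightarrow> (AE x in lebesgue_on \<Xi>. \<omega> x = \<eta> x)"

definition L2 :: "'n space set \<Rightarrow> nat \<Rightarrow> ('n::finite form) set" where
  "L2 \<Xi> k = {\<omega>. \<omega> \<in> borel_measurable (lebesgue_on \<Xi>) \<and> (\<forall>x\<in>\<Xi>. \<omega> x \<in> Alt k) \<and>
     integrable (lebesgue_on \<Xi>) (\<lambda>x. (norm (\<omega> x))\<^sup>2)}"

definition L2_inner :: "'n space set \<Rightarrow> 'n::finite form \<Rightarrow> 'n form \<Rightarrow> real" where
  "L2_inner \<Xi> \<omega> \<mu> = (LINT x|lebesgue_on \<Xi>. \<omega> x \<bullet> \<mu> x)"

definition has_weak_d :: "'n space set \<Rightarrow> nat \<Rightarrow> 'n::{finite,linorder} form \<Rightarrow> 'n form \<Rightarrow> bool" where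
  "has_weak_d \<Xi> k \<omega> \<eta> \<longleftrightarrow> \<omega> \<in> L2 \<Xi> k \<and> \<eta> \<in> L2 \<Xi> (k + 1) \<and>
     (\<forall>\<phi>\<in>test_forms \<Xi> (k + 1). L2_inner \<Xi> \<eta> \<phi> = L2_inner \<Xi> \<omega> (codiff (k + 1) \<phi>))"

text \<open>A representative of the weak exterior derivative; it is unique up to null sets.
  For $k = n$ it vanishes on \<open>\<Xi>\<close>, because \<open>Alt (n + 1) = {0}\<close>.\<close>

definition weak_d :: "'n space set \<Rightarrow> nat \<Rightarrow> 'n::{finite,linorder} form \<Rightarrow> 'n form" where
  "weak_d \<Xi> k \<omega> = (SOME \<eta>. has_weak_d \<Xi> k \<omega> \<eta>)"

definition has_weak_codiff :: "'n space set \<Rightarrow> nat \<Rightarrow> 'n::{finite,linorder} form \<Rightarrow> 'n form \<Rightarrow> bool" where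
  "has_weak_codiff \<Xi> k \<mu> \<nu> \<longleftrightarrow> \<mu> \<in> L2 \<Xi> k \<and> \<nu> \<in> L2 \<Xi> (k - 1) \<and>
     (\<exists>\<eta>. has_weak_d \<Xi> (CARD('n) - k) (\<lambda>x. hodge (\<mu> x)) \<eta> \<and>
          \<nu> = (\<lambda>x. codiff_sign TYPE('n) k *\<^sub>R hodge (\<eta> x)))"

definition weak_codiff :: "'n space set \<Rightarrow> nat \<Rightarrow> 'n::{finite,linorder} form \<Rightarrow> 'n form" where
  "weak_codiff \<Xi> k \<mu> = (SOME \<nu>. has_weak_codiff \<Xi> k \<mu> \<nu>)"

definition H :: "'n space set \<Rightarrow> nat \<Rightarrow> ('n::{finite,linorder} form) set" where
  "H \<Xi> k = {\<omega> \<in> L2 \<Xi> k. \<exists>\<eta>. has_weak_d \<Xi> k \<omega> \<eta>}"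

definition Hstar :: "'n space set \<Rightarrow> nat \<Rightarrow> ('n::{finite,linorder} form) set" where
  "Hstar \<Xi> k = {\<mu> \<in> L2 \<Xi> k. \<exists>\<nu>. has_weak_codiff \<Xi> k \<mu> \<nu>}"

definition graph_norm ::
  "'n space set \<Rightarrow> ('n::finite form \<Rightarrow> 'n form) \<Rightarrow> 'n form \<Rightarrow> real" where
  "graph_norm \<Xi> D \<omega> = sqrt (L2_inner \<Xi> \<omega> \<omega> + L2_inner \<Xi> (D \<omega>) (D \<omega>))"

definition H0 :: "'n space set \<Rightarrow> nat \<Rightarrow> ('n::{finite,linorder} form) set" where
  "H0 \<Xi> k = {\<omega> \<in> H \<Xi> k. \<forall>e>0. \<exists>\<phi>\<in>test_forms \<Xi> k.
     graph_norm \<Xi> (weak_d \<Xi> k) (\<lambda>x. \<omega> x - \<phi> x) < e}"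

definition H0star :: "'n space set \<Rightarrow> nat \<Rightarrow> ('n::{finite,linorder} form) set" where
  "H0star \<Xi> k = {\<mu> \<in> Hstar \<Xi> k. \<forall>e>0. \<exists>\<phi>\<in>test_forms \<Xi> k.
     graph_norm \<Xi> (weak_codiff \<Xi> k) (\<lambda>x. \<mu> x - \<phi> x) < e}"

section \<open>Cubical meshes\<close>

text \<open>
  The cells are open boxes, so that they are themselves domains of forms; the closed boxes
  subdivide the closure of \<open>\<Omega>\<close>, and two of them meet in a common (possibly empty) face.
\<close>

definition cubical_mesh :: "'n::finite space set \<Rightarrow> 'n space set set \<Rightarrow> bool" where
  "cubical_mesh \<Omega> G \<longleftrightarrow> finite G \<and>
     (\<forall>K\<in>G. K \<noteq> {} \<and> K \<subseteq> \<Omega> \<and> (\<exists>a b. K = box a b)) \<and>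
     pairwise disjnt G \<and>
     \<Union> (closure ` G) = closure \<Omega> \<and>
     (\<forall>K\<in>G. \<forall>L\<in>G. (closure K \<inter> closure L) face_of closure K \<and>
                    (closure K \<inter> closure L) face_of closure L)"

text \<open>Cell by cell application of a family of operators; the value off the cells is irrelevant.\<close>

definition cellwise :: "'n space set set \<Rightarrow> ('n space set \<Rightarrow> 'n::finite form \<Rightarrow> 'n form) \<Rightarrow>
    'n form \<Rightarrow> 'n form" where
  "cellwise G F \<omega> x = (\<Sum>K\<in>G. indicat_real K x *\<^sub>R F K \<omega> x)"

definition d_h :: "'n space set set \<Rightarrow> nat \<Rightarrow> 'n::{finite,linorder} form \<Rightarrow> 'n form" where
  "d_h G k = cellwise G (\<lambda>K. weak_d K k)"

section \<open>Local spaces\<close>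

definition P0 :: "nat \<Rightarrow> ('n::finite form) set" where
  "P0 k = {(\<lambda>x. u) |u. u \<in> Alt k}"

definition P1minus :: "nat \<Rightarrow> ('n::{finite,linorder} form) set" where
  "P1minus k = {(\<lambda>x. u + koszul x v) |u v. u \<in> Alt k \<and> v \<in> Alt (k + 1)}"

definition P1star :: "nat \<Rightarrow> ('n::{finite,linorder} form) set" where
  "P1star k = (\<lambda>\<omega> x. hodge (\<omega> x)) ` P1minus (CARD('n) - k)"

text \<open>$\bigotimes_i \mathcal{P}_{r_i}$: finite sums of products of univariate polynomials.\<close>

definition tensor_poly :: "('n::finite \<Rightarrow> nat) \<Rightarrow> (real ^ 'n \<Rightarrow> real) set" where
  "tensor_poly r = {(\<lambda>x. \<Sum>j<m. \<Prod>i\<in>UNIV. poly (p j i) (x $ i)) |(m::nat) p.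
     \<forall>j<m. \<forall>i. degree (p j i) \<le> r i}"

definition Q1minus :: "nat \<Rightarrow> ('n::finite form) set" where
  "Q1minus k = {\<omega>. (\<forall>x. \<omega> x \<in> Alt k) \<and>
     (\<forall>S. card S = k \<longrightarrow> (\<lambda>x. \<omega> x $ S) \<in> tensor_poly (\<lambda>i. 1 - (if i \<in> S then 1 else 0)))}"

definition Q1star :: "nat \<Rightarrow> ('n::{finite,linorder} form) set" where
  "Q1star k = (\<lambda>\<omega> x. hodge (\<omega> x)) ` Q1minus (CARD('n) - k)"

definition restr_in :: "'n space set \<Rightarrow> 'n::finite form \<Rightarrow> ('n form) set \<Rightarrow> bool" where
  "restr_in K \<omega> F \<longleftrightarrow> (\<exists>q\<in>F. eq_on K \<omega> q)"

section \<open>Interpolation\<close>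

text \<open>Polynomial forms are determined by their values on a box, so the interpolant is
  a unique function on the whole of Euclidean space.\<close>

definition local_interp :: "nat \<Rightarrow> 'n space set \<Rightarrow> 'n::{finite,linorder} form \<Rightarrow> 'n form" where
  "local_interp k K \<omega> =
     (if k < CARD('n) then
        (THE p. p \<in> P1minus k \<and> (\<forall>\<mu>\<in>P1star (k + 1).
           L2_inner K (weak_d K k p) \<mu> - L2_inner K p (weak_codiff K (k + 1) \<mu>) =
           L2_inner K (weak_d K k \<omega>) \<mu> - L2_inner K \<omega> (weak_codiff K (k + 1) \<mu>)))
      else (THE p. p \<in> P0 k \<and> (\<forall>q\<in>P0 k. L2_inner K p q = L2_inner K \<omega> q)))"

definition interp :: "'n space set set \<Rightarrow> nat \<Rightarrow> 'n::{finite,linorder} form \<Rightarrow> 'n form" where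
  "interp G k = cellwise G (local_interp k)"

section \<open>Global spaces\<close>

text \<open>The product of the local spaces, realised as piecewise polynomial elements of
  $L^2\Lambda^k(\Omega)$; the union of the cells has full measure in \<open>\<Omega>\<close>.\<close>

definition P1minus_h :: "'n space set \<Rightarrow> 'n space set set \<Rightarrow> nat \<Rightarrow> ('n::{finite,linorder} form) set" where
  "P1minus_h \<Omega> G k = {\<omega> \<in> L2 \<Omega> k. \<forall>K\<in>G. restr_in K \<omega> (P1minus k)}"

definition VQ :: "'n space set \<Rightarrow> 'n space set set \<Rightarrow> nat \<Rightarrow> ('n::{finite,linorder} form) set" where
  "VQ \<Omega> G k = {\<omega> \<in> H \<Omega> k. \<forall>K\<in>G. restr_in K \<omega> (Q1minus k)}"

definition VQ0 :: "'n space set \<Rightarrow> 'n space set set \<Rightarrow> nat \<Rightarrow> ('n::{finite,linorder} form) set" where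
  "VQ0 \<Omega> G k = {\<omega> \<in> H0 \<Omega> k. \<forall>K\<in>G. restr_in K \<omega> (Q1minus k)}"

definition VQstar :: "'n space set \<Rightarrow> 'n space set set \<Rightarrow> nat \<Rightarrow> ('n::{finite,linorder} form) set" where
  "VQstar \<Omega> G k = {\<mu> \<in> Hstar \<Omega> k. \<forall>K\<in>G. restr_in K \<mu> (Q1star k)}"

definition VQ0star :: "'n space set \<Rightarrow> 'n space set set \<Rightarrow> nat \<Rightarrow> ('n::{finite,linorder} form) set" where
  "VQ0star \<Omega> G k = {\<mu> \<in> H0star \<Omega> k. \<forall>K\<in>G. restr_in K \<mu> (Q1star k)}"

text \<open>The annihilator condition is void for $k = n$.\<close>

definition W_of :: "'n space set \<Rightarrow> 'n space set set \<Rightarrow> (nat \<Rightarrow> ('n form) set) \<Rightarrow> nat \<Rightarrow>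
    ('n::{finite,linorder} form) set" where
  "W_of \<Omega> G V k = {\<omega> \<in> P1minus_h \<Omega> G k. k < CARD('n) \<longrightarrow> (\<forall>\<mu>\<in>V (k + 1).
     (\<Sum>K\<in>G. L2_inner K (weak_d K k \<omega>) \<mu> - L2_inner K \<omega> (weak_codiff \<Omega> (k + 1) \<mu>)) = 0)}"

definition Wdef :: "'n space set \<Rightarrow> 'n space set set \<Rightarrow> nat \<Rightarrow> ('n::{finite,linorder} form) set" where
  "Wdef \<Omega> G = W_of \<Omega> G (VQ0star \<Omega> G)"

definition Wdef0 :: "'n space set \<Rightarrow> 'n space set set \<Rightarrow> nat \<Rightarrow> ('n::{finite,linorder} form) set" where
  "Wdef0 \<Omega> G = W_of \<Omega> G (VQstar \<Omega> G)"

section \<open>Complexes and diagrams\<close>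

definition const_form :: "real \<Rightarrow> 'n::finite form" where
  "const_form c = (\<lambda>x. c *\<^sub>R dx {})"

text \<open>The complex $V^0\to V^1\to\dots\to V^n\to 0$, with arrows \<open>D k\<close>.\<close>

definition is_complex :: "'n space set \<Rightarrow> (nat \<Rightarrow> ('n::finite form) set) \<Rightarrow>
    (nat \<Rightarrow> 'n form \<Rightarrow> 'n form) \<Rightarrow> bool" where
  "is_complex \<Omega> V D \<longleftrightarrow>
     (\<forall>k<CARD('n). D k \<in> V k \<rightarrow> V (k + 1)) \<and>
     (\<forall>\<omega>\<in>V CARD('n). eq_on \<Omega> (D CARD('n) \<omega>) (\<lambda>x. 0)) \<and>
     (\<forall>k<CARD('n). \<forall>\<omega>\<in>V k. eq_on \<Omega> (D (k + 1) (D k \<omega>)) (\<lambda>x. 0))"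

text \<open>The part $\mathbb{R}\to V^0\to V^1$ of the augmented complex.\<close>

definition is_augmented :: "'n space set \<Rightarrow> (nat \<Rightarrow> ('n::finite form) set) \<Rightarrow>
    (nat \<Rightarrow> 'n form \<Rightarrow> 'n form) \<Rightarrow> bool" where
  "is_augmented \<Omega> V D \<longleftrightarrow>
     (\<forall>c. const_form c \<in> V 0 \<and> eq_on \<Omega> (D 0 (const_form c)) (\<lambda>x. 0))"

definition is_cochain_map :: "'n space set \<Rightarrow>
    (nat \<Rightarrow> ('n::finite form) set) \<Rightarrow> (nat \<Rightarrow> 'n form \<Rightarrow> 'n form) \<Rightarrow>
    (nat \<Rightarrow> ('n form) set) \<Rightarrow> (nat \<Rightarrow> 'n form \<Rightarrow> 'n form) \<Rightarrow>
    (nat \<Rightarrow> 'n form \<Rightarrow> 'n form) \<Rightarrow> bool" where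
  "is_cochain_map \<Omega> V D W D' I \<longleftrightarrow>
     (\<forall>k\<le>CARD('n). I k \<in> V k \<rightarrow> W k) \<and>
     (\<forall>k<CARD('n). \<forall>\<omega>\<in>V k. eq_on \<Omega> (I (k + 1) (D k \<omega>)) (D' k (I k \<omega>)))"

end

theory Submission
  imports Defs
begin

text \<open>
  Three observations carry the proof.

  \<^bold>\<open>On a cell.\<close> Let \<open>c\<close> be the centre of a box \<open>K\<close>. The coefficients of a form in \<open>Q1minus k\<close> and
  those of a form in \<open>Q1star k\<close> belonging to the same basis element are affine in complementary sets of
  coordinates, so their product has degree at most one in each coordinate, and the integral of such a
  function over \<open>K\<close> is $|K|$ times its value at \<open>c\<close> (\<open>integral_tensor_poly\<close>,
  \<open>L2_inner_Q1minus_Q1star\<close>). As $d$ and $\delta$ preserve the two families, the pairing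
  $\langle dq,m\rangle_K-\langle q,\delta m\rangle_K$ equals
  $|K|\,(dq(c)\cdot m(c)-q(c)\cdot\delta m(c))$ (\<open>cell_pairing\<close>). Hence the interpolant of \<open>q\<close> is the
  unique Whitney form \<open>p\<close> with $p(c)=q(c)$ and $dp(c)=dq(c)$ (\<open>local_interp_characterisation\<close>), and
  replacing \<open>q\<close> by \<open>p\<close> does not change the pairing with any \<open>m\<close> in \<open>Q1star (k + 1)\<close>, although the
  definition of the interpolant tests only against the smaller space \<open>P1star (k + 1)\<close>.

  \<^bold>\<open>The vertical arrows.\<close> The sum over the cells of the pairings of \<open>\<omega>\<close> with \<open>\<mu>\<close> is
  $\langle d\omega,\mu\rangle_\Omega-\langle\omega,\delta\mu\rangle_\Omega$, which vanishes as soon as one of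
  the two forms is a limit of test forms (\<open>Green_H_H0star\<close>, \<open>Green_H0_Hstar\<close>). So interpolation maps
  into the annihilator spaces. The squares commute because on each cell both paths produce the constant
  form $dq(c)$ (\<open>is_cochain_map_interp\<close>).

  \<^bold>\<open>The lower rows.\<close> On Whitney forms $d_h\omega$ is piecewise constant. Up to sign, pairing $d_h\omega$ with
  \<open>\<mu>\<close> is pairing \<open>\<omega>\<close> with $\delta\mu$, because $d_hd_h\omega=0$ and $\delta\delta\mu=0$; and $\delta\mu$
  is again an admissible test form (\<open>is_complex_d_h\<close>).

  The weak operators are choices of representatives. To compute with them one needs their uniqueness up
  to null sets, that is the fundamental lemma of the calculus of variations, and their agreement with
  the classical operators on smooth forms, that is integration by parts. The former needs smooth bump
  functions, and $d\circ d=0$ for weak derivatives needs the symmetry of the second derivatives of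
  test forms.
\<close>

section \<open>Contraction, Hodge star and Koszul operator in coordinates\<close>

text \<open>
  The sign of $dx^i\wedge dx^S$ relative to $dx^{S\cup\{i\}}$, for $i\notin S$.
\<close>

definition isgn :: "'n::{finite,linorder} \<Rightarrow> 'n set \<Rightarrow> real" where
  "isgn i S = (-1) ^ card {j \<in> S. j < i}"

text \<open>
  The interior product with the \<open>i\<close>-th coordinate vector. It is the adjoint of the multiplication
  \<open>wedge (dx {i})\<close>, and both the Koszul operator and the codifferential are combinations of these maps.
\<close>

definition contr :: "'n::{finite,linorder} \<Rightarrow> 'n ext \<Rightarrow> 'n ext" where
  "contr i u = (\<chi> S. if i \<in> S then 0 else isgn i S * u $ insert i S)"

lemma contr_nth: "contr i u $ S = (if i \<in> S then 0 else isgn i S * u $ insert i S)"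
  by (simp add: contr_def)

lemma isgn_mult_self [simp]: "isgn i S * isgn i S = 1"
  unfolding isgn_def by (simp flip: power_mult_distrib)

lemma shuffle_sign_mult_self [simp]: "shuffle_sign S T * shuffle_sign S T = 1"
  unfolding shuffle_sign_def by (simp flip: power_mult_distrib)

lemma shuffle_sign_singleton: "shuffle_sign {i} T = isgn i T"
proof -
  have "{(a, j). a \<in> {i} \<and> j \<in> T \<and> j < a} = Pair i ` {j \<in> T. j < i}" by auto
  then show ?thesis unfolding shuffle_sign_def isgn_def by (simp add: card_image inj_on_def)
qed

lemma shuffle_sign_Un_left:
  assumes "S \<inter> S' = {}"
  shows "shuffle_sign (S \<union> S') T = shuffle_sign S T * shuffle_sign S' T"
proof -
  have "{(i, j). i \<in> S \<union> S' \<and> j \<in> T \<and> j < i} =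
    {(i, j). i \<in> S \<and> j \<in> T \<and> j < i} \<union> {(i, j). i \<in> S' \<and> j \<in> T \<and> j < i}" by auto
  moreover have "{(i, j). i \<in> S \<and> j \<in> T \<and> j < i} \<inter> {(i, j). i \<in> S' \<and> j \<in> T \<and> j < i} = {}"
    using assms by auto
  ultimately show ?thesis unfolding shuffle_sign_def by (simp add: card_Un_disjoint power_add)
qed

lemma shuffle_sign_swap:
  assumes "S \<inter> T = {}"
  shows "shuffle_sign S T * shuffle_sign T S = (-1) ^ (card S * card T)"
proof -
  define X where "X = {(i, j). i \<in> S \<and> j \<in> T \<and> j < i}"
  define Y where "Y = {(i, j). i \<in> S \<and> j \<in> T \<and> i < j}"
  have "bij_betw prod.swap {(i, j). i \<in> T \<and> j \<in> S \<and> j < i} Y"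
    unfolding Y_def by (rule bij_betwI[where g = prod.swap]) auto
  then have 1: "card {(i, j). i \<in> T \<and> j \<in> S \<and> j < i} = card Y"
    by (rule bij_betw_same_card)
  have "S \<times> T = X \<union> Y"
  proof (rule set_eqI, clarify)
    fix i j
    show "(i, j) \<in> S \<times> T \<longleftrightarrow> (i, j) \<in> X \<union> Y"
      using assms linorder_less_linear[of i j] by (auto simp: X_def Y_def)
  qed
  then have "card S * card T = card (X \<union> Y)"
    by (simp flip: card_cartesian_product)
  also have "\<dots> = card X + card Y"
    by (rule card_Un_disjoint) (auto simp: X_def Y_def)
  finally show ?thesis unfolding shuffle_sign_def 1 X_def[symmetric] by (simp add: power_add)
qed

lemma dx_nth: "dx S $ T = (if T = S then 1 else 0)"
  by (simp add: dx_def axis_def)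

lemma wedge_dx_nth:
  "wedge (dx {i}) u $ T = (if i \<in> T then isgn i (T - {i}) * u $ (T - {i}) else 0)"
proof -
  have "wedge (dx {i}) u = (\<Sum>R\<in>UNIV. if {i} \<inter> R = {} then (u $ R * shuffle_sign {i} R) *\<^sub>R dx ({i} \<union> R) else 0)"
  proof -
    have "(\<Sum>T\<in>UNIV. if S \<inter> T = {} then (dx {i} $ S * u $ T * shuffle_sign S T) *\<^sub>R dx (S \<union> T) else 0) =
      (if S = {i} then (\<Sum>R\<in>UNIV. if {i} \<inter> R = {} then (u $ R * shuffle_sign {i} R) *\<^sub>R dx ({i} \<union> R) else 0) else 0)" for S
      by (cases "S = {i}") (simp_all add: dx_nth cong: if_cong)
    then show ?thesis unfolding wedge_def by simp
  qed
  then have "wedge (dx {i}) u $ T = (\<Sum>R\<in>UNIV. if i \<notin> R \<and> T = insert i R then u $ R * isgn i R else 0)"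
    by (auto simp: sum_component dx_nth shuffle_sign_singleton intro!: sum.cong)
  also have "\<dots> = (\<Sum>R\<in>UNIV. if R = T - {i} then (if i \<in> T then u $ R * isgn i R else 0) else 0)"
    by (intro sum.cong) auto
  finally show ?thesis by (simp add: mult.commute)
qed

lemma hodge_nth: "hodge u $ S = u $ (- S) * shuffle_sign (- S) S"
proof -
  have "hodge u $ S = (\<Sum>T\<in>UNIV. if T = - S then u $ T * shuffle_sign T (- T) else 0)"
    unfolding hodge_def sum_component by (intro sum.cong) (auto simp: dx_nth)
  then show ?thesis by simp
qed

lemma koszul_eq: "koszul x u = (\<Sum>i\<in>UNIV. x $ i *\<^sub>R contr i u)"
proof (rule vec_eq_iff[THEN iffD2], rule allI)
  fix S
  have "koszul x u $ S = (\<Sum>T\<in>UNIV. \<Sum>i\<in>UNIV. if i \<in> T \<and> S = T - {i} then u $ T * isgn i T * x $ i else 0)"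
    unfolding koszul_def isgn_def[symmetric] sum_component
  proof (intro sum.cong refl)
    fix T :: "'a set"
    have "(\<Sum>i\<in>T. (isgn' i T * x $ i) *\<^sub>R dx (T - {i})) $ S = (\<Sum>i\<in>UNIV. if i \<in> T \<and> S = T - {i} then isgn' i T * x $ i else 0)" for isgn'
      unfolding sum_component by (rule sum.mono_neutral_cong_left) (auto simp: dx_nth)
    then show "(u $ T *\<^sub>R (\<Sum>i\<in>T. (isgn i T * x $ i) *\<^sub>R dx (T - {i}))) $ S = (\<Sum>i\<in>UNIV. if i \<in> T \<and> S = T - {i} then u $ T * isgn i T * x $ i else 0)"
      by (simp add: sum_distrib_left if_distrib mult.assoc cong: if_cong)
  qed
  also have "\<dots> = (\<Sum>i\<in>UNIV. \<Sum>T\<in>UNIV. if i \<in> T \<and> S = T - {i} then u $ T * isgn i T * x $ i else 0)"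
    by (rule sum.swap)
  also have "\<dots> = (\<Sum>i\<in>UNIV. \<Sum>T\<in>UNIV. if T = insert i S then (if i \<in> S then 0 else u $ T * isgn i T * x $ i) else 0)"
    by (intro sum.cong) auto
  also have "\<dots> = (\<Sum>i\<in>UNIV. if i \<in> S then 0 else u $ insert i S * isgn i S * x $ i)"
  proof -
    have "{j. (j = i \<or> j \<in> S) \<and> j < i} = {j \<in> S. j < i}" for i by auto
    then have "isgn i (insert i S) = isgn i S" for i by (simp add: isgn_def)
    then show ?thesis by (auto intro!: sum.cong)
  qed
  finally show "koszul x u $ S = (\<Sum>i\<in>UNIV. x $ i *\<^sub>R contr i u) $ S"
    by (auto simp: sum_component contr_nth algebra_simps intro!: sum.cong)
qed

lemma wedge_contr_adjoint: "wedge (dx {i}) u \<bullet> v = u \<bullet> contr i v"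
proof -
  have "wedge (dx {i}) u \<bullet> v = (\<Sum>T\<in>{T. i \<in> T}. isgn i (T - {i}) * u $ (T - {i}) * v $ T)"
    unfolding inner_vec_def by (rule sum.mono_neutral_cong_right) (auto simp: wedge_dx_nth)
  also have "\<dots> = (\<Sum>S\<in>{S. i \<notin> S}. u $ S * (isgn i S * v $ insert i S))"
    by (rule sum.reindex_bij_witness[where i = "insert i" and j = "\<lambda>T. T - {i}"])
      (auto simp: insert_absorb)
  also have "\<dots> = u \<bullet> contr i v"
    unfolding inner_vec_def by (rule sum.mono_neutral_cong_left) (auto simp: contr_nth)
  finally show ?thesis .
qed

lemma linear_wedge_dx: "linear (wedge (dx {i}))"
  by (rule linearI) (auto simp: vec_eq_iff wedge_dx_nth algebra_simps)

lemma linear_contr: "linear (contr i)"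
  by (rule linearI) (auto simp: vec_eq_iff contr_nth algebra_simps)

lemma linear_hodge: "linear hodge"
  by (rule linearI) (auto simp: vec_eq_iff hodge_nth algebra_simps)

lemmas contr_linear = linear_0[OF linear_contr] linear_add[OF linear_contr]
  linear_diff[OF linear_contr] linear_cmul[OF linear_contr] linear_sum[OF linear_contr]
  linear_neg[OF linear_contr]

lemmas hodge_linear = linear_0[OF linear_hodge] linear_add[OF linear_hodge]
  linear_diff[OF linear_hodge] linear_cmul[OF linear_hodge] linear_sum[OF linear_hodge]
  linear_neg[OF linear_hodge]

lemmas wedge_dx_linear = linear_0[OF linear_wedge_dx] linear_add[OF linear_wedge_dx]
  linear_diff[OF linear_wedge_dx] linear_cmul[OF linear_wedge_dx] linear_sum[OF linear_wedge_dx]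
  linear_neg[OF linear_wedge_dx]

lemma contr_anticomm: "contr i (contr j u) = - contr j (contr i u)"
proof -
  have ins: "isgn i (insert j S) = (if j < i then - isgn i S else isgn i S)" if "j \<notin> S" for i j :: 'a and S
  proof (cases "j < i")
    case True
    then have "{a \<in> insert j S. a < i} = insert j {a \<in> S. a < i}" by auto
    then show ?thesis using that True by (simp add: isgn_def)
  next
    case False
    then have "{a \<in> insert j S. a < i} = {a \<in> S. a < i}" by auto
    then show ?thesis using False by (simp add: isgn_def)
  qed
  show ?thesis
    by (auto simp: vec_eq_iff contr_nth ins insert_commute not_less_iff_gr_or_eq
        dest: less_asym)
qed

text \<open>
  Applied to second derivatives, this gives $\delta\circ\delta=0$.
\<close>

lemma sum_contr_contr_symmetric:
  assumes "\<And>i j. w i j = w j i"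
  shows "(\<Sum>i\<in>UNIV. \<Sum>j\<in>UNIV. contr i (contr j (w i j))) = 0"
proof -
  have "(\<Sum>i\<in>UNIV. \<Sum>j\<in>UNIV. contr i (contr j (w i j))) = (\<Sum>j\<in>UNIV. \<Sum>i\<in>UNIV. contr i (contr j (w i j)))"
    by (rule sum.swap)
  also have "\<dots> = - (\<Sum>j\<in>UNIV. \<Sum>i\<in>UNIV. contr j (contr i (w j i)))"
    unfolding sum_negf[symmetric] by (intro sum.cong refl) (metis assms contr_anticomm)
  finally show ?thesis unfolding eq_neg_iff_add_eq_0 scaleR_2[symmetric] by simp
qed

lemma sum_wedge_contr:
  assumes "u \<in> Alt k"
  shows "(\<Sum>i\<in>UNIV. wedge (dx {i}) (contr i u)) = real k *\<^sub>R u"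
proof (rule vec_eq_iff[THEN iffD2], rule allI)
  fix T
  have "(\<Sum>i\<in>UNIV. wedge (dx {i}) (contr i u)) $ T = (\<Sum>i\<in>UNIV. if i \<in> T then u $ T else 0)"
    by (auto simp: sum_component wedge_dx_nth contr_nth insert_absorb intro!: sum.cong)
  also have "\<dots> = real (card T) * u $ T" by (simp add: sum.If_cases)
  finally show "(\<Sum>i\<in>UNIV. wedge (dx {i}) (contr i u)) $ T = (real k *\<^sub>R u) $ T"
    using assms by (auto simp: Alt_def)
qed

lemma subspace_Alt: "subspace (Alt k)"
  by (auto simp: subspace_def Alt_def)

lemmas Alt_closed [intro] = subspace_0[OF subspace_Alt] subspace_add[OF subspace_Alt]
  subspace_diff[OF subspace_Alt] subspace_scale[OF subspace_Alt] subspace_sum[OF subspace_Alt]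
  subspace_neg[OF subspace_Alt]

lemma wedge_dx_Alt: "u \<in> Alt k \<Longrightarrow> wedge (dx {i}) u \<in> Alt (k + 1)"
  by (auto simp: Alt_def wedge_dx_nth) (metis One_nat_def Suc_pred add.commute card_Diff_singleton card_gt_0_iff empty_iff finite plus_1_eq_Suc)

lemma contr_Alt: "u \<in> Alt (k + 1) \<Longrightarrow> contr i u \<in> Alt k"
  by (auto simp: Alt_def contr_nth)

lemma koszul_Alt: "u \<in> Alt (k + 1) \<Longrightarrow> koszul x u \<in> Alt k"
  unfolding koszul_eq by (intro Alt_closed contr_Alt)

lemma card_compl: "card (- S :: 'n::finite set) = CARD('n) - card S"
  by (simp add: Compl_eq_Diff_UNIV card_Diff_subset)

lemma card_le_CARD: "card (S :: 'n::finite set) \<le> CARD('n)"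
  by (simp add: card_mono)

lemma hodge_Alt: "(u :: 'n::{finite,linorder} ext) \<in> Alt k \<Longrightarrow> hodge u \<in> Alt (CARD('n) - k)"
  by (auto simp: Alt_def hodge_nth card_compl) (metis card_compl card_le_CARD diff_diff_cancel double_complement)

lemma Alt_trivial: "(u :: 'n::finite ext) \<in> Alt k \<Longrightarrow> CARD('n) < k \<Longrightarrow> u = 0"
  by (auto simp: Alt_def vec_eq_iff) (metis card_le_CARD leD)

lemma hodge_hodge:
  assumes "(u :: 'n::{finite,linorder} ext) \<in> Alt k"
  shows "hodge (hodge u) = (-1) ^ (k * (CARD('n) - k)) *\<^sub>R u"
proof (rule vec_eq_iff[THEN iffD2], rule allI)
  fix S :: "'n set"
  have "hodge (hodge u) $ S = u $ S * (shuffle_sign S (- S) * shuffle_sign (- S) S)"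
    by (simp add: hodge_nth)
  also have "shuffle_sign S (- S) * shuffle_sign (- S) S = (-1) ^ (card S * (CARD('n) - card S))"
    by (subst shuffle_sign_swap) (auto simp: card_compl)
  finally show "hodge (hodge u) $ S = ((-1) ^ (k * (CARD('n) - k)) *\<^sub>R u) $ S"
    using assms by (cases "card S = k") (auto simp: Alt_def)
qed

lemma inner_hodge: "hodge u \<bullet> hodge v = u \<bullet> v"
proof -
  have "hodge u \<bullet> hodge v = (\<Sum>S\<in>UNIV. u $ (- S) * v $ (- S))"
    unfolding inner_vec_def by (intro sum.cong refl) (simp add: hodge_nth algebra_simps)
  also have "\<dots> = (\<Sum>S\<in>UNIV. u $ S * v $ S)"
    by (rule sum.reindex_bij_witness[where i = uminus and j = uminus]) auto
  finally show ?thesis by (simp add: inner_vec_def)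
qed

lemma norm_hodge: "norm (hodge u) = norm u"
  by (simp add: norm_eq_sqrt_inner inner_hodge)

lemma codiff_sign_sq [simp]: "codiff_sign t k * codiff_sign t k = 1"
  unfolding codiff_sign_def by (simp flip: power_mult_distrib)

text \<open>
  The algebraic core of the identity $\delta=-\sum_i\iota_i\partial_i$ on \<open>k\<close>-forms, where
  $\iota_i$ is the contraction: with the sign of the codifferential, the conjugate of the exterior
  multiplication by the Hodge star is minus the contraction.
\<close>

lemma codiff_sign_hodge:
  fixes w :: "'n::{finite,linorder} \<Rightarrow> 'n ext"
  assumes "\<And>i. w i \<in> Alt k" "0 < k"
  shows "codiff_sign TYPE('n) k *\<^sub>R hodge (\<Sum>i\<in>UNIV. wedge (dx {i}) (hodge (w i))) = - (\<Sum>i\<in>UNIV. contr i (w i))"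
proof (rule vec_eq_iff[THEN iffD2], rule allI)
  fix R :: "'n set"
  have *: "codiff_sign TYPE('n) k * (shuffle_sign (- R) R * (isgn i (- R - {i}) * (shuffle_sign (- (- R - {i})) (- R - {i}) * w i $ (- (- R - {i}))))) =
     - (isgn i R * w i $ insert i R)" if "i \<notin> R" for i
  proof (cases "card R = k - 1")
    case False
    then have "card (insert i R) \<noteq> k" using that assms(2) by auto
    moreover have "- (- R - {i}) = insert i R" by auto
    ultimately show ?thesis using assms(1)[of i] by (simp add: Alt_def)
  next
    case True
    \<comment> \<open>The basis element $dx^R$ arises from $dx^{R\cup\{i\}}$ by removing \<open>i\<close>; the star of the latter is a multiple of $dx^A$.\<close>
    define A where "A = - R - {i}"
    have R: "- R = {i} \<union> A" "- A = {i} \<union> R" "{i} \<inter> A = {}" "{i} \<inter> R = {}" "A \<inter> R = {}"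
      using that by (auto simp: A_def)
    have "CARD('n) - card R = card (- R)" by (simp add: card_compl)
    also have "\<dots> = 1 + card A" using R by simp
    finally have cA: "CARD('n) = card A + k" using True assms(2) card_le_CARD[of R] by simp
    have "shuffle_sign (- R) R * (isgn i A * (shuffle_sign (- A) A)) =
       isgn i R * (shuffle_sign A R * shuffle_sign R A)"
      unfolding R shuffle_sign_Un_left[OF R(3)] shuffle_sign_Un_left[OF R(4)] shuffle_sign_singleton
      by (simp add: mult_ac)
    also have "shuffle_sign A R * shuffle_sign R A = (-1) ^ (card A * (k - 1))"
      using shuffle_sign_swap[OF R(5)] True by simp
    finally have e: "shuffle_sign (- R) R * (isgn i A * (shuffle_sign (- A) A)) = isgn i R * (-1) ^ (card A * (k - 1))" .
    obtain m where m: "k = Suc m" using assms(2) by (cases k) auto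
    have "(-1 :: real) ^ (CARD('n) * (k + 1) + 1) * (-1) ^ (card A * (k - 1)) = -1"
      unfolding cA m power_add[symmetric] by (auto simp: uminus_power_if)
    then have "codiff_sign TYPE('n) k * (shuffle_sign (- R) R * (isgn i A * (shuffle_sign (- A) A))) = - isgn i R"
      unfolding e codiff_sign_def by (metis mult.left_commute mult_minus1_right)
    moreover have "- A = insert i R" using R by auto
    ultimately show ?thesis unfolding A_def[symmetric]
      by (metis (no_types, lifting) mult.assoc mult_minus_left)
  qed
  show "(codiff_sign TYPE('n) k *\<^sub>R hodge (\<Sum>i\<in>UNIV. wedge (dx {i}) (hodge (w i)))) $ R = (- (\<Sum>i\<in>UNIV. contr i (w i))) $ R"
    unfolding vector_scaleR_component real_scaleR_def hodge_nth sum_component vector_uminus_component sum_distrib_right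
      sum_distrib_left sum_negf[symmetric]
  proof (intro sum.cong refl)
    fix i
    show "codiff_sign TYPE('n) k * (wedge (dx {i}) (hodge (w i)) $ (- R) * shuffle_sign (- R) R) = - (contr i (w i) $ R)"
      using *[of i] by (auto simp: wedge_dx_nth hodge_nth contr_nth mult_ac)
  qed
qed

section \<open>Differential calculus of smooth functions\<close>

text \<open>
  The partial derivative in the \<open>i\<close>-th coordinate direction.
\<close>

definition pderivative :: "'n::finite \<Rightarrow> ('n space \<Rightarrow> 'b::real_normed_vector) \<Rightarrow> 'n space \<Rightarrow> 'b" where
  "pderivative i f x = frechet_derivative f (at x) (axis i 1)"

lemma frechet_derivativeI: "(f has_derivative f') (at x) \<Longrightarrow> frechet_derivative f (at x) = f'"
  using frechet_derivative_at by force

lemma Ck_Suc_has_derivative: "Ck (Suc m) f \<Longrightarrow> (f has_derivative frechet_derivative f (at x)) (at x)"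
  by (simp add: frechet_derivative_works)

lemma Ck_SucI:
  assumes "\<And>x. (f has_derivative f' x) (at x)" and "\<And>v. Ck m (\<lambda>x. f' x v)"
  shows "Ck (Suc m) f"
proof -
  have "frechet_derivative f (at x) = f' x" for x by (rule frechet_derivativeI[OF assms(1)])
  then show ?thesis using assms by (auto simp: differentiable_def)
qed

lemma Ck_Suc_imp_Ck: "Ck (Suc m) f \<Longrightarrow> Ck m f"
proof (induction m arbitrary: f)
  case 0
  then show ?case
    by (auto intro!: continuous_at_imp_continuous_on differentiable_imp_continuous_within)
qed auto

lemma Ck_antimono: "Ck m f \<Longrightarrow> k \<le> m \<Longrightarrow> Ck k f"
proof (induction "m - k" arbitrary: k)
  case (Suc d)
  then show ?case by (metis Ck_Suc_imp_Ck Suc_diff_Suc Suc_leI diff_Suc_Suc nat_neq_iff nat.inject zero_less_Suc zero_less_diff)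
qed simp

lemma Ck_continuous: "Ck m f \<Longrightarrow> continuous_on UNIV f"
  using Ck_antimono[of m f 0] by simp

lemma Ck_const: "Ck m (\<lambda>x. c)"
proof (induction m arbitrary: c)
  case (Suc m)
  show ?case by (rule Ck_SucI[where f' = "\<lambda>x v. 0"]) (use Suc in \<open>auto intro!: derivative_eq_intros\<close>)
qed simp

lemma Ck_bounded_linear_compose:
  assumes L: "bounded_linear L"
  shows "Ck m f \<Longrightarrow> Ck m (\<lambda>x. L (f x))"
proof (induction m arbitrary: f)
  case 0
  then show ?case using bounded_linear.continuous_on[OF L] by simp
next
  case (Suc m)
  show ?case
    by (rule Ck_SucI[where f' = "\<lambda>x v. L (frechet_derivative f (at x) v)"])
      (use Suc Ck_Suc_has_derivative[OF Suc.prems] in \<open>auto intro: bounded_linear.has_derivative[OF L]\<close>)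
qed

lemma Ck_bounded_linear: "bounded_linear L \<Longrightarrow> Ck m L"
proof (cases m)
  case 0
  assume "bounded_linear L"
  then show ?thesis using 0 by (simp add: linear_continuous_on)
next
  case (Suc m')
  assume L: "bounded_linear L"
  show ?thesis unfolding Suc
    by (rule Ck_SucI[where f' = "\<lambda>x. L"]) (auto intro: bounded_linear_imp_has_derivative L Ck_const)
qed

lemma Ck_add: "Ck m f \<Longrightarrow> Ck m g \<Longrightarrow> Ck m (\<lambda>x. f x + g x)"
proof (induction m arbitrary: f g)
  case 0
  then show ?case by (simp add: continuous_on_add)
next
  case (Suc m)
  show ?case
    by (rule Ck_SucI[where f' = "\<lambda>x v. frechet_derivative f (at x) v + frechet_derivative g (at x) v"])
      (use Suc Ck_Suc_has_derivative[OF Suc.prems(1)] Ck_Suc_has_derivative[OF Suc.prems(2)]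
        in \<open>auto intro: has_derivative_add\<close>)
qed

lemma Ck_scaleR:
  fixes f :: "'a::real_normed_vector \<Rightarrow> real"
  shows "Ck m f \<Longrightarrow> Ck m g \<Longrightarrow> Ck m (\<lambda>x. f x *\<^sub>R g x)"
proof (induction m arbitrary: f g)
  case 0
  then show ?case by (simp add: continuous_on_scaleR)
next
  case (Suc m)
  have "Ck m (\<lambda>x. f x *\<^sub>R frechet_derivative g (at x) v + frechet_derivative f (at x) v *\<^sub>R g x)" for v
    using Suc.prems Ck_Suc_imp_Ck[OF Suc.prems(1)] Ck_Suc_imp_Ck[OF Suc.prems(2)]
    by (intro Ck_add Suc.IH) auto
  then show ?case
    by (intro Ck_SucI[where f' = "\<lambda>x v. f x *\<^sub>R frechet_derivative g (at x) v + frechet_derivative f (at x) v *\<^sub>R g x"])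
      (use Ck_Suc_has_derivative[OF Suc.prems(1)] Ck_Suc_has_derivative[OF Suc.prems(2)]
        in \<open>auto intro: has_derivative_scaleR\<close>)
qed

lemma Ck_cmul: "Ck m f \<Longrightarrow> Ck m (\<lambda>x. c *\<^sub>R f x)"
  by (intro Ck_scaleR Ck_const)

lemma Ck_sum: "(\<And>i. i \<in> I \<Longrightarrow> Ck m (f i)) \<Longrightarrow> Ck m (\<lambda>x. \<Sum>i\<in>I. f i x)"
  by (induction I rule: infinite_finite_induct) (auto intro: Ck_const Ck_add)

lemma Ck_mult:
  fixes f :: "'a::real_normed_vector \<Rightarrow> real"
  shows "Ck m f \<Longrightarrow> Ck m g \<Longrightarrow> Ck m (\<lambda>x. f x * g x)"
  using Ck_scaleR[of m f g] by simp

lemma Ck_prod: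
  fixes f :: "'i \<Rightarrow> 'a::real_normed_vector \<Rightarrow> real"
  shows "(\<And>i. i \<in> I \<Longrightarrow> Ck m (f i)) \<Longrightarrow> Ck m (\<lambda>x. \<Prod>i\<in>I. f i x)"
  by (induction I rule: infinite_finite_induct) (auto intro: Ck_const Ck_mult)

lemma Ck_pderivative: "Ck (Suc m) f \<Longrightarrow> Ck m (pderivative i f)"
  by (simp add: pderivative_def[abs_def])

lemma has_derivative_along_line:
  fixes f :: "'a::real_normed_vector \<Rightarrow> real"
  assumes "Ck (Suc m) f"
  shows "((\<lambda>s. f (y + s *\<^sub>R v)) has_real_derivative frechet_derivative f (at (y + s *\<^sub>R v)) v) (at s)"
proof -
  have d: "(f has_derivative frechet_derivative f (at (y + s *\<^sub>R v))) (at (y + s *\<^sub>R v))"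
    by (rule Ck_Suc_has_derivative[OF assms])
  have "((\<lambda>s. y + s *\<^sub>R v) has_derivative (\<lambda>h. h *\<^sub>R v)) (at s)"
    by (auto intro!: derivative_eq_intros)
  then have "((\<lambda>s. f (y + s *\<^sub>R v)) has_derivative (\<lambda>h. frechet_derivative f (at (y + s *\<^sub>R v)) (h *\<^sub>R v))) (at s)"
    using d by (rule has_derivative_compose)
  moreover have "frechet_derivative f (at (y + s *\<^sub>R v)) (h *\<^sub>R v) = frechet_derivative f (at (y + s *\<^sub>R v)) v * h" for h
    using has_derivative_linear[OF d] by (simp add: linear_cmul)
  ultimately show ?thesis by (simp add: has_field_derivative_def)
qed

text \<open>
  Symmetry of second derivatives. Applying the mean value theorem twice to the second difference of \<open>f\<close>
  over a parallelogram with sides \<open>t *\<^sub>R u\<close> and \<open>t *\<^sub>R v\<close> expresses it by either mixed derivative at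
  nearby points; then \<open>t\<close> tends to zero.
\<close>

lemma frechet_derivative_commute:
  fixes f :: "'a::real_normed_vector \<Rightarrow> real"
  assumes f: "Ck 2 f"
  shows "frechet_derivative (\<lambda>y. frechet_derivative f (at y) u) (at x) v =
         frechet_derivative (\<lambda>y. frechet_derivative f (at y) v) (at x) u"
proof -
  define D where "D u v y = frechet_derivative (\<lambda>z. frechet_derivative f (at z) u) (at y) v" for u v y
  have f2: "Ck (Suc (Suc 0)) f" using f by (simp add: numeral_2_eq_2)
  then have f1: "Ck (Suc 0) (\<lambda>z. frechet_derivative f (at z) u)" for u by simp
  have cont: "continuous_on UNIV (D u v)" for u v
    using f1[of u] by (auto simp: D_def[abs_def])
  have *: "\<exists>\<xi> \<eta>. 0 < \<xi> \<and> \<xi> < t \<and> 0 < \<eta> \<and> \<eta> < t \<and>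
      f (x + t *\<^sub>R u + t *\<^sub>R v) - f (x + t *\<^sub>R u) - f (x + t *\<^sub>R v) + f x = t * t * D u v (x + \<xi> *\<^sub>R u + \<eta> *\<^sub>R v)"
    if t: "0 < t" for t :: real and u v
  proof -
    let ?g = "\<lambda>s. f ((x + t *\<^sub>R v) + s *\<^sub>R u) - f (x + s *\<^sub>R u)"
    let ?g' = "\<lambda>s. frechet_derivative f (at ((x + t *\<^sub>R v) + s *\<^sub>R u)) u - frechet_derivative f (at (x + s *\<^sub>R u)) u"
    have "(?g has_real_derivative ?g' s) (at s)" for s
      by (intro DERIV_diff has_derivative_along_line[OF f2])
    then obtain \<xi> where \<xi>: "0 < \<xi>" "\<xi> < t" "?g t - ?g 0 = (t - 0) * ?g' \<xi>"
      using MVT2[OF t, of ?g ?g'] by blast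
    let ?k = "\<lambda>s. frechet_derivative f (at ((x + \<xi> *\<^sub>R u) + s *\<^sub>R v)) u"
    have "(?k has_real_derivative D u v ((x + \<xi> *\<^sub>R u) + s *\<^sub>R v)) (at s)" for s
      unfolding D_def by (intro has_derivative_along_line[OF f1])
    then obtain \<eta> where \<eta>: "0 < \<eta>" "\<eta> < t" "?k t - ?k 0 = (t - 0) * D u v ((x + \<xi> *\<^sub>R u) + \<eta> *\<^sub>R v)"
      using MVT2[OF t, of ?k "\<lambda>s. D u v ((x + \<xi> *\<^sub>R u) + s *\<^sub>R v)"] by blast
    have "?g t - ?g 0 = t * (?k t - ?k 0)"
      using \<xi>(3) by (simp add: add_ac)
    then have "?g t - ?g 0 = t * t * D u v ((x + \<xi> *\<^sub>R u) + \<eta> *\<^sub>R v)" using \<eta>(3) by simp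
    then show ?thesis using \<xi>(1,2) \<eta>(1,2) by (intro exI[of _ \<xi>] exI[of _ \<eta>]) (simp add: add_ac)
  qed
  have "\<exists>\<xi> \<eta> \<xi>' \<eta>'. \<bar>\<xi>\<bar> \<le> inverse (real (Suc n)) \<and> \<bar>\<eta>\<bar> \<le> inverse (real (Suc n)) \<and>
      \<bar>\<xi>'\<bar> \<le> inverse (real (Suc n)) \<and> \<bar>\<eta>'\<bar> \<le> inverse (real (Suc n)) \<and>
      D u v (x + \<xi> *\<^sub>R u + \<eta> *\<^sub>R v) = D v u (x + \<xi>' *\<^sub>R v + \<eta>' *\<^sub>R u)" for n
  proof -
    let ?t = "inverse (real (Suc n))"
    have t: "0 < ?t" by simp
    obtain \<xi> \<eta> where 1: "0 < \<xi>" "\<xi> < ?t" "0 < \<eta>" "\<eta> < ?t"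
      "f (x + ?t *\<^sub>R u + ?t *\<^sub>R v) - f (x + ?t *\<^sub>R u) - f (x + ?t *\<^sub>R v) + f x = ?t * ?t * D u v (x + \<xi> *\<^sub>R u + \<eta> *\<^sub>R v)"
      using *[OF t, of u v] by blast
    obtain \<xi>' \<eta>' where 2: "0 < \<xi>'" "\<xi>' < ?t" "0 < \<eta>'" "\<eta>' < ?t"
      "f (x + ?t *\<^sub>R v + ?t *\<^sub>R u) - f (x + ?t *\<^sub>R v) - f (x + ?t *\<^sub>R u) + f x = ?t * ?t * D v u (x + \<xi>' *\<^sub>R v + \<eta>' *\<^sub>R u)"
      using *[OF t, of v u] by blast
    have "?t * ?t * D u v (x + \<xi> *\<^sub>R u + \<eta> *\<^sub>R v) = ?t * ?t * D v u (x + \<xi>' *\<^sub>R v + \<eta>' *\<^sub>R u)"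
      unfolding 1(5)[symmetric] 2(5)[symmetric] by (simp add: add_ac)
    then have "D u v (x + \<xi> *\<^sub>R u + \<eta> *\<^sub>R v) = D v u (x + \<xi>' *\<^sub>R v + \<eta>' *\<^sub>R u)" using t by simp
    then show ?thesis using 1 2
      by (intro exI[of _ \<xi>] exI[of _ \<eta>] exI[of _ \<xi>'] exI[of _ \<eta>']) simp
  qed
  then obtain \<xi> \<eta> \<xi>' \<eta>' where s:
    "\<And>n. \<bar>\<xi> n\<bar> \<le> inverse (real (Suc n))" "\<And>n. \<bar>\<eta> n\<bar> \<le> inverse (real (Suc n))"
    "\<And>n. \<bar>\<xi>' n\<bar> \<le> inverse (real (Suc n))" "\<And>n. \<bar>\<eta>' n\<bar> \<le> inverse (real (Suc n))"
    and e: "\<And>n. D u v (x + \<xi> n *\<^sub>R u + \<eta> n *\<^sub>R v) = D v u (x + \<xi>' n *\<^sub>R v + \<eta>' n *\<^sub>R u)"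
    by metis
  have z: "a \<longlonglongrightarrow> 0" if "\<And>n. \<bar>a n\<bar> \<le> inverse (real (Suc n))" for a :: "nat \<Rightarrow> real"
    using that by (intro Lim_null_comparison[OF _ LIMSEQ_inverse_real_of_nat]) auto
  have l: "(\<lambda>n. D u v (x + a n *\<^sub>R u' + b n *\<^sub>R v')) \<longlonglongrightarrow> D u v x" if "a \<longlonglongrightarrow> 0" "b \<longlonglongrightarrow> 0" for a b u v u' v'
  proof -
    have "(\<lambda>n. x + a n *\<^sub>R u' + b n *\<^sub>R v') \<longlonglongrightarrow> x + 0 *\<^sub>R u' + 0 *\<^sub>R v'"
      by (intro tendsto_intros that)
    then show ?thesis using continuous_on_tendsto_compose[OF cont, of _ x _ u v] by simp
  qed
  have "D u v x = D v u x"
    using l[OF z[OF s(1)] z[OF s(2)], of u v u v] l[OF z[OF s(3)] z[OF s(4)], of v u v u]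
    unfolding e by (rule LIMSEQ_unique)
  then show ?thesis by (simp add: D_def)
qed

lemma frechet_derivative_bounded_linear_compose:
  assumes "bounded_linear L" "f differentiable (at x)"
  shows "frechet_derivative (\<lambda>y. L (f y)) (at x) v = L (frechet_derivative f (at x) v)"
  using assms by (metis bounded_linear.has_derivative frechet_derivativeI frechet_derivative_works)

lemma pderivative_bounded_linear_compose:
  assumes "bounded_linear L" "f differentiable (at x)"
  shows "pderivative i (\<lambda>y. L (f y)) x = L (pderivative i f x)"
  unfolding pderivative_def by (rule frechet_derivative_bounded_linear_compose[OF assms])

lemma pderivative_commute:
  fixes f :: "'n::finite space \<Rightarrow> real ^ 'm::finite"
  assumes "Ck 2 f"
  shows "pderivative i (pderivative j f) x = pderivative j (pderivative i f) x"
proof (rule vec_eq_iff[THEN iffD2], rule allI)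
  fix S
  note L = bounded_linear_vec_nth[of S]
  have f2: "Ck (Suc (Suc 0)) f" using assms by (simp add: numeral_2_eq_2)
  have comp: "pderivative i (pderivative j f) x $ S = pderivative i (pderivative j (\<lambda>y. f y $ S)) x" for i j
  proof -
    have "pderivative j (\<lambda>y. f y $ S) = (\<lambda>y. pderivative j f y $ S)"
      using f2 by (intro ext pderivative_bounded_linear_compose[OF L]) simp
    moreover have "pderivative j f differentiable (at x)"
      using Ck_pderivative[OF f2] by simp
    ultimately show ?thesis by (simp add: pderivative_bounded_linear_compose[OF L])
  qed
  show "pderivative i (pderivative j f) x $ S = pderivative j (pderivative i f) x $ S"
    unfolding comp using frechet_derivative_commute[OF Ck_bounded_linear_compose[OF L assms], where x = x]
    by (simp add: pderivative_def[abs_def])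
qed

section \<open>Smooth bump functions and the fundamental lemma\<close>

text \<open>
  The functions $t\mapsto P(1/t)\,e^{-1/t}$ for $t>0$, extended by zero. This family is closed under
  differentiation, so all its members are smooth.
\<close>

definition flat :: "real poly \<Rightarrow> real \<Rightarrow> real" where
  "flat P t = (if t > 0 then poly P (1 / t) * exp (- (1 / t)) else 0)"

lemma poly_times_exp_tendsto_0: "((\<lambda>s. poly P s * exp (- s)) \<longlongrightarrow> (0::real)) at_top"
proof -
  have "((\<lambda>s. \<Sum>i\<le>degree P. coeff P i * (s ^ i / exp s)) \<longlongrightarrow> (\<Sum>i\<le>degree P. coeff P i * 0)) at_top"
    by (intro tendsto_intros tendsto_power_div_exp_0)
  then show ?thesis by (simp add: poly_altdef sum_distrib_right exp_minus divide_inverse mult.assoc)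
qed

lemma flat_tendsto_0: "(flat P \<longlongrightarrow> 0) (at_right 0)"
proof -
  have "((\<lambda>t. poly P (inverse t) * exp (- (inverse t))) \<longlongrightarrow> (0::real)) (at_right 0)"
    using filterlim_compose[OF poly_times_exp_tendsto_0 filterlim_inverse_at_top_right] .
  moreover have "eventually (\<lambda>t. poly P (inverse t) * exp (- (inverse t)) = flat P t) (at_right 0)"
    by (auto simp: flat_def eventually_at_right_field divide_inverse intro: exI[of _ 1])
  ultimately show ?thesis by (simp add: tendsto_cong)
qed

lemma flat_deriv: "(flat P has_real_derivative flat ([:0, 0, 1:] * (P - pderiv P)) t) (at t)"
proof -
  consider "t < 0" | "t = 0" | "t > 0" by linarith
  then show ?thesis
  proof cases
    case 1
    have "((\<lambda>_. 0) has_real_derivative 0) (at t)" by simp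
    moreover have "eventually (\<lambda>s. flat P s = 0) (nhds t)"
      by (rule eventually_nhds_in_open[of "{..<0}" t, THEN eventually_mono]) (use 1 in \<open>auto simp: flat_def\<close>)
    ultimately have "(flat P has_real_derivative 0) (at t)"
      using DERIV_cong_ev[of t t "flat P" "\<lambda>_. 0" 0 0] by simp
    then show ?thesis using 1 by (simp add: flat_def)
  next
    case 2
    have "((\<lambda>h. flat P h / h) \<longlongrightarrow> 0) (at_left 0)"
      by (rule tendsto_eventually) (auto simp: flat_def eventually_at_left_field intro: exI[of _ "-1"])
    moreover have "((\<lambda>h. flat P h / h) \<longlongrightarrow> 0) (at_right 0)"
    proof -
      have "eventually (\<lambda>h. flat ([:0, 1:] * P) h = flat P h / h) (at_right 0)"
        by (auto simp: flat_def eventually_at_right_field intro: exI[of _ 1])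
      then show ?thesis using flat_tendsto_0[of "[:0, 1:] * P"] by (simp add: tendsto_cong)
    qed
    ultimately have "((\<lambda>h. flat P h / h) \<longlongrightarrow> 0) (at 0)"
      by (rule filterlim_split_at)
    then show ?thesis unfolding 2 DERIV_def by (simp add: flat_def)
  next
    case 3
    have d: "((\<lambda>s. poly P (1 / s) * exp (- (1 / s))) has_real_derivative
        flat ([:0, 0, 1:] * (P - pderiv P)) t) (at t)"
      using 3 by (auto intro!: derivative_eq_intros DERIV_chain'[OF _ poly_DERIV] simp: flat_def field_simps power2_eq_square)
    have e: "eventually (\<lambda>s. flat P s = poly P (1 / s) * exp (- (1 / s))) (nhds t)"
      by (rule eventually_nhds_in_open[of "{0<..}" t, THEN eventually_mono]) (use 3 in \<open>auto simp: flat_def\<close>)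
    show ?thesis by (rule DERIV_cong_ev[THEN iffD2, OF refl e refl d])
  qed
qed

lemma Ck_flat:
  assumes L: "bounded_linear L"
  shows "Ck m (\<lambda>x. flat P (L x + d))"
proof (induction m arbitrary: P)
  case 0
  have "continuous_on UNIV (flat P)"
    by (intro continuous_at_imp_continuous_on ballI DERIV_isCont[OF flat_deriv])
  then have "continuous_on UNIV (\<lambda>x. flat P (L x + d))"
  proof (rule continuous_on_compose2)
    show "continuous_on UNIV (\<lambda>x. L x + d)" by (intro continuous_intros linear_continuous_on L)
  qed auto
  then show ?case by simp
next
  case (Suc m)
  let ?Q = "[:0, 0, 1:] * (P - pderiv P)"
  have "((\<lambda>x. flat P (L x + d)) has_derivative (\<lambda>v. flat ?Q (L x + d) * L v)) (at x)" for x
  proof -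
    have "((\<lambda>x. L x + d) has_derivative L) (at x)"
      using has_derivative_add_const[OF bounded_linear_imp_has_derivative[OF L]] .
    from has_derivative_compose[OF this flat_deriv[unfolded has_field_derivative_def]]
    show ?thesis .
  qed
  then show ?case
    by (rule Ck_SucI) (intro Ck_mult Suc Ck_const)
qed

lemma flat_1_tendsto: "(\<lambda>m. flat 1 (real (Suc m) * t)) \<longlonglongrightarrow> (if t > 0 then 1 else 0)"
proof (cases "t > 0")
  case True
  have "(\<lambda>m. exp (- (inverse t * inverse (real (Suc m))))) \<longlonglongrightarrow> exp (- (inverse t * 0))"
    by (intro tendsto_intros LIMSEQ_inverse_real_of_nat)
  then show ?thesis using True by (simp add: flat_def divide_inverse mult.commute del: of_nat_Suc)
next
  case False
  then have "\<not> 0 < real (Suc m) * t" for m by (simp add: zero_less_mult_iff del: of_nat_Suc)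
  then show ?thesis using False by (simp add: flat_def)
qed

lemma flat_1_bounds: "0 \<le> flat 1 t" "flat 1 t \<le> 1"
  by (auto simp: flat_def)

text \<open>
  The indicator function of an open box is a bounded pointwise limit of smooth functions
  supported in the closed box.
\<close>

lemma smooth_approx_box:
  fixes a b :: "'n::finite space"
  obtains \<psi> :: "nat \<Rightarrow> 'n space \<Rightarrow> real" where "\<And>k m. Ck m (\<psi> k)"
    "\<And>k x. 0 \<le> \<psi> k x" "\<And>k x. \<psi> k x \<le> 1" "\<And>k x. x \<notin> box a b \<Longrightarrow> \<psi> k x = 0"
    "\<And>x. (\<lambda>k. \<psi> k x) \<longlonglongrightarrow> indicator (box a b) x"
proof
  let ?\<psi> = "\<lambda>k x. \<Prod>i\<in>UNIV. flat 1 (real (Suc k) * (x $ i - a $ i)) * flat 1 (real (Suc k) * (b $ i - x $ i))"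
  show "Ck m (?\<psi> k)" for k m
  proof (intro Ck_prod Ck_mult)
    fix i :: 'n
    have "bounded_linear (\<lambda>x :: 'n space. real (Suc k) * (x $ i))" "bounded_linear (\<lambda>x :: 'n space. - real (Suc k) * (x $ i))"
      by (intro bounded_linear_const_mult bounded_linear_vec_nth)+
    from Ck_flat[OF this(1), of m 1 "- real (Suc k) * a $ i"] Ck_flat[OF this(2), of m 1 "real (Suc k) * b $ i"]
    show "Ck m (\<lambda>x. flat 1 (real (Suc k) * (x $ i - a $ i)))" "Ck m (\<lambda>x. flat 1 (real (Suc k) * (b $ i - x $ i)))"
      by (simp_all add: algebra_simps)
  qed
  show "0 \<le> ?\<psi> k x" for k x by (intro prod_nonneg ballI mult_nonneg_nonneg flat_1_bounds)
  show "?\<psi> k x \<le> 1" for k x by (intro prod_le_1 conjI mult_nonneg_nonneg mult_le_one flat_1_bounds)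
  have out: "?\<psi> k x = 0" if x: "x \<notin> box a b" for k x
  proof -
    obtain i where "\<not> (a $ i < x $ i \<and> x $ i < b $ i)" using x by (auto simp: mem_box_cart)
    then have "flat 1 (real (Suc k) * (x $ i - a $ i)) * flat 1 (real (Suc k) * (b $ i - x $ i)) = 0"
      by (auto simp: flat_def zero_less_mult_iff simp del: of_nat_Suc)
    then show ?thesis by (intro prod_zero) auto
  qed
  show "?\<psi> k x = 0" if "x \<notin> box a b" for k x using out[OF that] .
  show "(\<lambda>k. ?\<psi> k x) \<longlonglongrightarrow> indicator (box a b) x" for x
  proof (cases "x \<in> box a b")
    case True
    have "(\<lambda>k. ?\<psi> k x) \<longlonglongrightarrow> (\<Prod>i\<in>UNIV. (if x $ i - a $ i > 0 then 1 else 0) * (if b $ i - x $ i > 0 then 1 else 0))"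
      by (intro tendsto_intros flat_1_tendsto)
    then show ?thesis using True by (simp add: mem_box_cart)
  next
    case False
    then have "(\<lambda>k. ?\<psi> k x) = (\<lambda>k. 0)" using out by blast
    then show ?thesis using False by simp
  qed
qed

text \<open>
  The fundamental lemma of the calculus of variations. By \<open>smooth_approx_box\<close> the integral of \<open>f\<close> over
  every closed box inside \<open>\<Omega>\<close> vanishes, and almost everywhere \<open>f\<close> is the limit of its averages over
  shrinking boxes.
\<close>

lemma fundamental_lemma:
  fixes f :: "'n::finite space \<Rightarrow> real"
  assumes \<Omega>: "open \<Omega>" and f: "integrable (lebesgue_on \<Omega>) f"
    and 0: "\<And>\<psi> :: 'n space \<Rightarrow> real. (\<And>m. Ck m \<psi>) \<Longrightarrow> compact (closure {x. \<psi> x \<noteq> 0}) \<Longrightarrow>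
      closure {x. \<psi> x \<noteq> 0} \<subseteq> \<Omega> \<Longrightarrow> (LINT x|lebesgue_on \<Omega>. f x * \<psi> x) = 0"
  shows "AE x in lebesgue_on \<Omega>. f x = 0"
proof -
  have \<Omega>_leb: "\<Omega> \<in> sets lebesgue" using \<Omega> by auto
  define g where "g x = indicat_real \<Omega> x *\<^sub>R f x" for x
  have g: "integrable lebesgue g"
    using f \<Omega>_leb unfolding g_def by (subst (asm) integrable_restrict_space) auto
  have box0: "integral (cbox a b) g = 0" if ab: "cbox a b \<subseteq> \<Omega>" for a b
  proof -
    obtain \<psi> :: "nat \<Rightarrow> 'n space \<Rightarrow> real" where \<psi>: "\<And>k m. Ck m (\<psi> k)"
      "\<And>k x. 0 \<le> \<psi> k x" "\<And>k x. \<psi> k x \<le> 1" "\<And>k x. x \<notin> box a b \<Longrightarrow> \<psi> k x = 0"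
      "\<And>x. (\<lambda>k. \<psi> k x) \<longlonglongrightarrow> indicator (box a b) x" using smooth_approx_box[of a b] by blast
    have mpsi: "\<psi> k \<in> borel_measurable lebesgue" for k
      using borel_measurable_continuous_onI[OF Ck_continuous[OF \<psi>(1)[of 0 k]]] by (simp add: measurable_completion)
    have z: "(LINT x|lebesgue. g x * \<psi> k x) = 0" for k
    proof -
      have "{x. \<psi> k x \<noteq> 0} \<subseteq> cbox a b" using \<psi>(4) box_subset_cbox by blast
      then have s: "closure {x. \<psi> k x \<noteq> 0} \<subseteq> cbox a b" by (rule closure_minimal) auto
      then have "compact (closure {x. \<psi> k x \<noteq> 0})"
        by (meson bounded_cbox bounded_subset closed_closure compact_eq_bounded_closed)
      then have "(LINT x|lebesgue_on \<Omega>. f x * \<psi> k x) = 0"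
        using 0[OF \<psi>(1)] s ab by auto
      then show ?thesis using \<Omega>_leb by (subst (asm) integral_restrict_space) (auto simp: g_def mult_ac)
    qed
    have "(\<lambda>k. LINT x|lebesgue. g x * \<psi> k x) \<longlonglongrightarrow> (LINT x|lebesgue. g x * indicator (box a b) x)"
    proof (rule integral_dominated_convergence[where w = "\<lambda>x. norm (g x)"])
      show "AE x in lebesgue. (\<lambda>k. g x * \<psi> k x) \<longlonglongrightarrow> g x * indicator (box a b) x"
        by (intro AE_I2 tendsto_mult tendsto_const \<psi>)
      show "AE x in lebesgue. norm (g x * \<psi> k x) \<le> norm (g x)" for k
        using \<psi>(2,3) by (intro AE_I2) (simp add: abs_mult mult_left_le)
    qed (use g mpsi in \<open>auto intro!: borel_measurable_times integrable_norm borel_measurable_indicator\<close>)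
    then have "(LINT x|lebesgue. g x * indicator (box a b) x) = 0"
      unfolding z by (simp add: LIMSEQ_const_iff)
    then have "(LINT x : box a b | lebesgue. g x) = 0"
      by (simp add: set_lebesgue_integral_def mult.commute)
    moreover have "set_integrable lebesgue (box a b) g"
      unfolding set_integrable_def using g by (intro integrable_mult_indicator) auto
    ultimately have "integral (box a b) g = 0"
      by (simp add: set_lebesgue_integral_eq_integral)
    then show ?thesis by (simp add: integral_open_interval)
  qed
  have "g integrable_on cbox a b" for a b
    using integrable_on_lebesgue[OF g] integrable_on_subcbox by blast
  then obtain N where N: "negligible N" "\<And>x e. \<lbrakk>x \<notin> N; 0 < e\<rbrakk> \<Longrightarrow>
    \<exists>d>0. \<forall>h. 0 < h \<and> h < d \<longrightarrow> norm (integral (cbox x (x + h *\<^sub>R One)) g /\<^sub>R h ^ DIM('n space) - g x) < e"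
    by (rule integrable_ccontinuous_explicit) blast
  have "f x = 0" if x: "x \<in> \<Omega>" "x \<notin> N" for x
  proof (rule ccontr)
    assume "f x \<noteq> 0"
    then have "0 < norm (g x)" using x by (simp add: g_def)
    from N(2)[OF x(2) this] obtain d where d: "d > 0"
      "\<And>h. 0 < h \<Longrightarrow> h < d \<Longrightarrow> norm (integral (cbox x (x + h *\<^sub>R One)) g /\<^sub>R h ^ DIM('n space) - g x) < norm (g x)"
      by blast
    obtain r where r: "r > 0" "ball x r \<subseteq> \<Omega>" using \<Omega> x(1) openE by blast
    \<comment> \<open>A cube with corner \<open>x\<close> and this side length lies in \<open>ball x r\<close>.\<close>
    define h where "h = min (d / 2) (r / (2 * (norm (One :: 'n space) + 1)))"
    have h: "0 < h" "h < d" using d(1) r(1) by (auto simp: h_def add_nonneg_pos)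
    have "cbox x (x + h *\<^sub>R One) \<subseteq> ball x r"
    proof
      fix y assume y: "y \<in> cbox x (x + h *\<^sub>R One)"
      have "norm (y - x) \<le> norm (h *\<^sub>R (One :: 'n space))"
        by (rule norm_le_componentwise) (use y in \<open>auto simp: mem_box inner_diff_left inner_add_left algebra_simps\<close>)
      also have "\<dots> \<le> h * (norm (One :: 'n space) + 1)" using h by simp
      also have "\<dots> \<le> r / (2 * (norm (One :: 'n space) + 1)) * (norm (One :: 'n space) + 1)"
        by (intro mult_right_mono) (auto simp: h_def)
      also have "\<dots> = r / 2"
      proof -
        have "norm (One :: 'n space) + 1 \<noteq> 0" using norm_ge_zero[of "One :: 'n space"] by linarith
        then show ?thesis by (simp add: field_simps)
      qed
      also have "\<dots> < r" using r(1) by simp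
      finally show "y \<in> ball x r" by (simp add: dist_norm norm_minus_commute)
    qed
    then have "integral (cbox x (x + h *\<^sub>R One)) g = 0" using box0 r(2) by blast
    then show False using d(2)[OF h] by simp
  qed
  then have "AE x in lebesgue. x \<in> \<Omega> \<longrightarrow> f x = 0"
    using N(1) by (auto simp: negligible_iff_null_sets intro!: AE_I')
  then show ?thesis using \<Omega>_leb by (simp add: AE_restrict_space_iff)
qed

section \<open>Integrals of derivatives of compactly supported functions\<close>

lemma frechet_derivative_outside_support:
  assumes "x \<notin> closure {x. f x \<noteq> 0}"
  shows "frechet_derivative f (at x) v = 0"
proof -
  have "(f has_derivative (\<lambda>v. 0)) (at x)"
  proof (rule has_derivative_transform_within_open[where f = "\<lambda>_. 0" and s = "- closure {x. f x \<noteq> 0}"])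
    show "0 = f y" if "y \<in> - closure {x. f x \<noteq> 0}" for y
      using that closure_subset[of "{x. f x \<noteq> 0}"] by force
  qed (use assms in auto)
  then show ?thesis by (simp add: frechet_derivativeI)
qed

lemma integrable_continuous_bounded_support:
  fixes f :: "'a::euclidean_space \<Rightarrow> real"
  assumes "continuous_on UNIV f" "\<And>x. x \<notin> cball 0 R \<Longrightarrow> f x = 0"
  shows "integrable lborel f"
proof -
  have "integrable lborel (\<lambda>x. indicator (cball 0 R) x *\<^sub>R f x)"
    by (rule borel_integrable_compact[OF compact_cball]) (rule continuous_on_subset[OF assms(1)], simp)
  moreover have "(\<lambda>x. indicator (cball 0 R) x *\<^sub>R f x) = f"
  proof
    fix x
    show "indicator (cball 0 R) x *\<^sub>R f x = f x" by (cases "x \<in> cball 0 R") (simp_all add: assms(2))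
  qed
  ultimately show ?thesis by simp
qed

text \<open>
  By translation invariance every difference quotient of \<open>h\<close> has integral zero; the quotients converge
  boundedly to the partial derivative.
\<close>

lemma integral_pderivative_eq_0:
  fixes h :: "'n::finite space \<Rightarrow> real"
  assumes h: "Ck 1 h" and cpt: "compact (closure {x. h x \<noteq> 0})"
  shows "(\<integral>x. pderivative i h x \<partial>lborel) = 0"
proof -
  define e :: "'n space" where "e = axis i 1"
  have e: "norm e = 1" by (simp add: e_def)
  have h1: "Ck (Suc 0) h" using h by simp
  obtain R where R: "closure {x. h x \<noteq> 0} \<subseteq> cball 0 R"
    using bounded_subset_ballD[OF compact_imp_bounded[OF cpt], of 0] ball_subset_cball by (metis subset_trans)
  have out: "h x = 0" if "x \<notin> cball 0 R" for x
  proof (rule ccontr)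
    assume "h x \<noteq> 0"
    then have "x \<in> closure {x. h x \<noteq> 0}" using closure_subset[of "{x. h x \<noteq> 0}"] by blast
    then show False using that R by blast
  qed
  have conth: "continuous_on UNIV h" by (rule Ck_continuous[OF h])
  have contd: "continuous_on UNIV (pderivative i h)" using Ck_pderivative[OF h1] by simp
  have inth: "integrable lborel h" by (rule integrable_continuous_bounded_support[OF conth out])
  have shift: "integrable lborel (\<lambda>x. h (x + t *\<^sub>R e))" "(\<integral>x. h (x + t *\<^sub>R e) \<partial>lborel) = (\<integral>x. h x \<partial>lborel)" for t
  proof -
    have m: "(+) (t *\<^sub>R e) \<in> measurable lborel borel" by measurable
    have hm: "h \<in> borel_measurable borel" using borel_measurable_continuous_onI[OF conth] .
    show "integrable lborel (\<lambda>x. h (x + t *\<^sub>R e))"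
      using integrable_distr_eq[OF m hm] inth unfolding lborel_distr_plus add.commute[of _ "t *\<^sub>R e"] by simp
    show "(\<integral>x. h (x + t *\<^sub>R e) \<partial>lborel) = (\<integral>x. h x \<partial>lborel)"
      using integral_distr[OF m hm] unfolding lborel_distr_plus add.commute[of _ "t *\<^sub>R e"] by simp
  qed
  have "bounded (pderivative i h ` cball 0 (R + 2))"
    by (intro compact_imp_bounded compact_continuous_image compact_cball continuous_on_subset[OF contd]) auto
  then obtain M where M: "\<And>x. x \<in> cball 0 (R + 2) \<Longrightarrow> norm (pderivative i h x) \<le> M"
    unfolding bounded_iff by blast
  define t where "t n = inverse (real (Suc n))" for n
  have t: "0 < t n" "t n \<le> 1" for n by (simp_all add: t_def inverse_le_1_iff)
  have tl: "t \<longlonglongrightarrow> 0" unfolding t_def by (rule LIMSEQ_inverse_real_of_nat)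
  let ?q = "\<lambda>n x. (h (x + t n *\<^sub>R e) - h x) / t n"
  have der: "((\<lambda>s. h (x + s *\<^sub>R e)) has_real_derivative pderivative i h (x + s *\<^sub>R e)) (at s)" for x s
    unfolding pderivative_def e_def by (rule has_derivative_along_line[OF h1])
  have lim: "(\<lambda>n. \<integral>x. ?q n x \<partial>lborel) \<longlonglongrightarrow> (\<integral>x. pderivative i h x \<partial>lborel)"
  proof (rule integral_dominated_convergence[where w = "\<lambda>x. indicator (cball 0 (R + 1)) x * M"])
    show "pderivative i h \<in> borel_measurable lborel" using borel_measurable_continuous_onI[OF contd] by simp
    show "?q n \<in> borel_measurable lborel" for n
      by (intro borel_measurable_divide borel_measurable_diff borel_measurable_const
          borel_measurable_integrable[OF shift(1)] borel_measurable_integrable[OF inth])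
    show "integrable lborel (\<lambda>x. indicator (cball 0 (R + 1)) x * M)"
      by (intro integrable_mult_left integrable_real_indicator emeasure_lborel_cball_finite) simp
    show "AE x in lborel. (\<lambda>n. ?q n x) \<longlonglongrightarrow> pderivative i h x"
    proof (rule AE_I2)
      fix x
      have "((\<lambda>s. (h (x + (0 + s) *\<^sub>R e) - h (x + 0 *\<^sub>R e)) / s) \<longlongrightarrow> pderivative i h (x + 0 *\<^sub>R e)) (at 0)"
        using der[of x 0] unfolding DERIV_def .
      then have "((\<lambda>s. (h (x + s *\<^sub>R e) - h x) / s) \<longlongrightarrow> pderivative i h x) (at 0)" by simp
      moreover have "filterlim t (at 0) sequentially"
        by (intro filterlim_atI tl always_eventually allI) (metis t(1) less_irrefl)
      ultimately show "(\<lambda>n. ?q n x) \<longlonglongrightarrow> pderivative i h x"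
        by (rule filterlim_compose)
    qed
    show "AE x in lborel. norm (?q n x) \<le> indicator (cball 0 (R + 1)) x * M" for n
    proof (rule AE_I2)
      fix x
      have nt: "norm (t n *\<^sub>R e) \<le> 1" using t[of n] e by simp
      show "norm (?q n x) \<le> indicator (cball 0 (R + 1)) x * M"
      proof (cases "x \<in> cball 0 (R + 1)")
        case True
        obtain z where z: "0 < z" "z < t n" "h (x + t n *\<^sub>R e) - h (x + 0 *\<^sub>R e) = (t n - 0) * pderivative i h (x + z *\<^sub>R e)"
          using MVT2[OF t(1), of n "\<lambda>s. h (x + s *\<^sub>R e)" "\<lambda>s. pderivative i h (x + s *\<^sub>R e)"] der by blast
        have "norm (x + z *\<^sub>R e) \<le> norm x + norm (z *\<^sub>R e)" by (rule norm_triangle_ineq)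
        then have "x + z *\<^sub>R e \<in> cball 0 (R + 2)" using True z(1,2) e t(2)[of n] by simp
        then have "norm (pderivative i h (x + z *\<^sub>R e)) \<le> M" by (rule M)
        then show ?thesis using True z(3) t(1)[of n] by simp
      next
        case False
        have "norm x \<le> norm (x + t n *\<^sub>R e) + norm (t n *\<^sub>R e)"
          using norm_triangle_ineq4[of "x + t n *\<^sub>R e" "t n *\<^sub>R e"] by simp
        then have "x + t n *\<^sub>R e \<notin> cball 0 R" "x \<notin> cball 0 R" using False nt by auto
        then show ?thesis using False by (simp add: out)
      qed
    qed
  qed
  have z: "(\<integral>x. ?q n x \<partial>lborel) = 0" for n
    using shift[of "t n"] inth by simp
  show ?thesis using lim unfolding z by (simp add: LIMSEQ_const_iff)
qed

section \<open>Square integrable forms\<close>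

lemma open_sets_lebesgue: "open \<Omega> \<Longrightarrow> \<Omega> \<in> sets lebesgue"
  by simp

lemma eq_on_iff:
  assumes "open \<Omega>"
  shows "eq_on \<Omega> \<omega> \<eta> \<longleftrightarrow> (AE x in lebesgue. x \<in> \<Omega> \<longrightarrow> \<omega> x = \<eta> x)"
  unfolding eq_on_def using assms by (subst AE_restrict_space_iff) auto

lemma eq_onI: "open \<Omega> \<Longrightarrow> (\<And>x. x \<in> \<Omega> \<Longrightarrow> \<omega> x = \<eta> x) \<Longrightarrow> eq_on \<Omega> \<omega> \<eta>"
  by (simp add: eq_on_iff)

lemma eq_on_refl: "eq_on \<Omega> \<omega> \<omega>"
  by (simp add: eq_on_def)

lemma eq_on_sym: "eq_on \<Omega> \<omega> \<eta> \<Longrightarrow> eq_on \<Omega> \<eta> \<omega>"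
  unfolding eq_on_def by (auto elim: AE_mp)

lemma eq_on_trans [trans]: "eq_on \<Omega> \<omega> \<eta> \<Longrightarrow> eq_on \<Omega> \<eta> \<zeta> \<Longrightarrow> eq_on \<Omega> \<omega> \<zeta>"
  unfolding eq_on_def by (elim AE_mp) (auto elim!: AE_mp)

lemma eq_on_subset:
  assumes "eq_on \<Omega> \<omega> \<eta>" "K \<subseteq> \<Omega>" "open K" "open \<Omega>"
  shows "eq_on K \<omega> \<eta>"
  using assms(1) unfolding eq_on_iff[OF assms(3)] eq_on_iff[OF assms(4)]
  by (rule AE_mp) (use assms(2) in auto)

lemma eq_on_compose:
  assumes "eq_on \<Omega> \<omega> \<eta>"
  shows "eq_on \<Omega> (\<lambda>x. F (\<omega> x)) (\<lambda>x. F (\<eta> x))"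
  using assms unfolding eq_on_def by (rule AE_mp) auto

lemma L2_measurable: "\<omega> \<in> L2 \<Omega> k \<Longrightarrow> \<omega> \<in> borel_measurable (lebesgue_on \<Omega>)"
  by (simp add: L2_def)

lemma L2_Alt: "\<omega> \<in> L2 \<Omega> k \<Longrightarrow> x \<in> \<Omega> \<Longrightarrow> \<omega> x \<in> Alt k"
  by (simp add: L2_def)

lemma two_inner_le: "2 * \<bar>u \<bullet> v\<bar> \<le> (norm u)\<^sup>2 + (norm v)\<^sup>2" for u :: "'a::real_inner"
proof -
  have "2 * \<bar>u \<bullet> v\<bar> \<le> 2 * norm u * norm v" using Cauchy_Schwarz_ineq2[of u v] by simp
  also have "\<dots> \<le> (norm u)\<^sup>2 + (norm v)\<^sup>2" by (rule sum_squares_bound)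
  finally show ?thesis .
qed

lemma L2_inner_integrable:
  assumes "\<omega> \<in> L2 \<Omega> j" "\<mu> \<in> L2 \<Omega> k"
  shows "integrable (lebesgue_on \<Omega>) (\<lambda>x. \<omega> x \<bullet> \<mu> x)"
proof (rule Bochner_Integration.integrable_bound)
  show "integrable (lebesgue_on \<Omega>) (\<lambda>x. (norm (\<omega> x))\<^sup>2 + (norm (\<mu> x))\<^sup>2)"
    using assms by (auto simp: L2_def)
  show "(\<lambda>x. \<omega> x \<bullet> \<mu> x) \<in> borel_measurable (lebesgue_on \<Omega>)"
    using assms by (intro borel_measurable_inner L2_measurable)
  have "\<bar>\<omega> x \<bullet> \<mu> x\<bar> \<le> (norm (\<omega> x))\<^sup>2 + (norm (\<mu> x))\<^sup>2" for x
    using two_inner_le[of "\<omega> x" "\<mu> x"] abs_ge_zero[of "\<omega> x \<bullet> \<mu> x"] by linarith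
  then show "AE x in lebesgue_on \<Omega>. norm (\<omega> x \<bullet> \<mu> x) \<le> norm ((norm (\<omega> x))\<^sup>2 + (norm (\<mu> x))\<^sup>2)"
    by simp
qed

lemma L2_add:
  assumes "\<omega> \<in> L2 \<Omega> k" "\<mu> \<in> L2 \<Omega> k"
  shows "(\<lambda>x. \<omega> x + \<mu> x) \<in> L2 \<Omega> k"
proof -
  have "integrable (lebesgue_on \<Omega>) (\<lambda>x. (norm (\<omega> x))\<^sup>2 + 2 * (\<omega> x \<bullet> \<mu> x) + (norm (\<mu> x))\<^sup>2)"
    using assms L2_inner_integrable[OF assms] by (auto simp: L2_def)
  moreover have "(norm (\<omega> x + \<mu> x))\<^sup>2 = (norm (\<omega> x))\<^sup>2 + 2 * (\<omega> x \<bullet> \<mu> x) + (norm (\<mu> x))\<^sup>2" for x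
    by (simp add: power2_norm_eq_inner inner_add_left inner_add_right inner_commute)
  ultimately show ?thesis using assms by (auto simp: L2_def intro: Alt_closed)
qed

lemma L2_scaleR:
  assumes "\<omega> \<in> L2 \<Omega> k"
  shows "(\<lambda>x. c *\<^sub>R \<omega> x) \<in> L2 \<Omega> k"
  using assms by (auto simp: L2_def power_mult_distrib intro: Alt_closed)

lemma L2_diff:
  assumes "\<omega> \<in> L2 \<Omega> k" "\<mu> \<in> L2 \<Omega> k"
  shows "(\<lambda>x. \<omega> x - \<mu> x) \<in> L2 \<Omega> k"
  using L2_add[OF assms(1) L2_scaleR[OF assms(2), of "-1"]] by simp

lemma L2_zero: "(\<lambda>x. 0) \<in> L2 \<Omega> k"
  by (auto simp: L2_def intro: Alt_closed)

lemma L2_hodge: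
  fixes \<omega> :: "'n::{finite,linorder} form"
  assumes "\<omega> \<in> L2 \<Omega> k"
  shows "(\<lambda>x. hodge (\<omega> x)) \<in> L2 \<Omega> (CARD('n) - k)"
proof -
  have "continuous_on UNIV (hodge :: 'n ext \<Rightarrow> 'n ext)"
    by (intro linear_continuous_on linear_conv_bounded_linear[THEN iffD1] linear_hodge)
  then have "(\<lambda>x. hodge (\<omega> x)) \<in> borel_measurable (lebesgue_on \<Omega>)"
    using L2_measurable[OF assms] by (rule borel_measurable_continuous_on)
  then show ?thesis using assms by (auto simp: L2_def norm_hodge intro: hodge_Alt)
qed

lemma integrable_lebesgue_on_subset:
  fixes f :: "'n::finite space \<Rightarrow> real"
  assumes f: "integrable (lebesgue_on \<Omega>) f" and "K \<subseteq> \<Omega>" "open K" "open \<Omega>"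
  shows "integrable (lebesgue_on K) f"
proof -
  have "integrable lebesgue (\<lambda>x. indicator \<Omega> x *\<^sub>R f x)"
    using f assms(4) by (subst (asm) integrable_restrict_space) auto
  then have "integrable lebesgue (\<lambda>x. indicator K x *\<^sub>R (indicator \<Omega> x *\<^sub>R f x))"
    by (rule integrable_mult_indicator[OF open_sets_lebesgue[OF assms(3)]])
  also have "(\<lambda>x. indicator K x *\<^sub>R (indicator \<Omega> x *\<^sub>R f x)) = (\<lambda>x. indicator K x *\<^sub>R f x)"
    using assms(2) by (auto simp: fun_eq_iff indicator_def)
  finally show ?thesis using assms(3) by (subst integrable_restrict_space) auto
qed

lemma L2_subset:
  assumes "\<omega> \<in> L2 \<Omega> k" "K \<subseteq> \<Omega>" "open K" "open \<Omega>"
  shows "\<omega> \<in> L2 K k"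
  using assms measurable_restrict_mono[OF L2_measurable[OF assms(1)] assms(2)]
  by (auto simp: L2_def intro: integrable_lebesgue_on_subset)

lemma L2_inner_cong:
  assumes "eq_on \<Omega> \<omega> \<omega>'" "eq_on \<Omega> \<mu> \<mu>'"
    "\<omega> \<in> L2 \<Omega> j" "\<omega>' \<in> L2 \<Omega> j'" "\<mu> \<in> L2 \<Omega> k" "\<mu>' \<in> L2 \<Omega> k'"
  shows "L2_inner \<Omega> \<omega> \<mu> = L2_inner \<Omega> \<omega>' \<mu>'"
  unfolding L2_inner_def
proof (rule integral_cong_AE)
  show "AE x in lebesgue_on \<Omega>. \<omega> x \<bullet> \<mu> x = \<omega>' x \<bullet> \<mu>' x"
    using assms(1) unfolding eq_on_def by (rule AE_mp) (use assms(2)[unfolded eq_on_def] in \<open>auto elim: AE_mp\<close>)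
qed (use assms in \<open>auto intro!: borel_measurable_inner L2_measurable\<close>)

lemma L2_inner_diff_left:
  assumes "\<omega> \<in> L2 \<Omega> j" "\<omega>' \<in> L2 \<Omega> j" "\<mu> \<in> L2 \<Omega> k"
  shows "L2_inner \<Omega> (\<lambda>x. \<omega> x - \<omega>' x) \<mu> = L2_inner \<Omega> \<omega> \<mu> - L2_inner \<Omega> \<omega>' \<mu>"
  unfolding L2_inner_def inner_diff_left
  by (rule Bochner_Integration.integral_diff) (use assms L2_inner_integrable in blast)+

lemma L2_inner_commute: "L2_inner \<Omega> \<omega> \<mu> = L2_inner \<Omega> \<mu> \<omega>"
  unfolding L2_inner_def by (simp add: inner_commute)

lemma L2_inner_diff_right:
  assumes "\<omega> \<in> L2 \<Omega> j" "\<omega>' \<in> L2 \<Omega> j" "\<mu> \<in> L2 \<Omega> k"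
  shows "L2_inner \<Omega> \<mu> (\<lambda>x. \<omega> x - \<omega>' x) = L2_inner \<Omega> \<mu> \<omega> - L2_inner \<Omega> \<mu> \<omega>'"
  using L2_inner_diff_left[OF assms] by (simp add: L2_inner_commute)

lemma L2_inner_scaleR_left: "L2_inner \<Omega> (\<lambda>x. c *\<^sub>R \<omega> x) \<mu> = c * L2_inner \<Omega> \<omega> \<mu>"
  unfolding L2_inner_def by simp

lemma L2_inner_scaleR_right: "L2_inner \<Omega> \<omega> (\<lambda>x. c *\<^sub>R \<mu> x) = c * L2_inner \<Omega> \<omega> \<mu>"
  unfolding L2_inner_def by simp

lemma L2_inner_hodge: "L2_inner \<Omega> (\<lambda>x. hodge (\<omega> x)) (\<lambda>x. hodge (\<mu> x)) = L2_inner \<Omega> \<omega> \<mu>"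
  unfolding L2_inner_def by (simp add: inner_hodge)

lemma L2_inner_zero: "L2_inner \<Omega> (\<lambda>x. 0) \<mu> = 0" "L2_inner \<Omega> \<omega> (\<lambda>x. 0) = 0"
  unfolding L2_inner_def by simp_all

lemma L2_inner_self_nonneg: "0 \<le> L2_inner \<Omega> \<omega> \<omega>"
  unfolding L2_inner_def by (intro integral_nonneg_AE) auto

text \<open>
  Young's inequality, which serves in place of the Cauchy-Schwarz inequality.
\<close>

lemma L2_inner_Young:
  assumes "\<omega> \<in> L2 \<Omega> j" "\<mu> \<in> L2 \<Omega> k" "0 < e"
  shows "2 * \<bar>L2_inner \<Omega> \<omega> \<mu>\<bar> \<le> L2_inner \<Omega> \<omega> \<omega> / e + e * L2_inner \<Omega> \<mu> \<mu>"
proof -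
  have i: "integrable (lebesgue_on \<Omega>) (\<lambda>x. \<omega> x \<bullet> \<omega> x)" "integrable (lebesgue_on \<Omega>) (\<lambda>x. \<mu> x \<bullet> \<mu> x)"
    "integrable (lebesgue_on \<Omega>) (\<lambda>x. \<omega> x \<bullet> \<mu> x)"
    using assms(1,2) L2_inner_integrable by blast+
  have p: "2 * \<bar>\<omega> x \<bullet> \<mu> x\<bar> \<le> (\<omega> x \<bullet> \<omega> x) / e + e * (\<mu> x \<bullet> \<mu> x)" for x
  proof -
    have eq: "(inverse (sqrt e) *\<^sub>R \<omega> x) \<bullet> (sqrt e *\<^sub>R \<mu> x) = \<omega> x \<bullet> \<mu> x"
      using assms(3) by simp
    have "2 * \<bar>\<omega> x \<bullet> \<mu> x\<bar> \<le> (norm (inverse (sqrt e) *\<^sub>R \<omega> x))\<^sup>2 + (norm (sqrt e *\<^sub>R \<mu> x))\<^sup>2"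
      using two_inner_le[of "inverse (sqrt e) *\<^sub>R \<omega> x" "sqrt e *\<^sub>R \<mu> x"] unfolding eq .
    then show ?thesis using assms(3)
      by (simp add: power_mult_distrib power2_norm_eq_inner power_inverse divide_inverse mult.commute)
  qed
  have "\<bar>L2_inner \<Omega> \<omega> \<mu>\<bar> \<le> (LINT x|lebesgue_on \<Omega>. \<bar>\<omega> x \<bullet> \<mu> x\<bar>)"
    unfolding L2_inner_def by (rule integral_abs_bound)
  then have "2 * \<bar>L2_inner \<Omega> \<omega> \<mu>\<bar> \<le> (LINT x|lebesgue_on \<Omega>. 2 * \<bar>\<omega> x \<bullet> \<mu> x\<bar>)" by simp
  also have "\<dots> \<le> (LINT x|lebesgue_on \<Omega>. (\<omega> x \<bullet> \<omega> x) / e + e * (\<mu> x \<bullet> \<mu> x))"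
    using i p by (intro integral_mono) auto
  also have "\<dots> = L2_inner \<Omega> \<omega> \<omega> / e + e * L2_inner \<Omega> \<mu> \<mu>"
    unfolding L2_inner_def using i by (subst Bochner_Integration.integral_add) auto
  finally show ?thesis .
qed

lemma bounded_open_lmeasurable: "open \<Omega> \<Longrightarrow> bounded \<Omega> \<Longrightarrow> \<Omega> \<in> lmeasurable"
  by (rule lmeasurable_open)

lemma continuous_bounded_integrable:
  fixes f :: "'n::finite space \<Rightarrow> real"
  assumes "continuous_on UNIV f" "open \<Omega>" "bounded \<Omega>"
  shows "integrable (lebesgue_on \<Omega>) f"
proof -
  interpret finite_measure "lebesgue_on \<Omega>"
    by (rule finite_measure_lebesgue_on[OF bounded_open_lmeasurable[OF assms(2,3)]])
  have "bounded (f ` closure \<Omega>)"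
    using assms(3) by (intro compact_imp_bounded compact_continuous_image continuous_on_subset[OF assms(1)]) auto
  then obtain B where B: "\<And>x. x \<in> closure \<Omega> \<Longrightarrow> norm (f x) \<le> B" unfolding bounded_iff by blast
  have "f \<in> borel_measurable lebesgue"
    using borel_measurable_continuous_onI[OF assms(1)] by (simp add: measurable_completion)
  then have m: "f \<in> borel_measurable (lebesgue_on \<Omega>)" by (rule measurable_restrict_space1)
  show ?thesis
    by (rule integrable_const_bound[OF _ m, of B]) (use B[OF subsetD[OF closure_subset]] in \<open>auto intro!: AE_I2\<close>)
qed

lemma L2_continuous:
  assumes "continuous_on UNIV \<omega>" "\<And>x. \<omega> x \<in> Alt k" "open \<Omega>" "bounded \<Omega>"
  shows "\<omega> \<in> L2 \<Omega> k"
proof -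
  have "\<omega> \<in> borel_measurable lebesgue"
    using borel_measurable_continuous_onI[OF assms(1)] by (simp add: measurable_completion)
  then have "\<omega> \<in> borel_measurable (lebesgue_on \<Omega>)" by (rule measurable_restrict_space1)
  moreover have "integrable (lebesgue_on \<Omega>) (\<lambda>x. (norm (\<omega> x))\<^sup>2)"
    using assms by (intro continuous_bounded_integrable) (auto intro!: continuous_intros)
  ultimately show ?thesis using assms(2) by (simp add: L2_def)
qed

lemma integral_lebesgue_on_supported:
  fixes f :: "'n::finite space \<Rightarrow> real"
  assumes "open K" "\<And>x. x \<notin> K \<Longrightarrow> f x = 0"
  shows "(LINT x|lebesgue_on K. f x) = (LINT x|lebesgue. f x)"
proof -
  have "(\<lambda>x. indicator K x *\<^sub>R f x) = f" using assms(2) by (auto simp: fun_eq_iff indicator_def)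
  then show ?thesis using assms(1) by (subst integral_restrict_space) auto
qed

lemma L2_inner_supported:
  assumes "open K" "open \<Omega>" "K \<subseteq> \<Omega>" "\<And>x. x \<notin> K \<Longrightarrow> \<phi> x = 0"
  shows "L2_inner K \<omega> \<phi> = L2_inner \<Omega> \<omega> \<phi>"
proof -
  have "\<phi> x = 0" if "x \<notin> \<Omega>" for x using assms(3,4) that by blast
  then show ?thesis unfolding L2_inner_def using assms by (simp add: integral_lebesgue_on_supported)
qed

section \<open>Classical operators and test forms\<close>

lemma outside_support:
  assumes "x \<notin> closure {x. f x \<noteq> 0}"
  shows "f x = 0"
proof (rule ccontr)
  assume "f x \<noteq> 0"
  then have "x \<in> {x. f x \<noteq> 0}" by simp
  then show False using assms closure_subset by (metis subsetD)
qed

lemma test_forms_Ck: "\<phi> \<in> test_forms \<Omega> k \<Longrightarrow> Ck m \<phi>"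
  and test_forms_Alt: "\<phi> \<in> test_forms \<Omega> k \<Longrightarrow> \<phi> x \<in> Alt k"
  by (simp_all add: test_forms_def)

lemma test_forms_zero: "\<phi> \<in> test_forms \<Omega> k \<Longrightarrow> x \<notin> \<Omega> \<Longrightarrow> \<phi> x = 0"
  by (rule outside_support) (auto simp: test_forms_def)

lemma test_forms_mono: "K \<subseteq> \<Omega> \<Longrightarrow> test_forms K k \<subseteq> test_forms \<Omega> k"
  by (auto simp: test_forms_def)

text \<open>
  A smooth form whose support lies in the support of a test form is a test form.
\<close>

lemma test_forms_transfer:
  assumes \<phi>: "\<phi> \<in> test_forms \<Omega> k" and "\<And>m. Ck m \<psi>" "\<And>x. \<psi> x \<in> Alt j"
    and z: "\<And>x. x \<notin> closure {x. \<phi> x \<noteq> 0} \<Longrightarrow> \<psi> x = 0"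
  shows "\<psi> \<in> test_forms \<Omega> j"
proof -
  have s: "closure {x. \<psi> x \<noteq> 0} \<subseteq> closure {x. \<phi> x \<noteq> 0}"
  proof (rule closure_minimal)
    show "{x. \<psi> x \<noteq> 0} \<subseteq> closure {x. \<phi> x \<noteq> 0}" using z by blast
  qed simp
  have "compact (closure {x. \<psi> x \<noteq> 0})"
    unfolding compact_eq_bounded_closed
  proof
    show "bounded (closure {x. \<psi> x \<noteq> 0})"
      by (rule bounded_subset[OF compact_imp_bounded s]) (use \<phi> in \<open>simp add: test_forms_def\<close>)
  qed simp
  moreover have "closure {x. \<psi> x \<noteq> 0} \<subseteq> \<Omega>"
    using s \<phi> unfolding test_forms_def by blast
  ultimately show ?thesis using assms(2,3) by (simp add: test_forms_def)
qed

lemma bounded_linear_hodge: "bounded_linear hodge"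
  by (simp add: linear_conv_bounded_linear[symmetric] linear_hodge)

lemma bounded_linear_contr: "bounded_linear (contr i)"
  by (simp add: linear_conv_bounded_linear[symmetric] linear_contr)

lemma bounded_linear_wedge_dx: "bounded_linear (wedge (dx {i}))"
  by (simp add: linear_conv_bounded_linear[symmetric] linear_wedge_dx)

lemma ext_deriv_eq: "ext_deriv \<omega> x = (\<Sum>i\<in>UNIV. wedge (dx {i}) (pderivative i \<omega> x))"
  by (simp add: ext_deriv_def pderivative_def)

lemma pderivative_Alt:
  fixes \<omega> :: "'n::finite form"
  assumes "Ck 1 \<omega>" "\<And>x. \<omega> x \<in> Alt k"
  shows "pderivative i \<omega> x \<in> Alt k"
  unfolding Alt_def
proof (intro CollectI allI impI)
  fix S :: "'n set" assume S: "card S \<noteq> k"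
  have z: "(\<lambda>y. \<omega> y $ S) = (\<lambda>y. 0)" using assms(2) S unfolding Alt_def by blast
  have "pderivative i \<omega> x $ S = pderivative i (\<lambda>y. \<omega> y $ S) x"
    using assms(1) by (simp add: pderivative_bounded_linear_compose[OF bounded_linear_vec_nth])
  also have "\<dots> = 0" unfolding z by (simp add: pderivative_def frechet_derivative_const)
  finally show "pderivative i \<omega> x $ S = 0" .
qed

lemma Ck_ext_deriv: "Ck (Suc m) \<omega> \<Longrightarrow> Ck m (ext_deriv \<omega>)"
  unfolding ext_deriv_eq[abs_def]
  by (intro Ck_sum Ck_bounded_linear_compose[OF bounded_linear_wedge_dx] Ck_pderivative)

lemma ext_deriv_Alt:
  assumes "Ck 1 \<omega>" "\<And>x. \<omega> x \<in> Alt k"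
  shows "ext_deriv \<omega> x \<in> Alt (k + 1)"
  unfolding ext_deriv_eq by (intro Alt_closed wedge_dx_Alt pderivative_Alt[OF assms])

lemma ext_deriv_hodge:
  assumes "Ck 1 \<omega>"
  shows "ext_deriv (\<lambda>y. hodge (\<omega> y)) x = (\<Sum>i\<in>UNIV. wedge (dx {i}) (hodge (pderivative i \<omega> x)))"
  unfolding ext_deriv_eq using assms by (simp add: pderivative_bounded_linear_compose[OF bounded_linear_hodge])

lemma codiff_eq:
  assumes "Ck 1 \<phi>" "\<And>x. \<phi> x \<in> Alt k" "0 < k"
  shows "codiff k \<phi> x = - (\<Sum>i\<in>UNIV. contr i (pderivative i \<phi> x))"
  unfolding codiff_def ext_deriv_hodge[OF assms(1)]
  by (rule codiff_sign_hodge[OF pderivative_Alt[OF assms(1,2)] assms(3)])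

lemma Ck_codiff: "Ck (Suc m) \<phi> \<Longrightarrow> Ck m (codiff k \<phi>)"
  unfolding codiff_def[abs_def]
  by (intro Ck_cmul Ck_bounded_linear_compose[OF bounded_linear_hodge] Ck_ext_deriv)

lemma codiff_Alt:
  assumes "Ck 1 \<phi>" "\<And>x. \<phi> x \<in> Alt (k + 1)"
  shows "codiff (k + 1) \<phi> x \<in> Alt k"
proof -
  have "codiff (k + 1) \<phi> x = - (\<Sum>i\<in>UNIV. contr i (pderivative i \<phi> x))"
    by (rule codiff_eq) (use assms in auto)
  then show ?thesis using pderivative_Alt[OF assms] by (auto intro!: Alt_closed contr_Alt)
qed

lemma codiff_codiff:
  assumes "Ck 2 \<phi>" "\<And>x. \<phi> x \<in> Alt (k + 2)"
  shows "codiff (k + 1) (codiff (k + 2) \<phi>) x = 0"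
proof -
  have \<phi>: "Ck (Suc (Suc 0)) \<phi>" "Ck 1 \<phi>"
    using assms(1) Ck_antimono[OF assms(1), of 1] by (simp_all add: numeral_2_eq_2)
  have c1: "Ck 1 (codiff (k + 2) \<phi>)" using Ck_codiff[OF \<phi>(1)] by simp
  have A: "codiff (k + 2) \<phi> y \<in> Alt (k + 1)" for y
    using codiff_Alt[of \<phi> "k + 1" y] \<phi> assms(2) by (simp add: add.assoc)
  have e: "codiff (k + 2) \<phi> = (\<lambda>y. - (\<Sum>j\<in>UNIV. contr j (pderivative j \<phi> y)))"
    by (rule ext, rule codiff_eq) (use \<phi> assms(2) in auto)
  have d: "pderivative j \<phi> differentiable (at x)" for j
    using Ck_pderivative[OF \<phi>(1)] by simp
  have p: "pderivative i (codiff (k + 2) \<phi>) x = - (\<Sum>j\<in>UNIV. contr j (pderivative i (pderivative j \<phi>) x))" for i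
  proof -
    have "((\<lambda>y. - (\<Sum>j\<in>UNIV. contr j (pderivative j \<phi> y))) has_derivative
        (\<lambda>v. - (\<Sum>j\<in>UNIV. contr j (frechet_derivative (pderivative j \<phi>) (at x) v)))) (at x)"
      using d by (intro has_derivative_minus has_derivative_sum bounded_linear.has_derivative[OF bounded_linear_contr])
        (simp add: frechet_derivative_works)
    then show ?thesis unfolding e by (simp add: pderivative_def frechet_derivativeI)
  qed
  have "codiff (k + 1) (codiff (k + 2) \<phi>) x = - (\<Sum>i\<in>UNIV. contr i (pderivative i (codiff (k + 2) \<phi>) x))"
    by (rule codiff_eq[OF c1 A]) simp
  also have "\<dots> = (\<Sum>i\<in>UNIV. \<Sum>j\<in>UNIV. contr i (contr j (pderivative i (pderivative j \<phi>) x)))"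
    unfolding p by (simp add: contr_linear sum_negf)
  also have "\<dots> = 0"
    by (rule sum_contr_contr_symmetric) (rule pderivative_commute[OF assms(1)])
  finally show ?thesis .
qed

lemma pderivative_outside_support:
  "x \<notin> closure {x. f x \<noteq> 0} \<Longrightarrow> pderivative i f x = 0"
  by (simp add: pderivative_def frechet_derivative_outside_support)

lemma ext_deriv_outside_support: "x \<notin> closure {x. \<phi> x \<noteq> 0} \<Longrightarrow> ext_deriv \<phi> x = 0"
  by (simp add: ext_deriv_eq pderivative_outside_support wedge_dx_linear)

lemma ext_deriv_test:
  assumes "\<phi> \<in> test_forms \<Omega> k"
  shows "ext_deriv \<phi> \<in> test_forms \<Omega> (k + 1)"
proof (rule test_forms_transfer[OF assms])
  show "Ck m (ext_deriv \<phi>)" for m by (rule Ck_ext_deriv[OF test_forms_Ck[OF assms]])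
  show "ext_deriv \<phi> x \<in> Alt (k + 1)" for x
    by (rule ext_deriv_Alt[OF test_forms_Ck[OF assms] test_forms_Alt[OF assms]])
qed (rule ext_deriv_outside_support)

lemma hodge_test:
  fixes \<phi> :: "'n::{finite,linorder} form"
  assumes "\<phi> \<in> test_forms \<Omega> k"
  shows "(\<lambda>x. hodge (\<phi> x)) \<in> test_forms \<Omega> (CARD('n) - k)"
proof (rule test_forms_transfer[OF assms])
  show "hodge (\<phi> x) = 0" if "x \<notin> closure {x. \<phi> x \<noteq> 0}" for x
    by (simp add: outside_support[OF that] hodge_linear)
  show "Ck m (\<lambda>x. hodge (\<phi> x))" for m
    by (rule Ck_bounded_linear_compose[OF bounded_linear_hodge test_forms_Ck[OF assms]])
  show "hodge (\<phi> x) \<in> Alt (CARD('n) - k)" for x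
    by (rule hodge_Alt[OF test_forms_Alt[OF assms]])
qed

lemma codiff_test:
  assumes "\<phi> \<in> test_forms \<Omega> (k + 1)"
  shows "codiff (k + 1) \<phi> \<in> test_forms \<Omega> k"
proof (rule test_forms_transfer[OF assms])
  have A: "\<phi> x \<in> Alt (k + 1)" for x using assms by (rule test_forms_Alt)
  show "codiff (k + 1) \<phi> x = 0" if "x \<notin> closure {x. \<phi> x \<noteq> 0}" for x
    using that A by (subst codiff_eq[OF test_forms_Ck[OF assms]]) (auto simp: pderivative_outside_support contr_linear)
  show "codiff (k + 1) \<phi> x \<in> Alt k" for x by (rule codiff_Alt[OF test_forms_Ck[OF assms] A])
  show "Ck m (codiff (k + 1) \<phi>)" for m by (rule Ck_codiff[OF test_forms_Ck[OF assms]])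
qed

lemma L2_test: "\<phi> \<in> test_forms \<Omega> k \<Longrightarrow> open \<Omega> \<Longrightarrow> bounded \<Omega> \<Longrightarrow> \<phi> \<in> L2 \<Omega> k"
  by (rule L2_continuous[OF Ck_continuous[OF test_forms_Ck]]) (auto intro: test_forms_Alt)

section \<open>Weak exterior derivatives\<close>

lemma pderivative_inner_contr:
  assumes "Ck 1 \<omega>" "Ck 1 \<phi>"
  shows "pderivative i (\<lambda>y. \<omega> y \<bullet> contr i (\<phi> y)) x =
    pderivative i \<omega> x \<bullet> contr i (\<phi> x) + \<omega> x \<bullet> contr i (pderivative i \<phi> x)"
proof -
  have "((\<lambda>y. \<omega> y \<bullet> contr i (\<phi> y)) has_derivative (\<lambda>v. \<omega> x \<bullet> contr i (frechet_derivative \<phi> (at x) v) +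
      frechet_derivative \<omega> (at x) v \<bullet> contr i (\<phi> x))) (at x)"
    using assms by (intro has_derivative_inner bounded_linear.has_derivative[OF bounded_linear_contr])
      (simp_all add: frechet_derivative_works)
  then show ?thesis by (simp add: pderivative_def frechet_derivativeI add.commute)
qed

lemma Ck_inner:
  fixes f g :: "'a::real_normed_vector \<Rightarrow> real ^ 'm::finite"
  assumes "Ck m f" "Ck m g"
  shows "Ck m (\<lambda>x. f x \<bullet> g x)"
  unfolding inner_vec_def inner_real_def
  by (intro Ck_sum Ck_mult Ck_bounded_linear_compose[OF bounded_linear_vec_nth] assms)

text \<open>
  Integration by parts: the difference of the integrands is the divergence of a compactly supported
  vector field.
\<close>

lemma Green_smooth:
  fixes \<omega> :: "'n::{finite,linorder} form"
  assumes \<Omega>: "open \<Omega>" "bounded \<Omega>"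
    and \<omega>: "Ck 1 \<omega>" "\<And>x. \<omega> x \<in> Alt k" and \<phi>: "\<phi> \<in> test_forms \<Omega> (k + 1)"
  shows "L2_inner \<Omega> (ext_deriv \<omega>) \<phi> = L2_inner \<Omega> \<omega> (codiff (k + 1) \<phi>)"
proof -
  have \<phi>1: "Ck 1 \<phi>" by (rule test_forms_Ck[OF \<phi>])
  have L: "\<omega> \<in> L2 \<Omega> k" "ext_deriv \<omega> \<in> L2 \<Omega> (k + 1)" "\<phi> \<in> L2 \<Omega> (k + 1)" "codiff (k + 1) \<phi> \<in> L2 \<Omega> k"
  proof -
    show "\<omega> \<in> L2 \<Omega> k" by (rule L2_continuous[OF Ck_continuous[OF \<omega>(1)] \<omega>(2) \<Omega>])
    have "continuous_on UNIV (ext_deriv \<omega>)" using Ck_ext_deriv[of 0 \<omega>] \<omega>(1) by simp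
    then show "ext_deriv \<omega> \<in> L2 \<Omega> (k + 1)" by (rule L2_continuous[OF _ ext_deriv_Alt[OF \<omega>] \<Omega>])
    show "\<phi> \<in> L2 \<Omega> (k + 1)" by (rule L2_test[OF \<phi> \<Omega>])
    show "codiff (k + 1) \<phi> \<in> L2 \<Omega> k" by (rule L2_test[OF codiff_test[OF \<phi>] \<Omega>])
  qed
  \<comment> \<open>The components of the vector field whose divergence is the difference of the integrands.\<close>
  let ?h = "\<lambda>i y. \<omega> y \<bullet> contr i (\<phi> y)"
  have Ckh: "Ck 1 (?h i)" for i
    by (intro Ck_inner \<omega>(1) Ck_bounded_linear_compose[OF bounded_linear_contr] \<phi>1)
  have conth: "continuous_on UNIV (pderivative i (?h i))" for i
    using Ck_pderivative[of 0 "?h i"] Ckh[of i] by simp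
  have sub: "closure {x. ?h i x \<noteq> 0} \<subseteq> closure {x. \<phi> x \<noteq> 0}" for i
    by (intro closure_mono) (auto simp: contr_linear)
  have supp: "closure {x. \<phi> x \<noteq> 0} \<subseteq> \<Omega>" "compact (closure {x. \<phi> x \<noteq> 0})"
    using \<phi> by (auto simp: test_forms_def)
  have h0: "(LINT x|lebesgue_on \<Omega>. pderivative i (?h i) x) = 0" for i
  proof -
    have "(LINT x|lebesgue_on \<Omega>. pderivative i (?h i) x) = (LINT x|lebesgue. pderivative i (?h i) x)"
    proof (rule integral_lebesgue_on_supported[OF \<Omega>(1)])
      fix x assume "x \<notin> \<Omega>"
      then have "x \<notin> closure {x. ?h i x \<noteq> 0}" using sub supp(1) by blast
      then show "pderivative i (?h i) x = 0" by (rule pderivative_outside_support)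
    qed
    also have "\<dots> = (LINT x|lborel. pderivative i (?h i) x)"
      using borel_measurable_continuous_onI[OF conth] by (intro integral_completion) simp
    also have "\<dots> = 0"
    proof (rule integral_pderivative_eq_0[OF Ckh])
      show "compact (closure {x. ?h i x \<noteq> 0})"
        unfolding compact_eq_bounded_closed using bounded_subset[OF compact_imp_bounded[OF supp(2)] sub] by simp
    qed
    finally show ?thesis .
  qed
  have "ext_deriv \<omega> x \<bullet> \<phi> x - \<omega> x \<bullet> codiff (k + 1) \<phi> x = (\<Sum>i\<in>UNIV. pderivative i (?h i) x)" for x
  proof -
    have "codiff (k + 1) \<phi> x = - (\<Sum>i\<in>UNIV. contr i (pderivative i \<phi> x))"
      by (rule codiff_eq[OF \<phi>1 test_forms_Alt[OF \<phi>]]) simp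
    then show ?thesis
      by (simp add: ext_deriv_eq pderivative_inner_contr[OF \<omega>(1) \<phi>1] inner_sum_left inner_sum_right
          wedge_contr_adjoint sum.distrib)
  qed
  then have "L2_inner \<Omega> (ext_deriv \<omega>) \<phi> - L2_inner \<Omega> \<omega> (codiff (k + 1) \<phi>)
      = (LINT x|lebesgue_on \<Omega>. (\<Sum>i\<in>UNIV. pderivative i (?h i) x))"
    unfolding L2_inner_def using L by (subst Bochner_Integration.integral_diff[symmetric]) (auto intro: L2_inner_integrable)
  also have "\<dots> = (\<Sum>i\<in>UNIV. (LINT x|lebesgue_on \<Omega>. pderivative i (?h i) x))"
    by (intro Bochner_Integration.integral_sum continuous_bounded_integrable conth \<Omega>)
  also have "\<dots> = 0" by (simp add: h0)
  finally show ?thesis by simp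
qed

lemma has_weak_d_smooth:
  assumes \<Omega>: "open \<Omega>" "bounded \<Omega>" and \<omega>: "Ck 1 \<omega>" "\<And>x. \<omega> x \<in> Alt k"
  shows "has_weak_d \<Omega> k \<omega> (ext_deriv \<omega>)"
proof -
  have "continuous_on UNIV (ext_deriv \<omega>)" using Ck_ext_deriv[of 0 \<omega>] \<omega>(1) by simp
  then have "ext_deriv \<omega> \<in> L2 \<Omega> (k + 1)" by (rule L2_continuous[OF _ ext_deriv_Alt[OF \<omega>] \<Omega>])
  then show ?thesis unfolding has_weak_d_def
    using L2_continuous[OF Ck_continuous[OF \<omega>(1)] \<omega>(2) \<Omega>] Green_smooth[OF \<Omega> \<omega>] by blast
qed

lemma has_weak_d_L2:
  assumes "has_weak_d \<Omega> k \<omega> \<eta>"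
  shows "\<omega> \<in> L2 \<Omega> k" "\<eta> \<in> L2 \<Omega> (k + 1)"
  using assms by (simp_all add: has_weak_d_def)

lemma has_weak_dD:
  "has_weak_d \<Omega> k \<omega> \<eta> \<Longrightarrow> \<phi> \<in> test_forms \<Omega> (k + 1) \<Longrightarrow> L2_inner \<Omega> \<eta> \<phi> = L2_inner \<Omega> \<omega> (codiff (k + 1) \<phi>)"
  by (simp add: has_weak_d_def)

lemma L2_component_integrable:
  assumes "\<omega> \<in> L2 \<Omega> k" "open \<Omega>" "bounded \<Omega>"
  shows "integrable (lebesgue_on \<Omega>) (\<lambda>x. \<omega> x $ S)"
proof -
  have "(\<lambda>x. dx S) \<in> L2 \<Omega> (card S)"
    by (rule L2_continuous) (use assms in \<open>auto simp: Alt_def dx_nth\<close>)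
  then have "integrable (lebesgue_on \<Omega>) (\<lambda>x. \<omega> x \<bullet> dx S)"
    using assms(1) by (rule L2_inner_integrable[rotated])
  then show ?thesis by (simp add: dx_def inner_axis)
qed

text \<open>
  A square integrable form is determined up to null sets by its integrals against test forms.
\<close>

lemma L2_eq_zero:
  assumes \<Omega>: "open \<Omega>" "bounded \<Omega>" and \<zeta>: "\<zeta> \<in> L2 \<Omega> k"
    and z: "\<And>\<phi>. \<phi> \<in> test_forms \<Omega> k \<Longrightarrow> L2_inner \<Omega> \<zeta> \<phi> = 0"
  shows "eq_on \<Omega> \<zeta> (\<lambda>x. 0)"
proof -
  have "AE x in lebesgue_on \<Omega>. \<zeta> x $ S = 0" for S
  proof (cases "card S = k")
    case False
    then show ?thesis using L2_Alt[OF \<zeta>] \<Omega>(1) by (intro AE_I2) (auto simp: Alt_def)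
  next
    case True
    show ?thesis
    proof (rule fundamental_lemma[OF \<Omega>(1) L2_component_integrable[OF \<zeta> \<Omega>]])
      fix \<psi> :: "'a space \<Rightarrow> real"
      assume \<psi>: "\<And>m. Ck m \<psi>" "compact (closure {x. \<psi> x \<noteq> 0})" "closure {x. \<psi> x \<noteq> 0} \<subseteq> \<Omega>"
      have "{x. \<psi> x *\<^sub>R (dx S :: 'a ext) \<noteq> 0} = {x. \<psi> x \<noteq> 0}"
        by (auto simp: dx_def)
      then have "(\<lambda>x. \<psi> x *\<^sub>R dx S) \<in> test_forms \<Omega> k"
        using \<psi> True unfolding test_forms_def
        by (auto intro!: Ck_scaleR Ck_const simp: Alt_def dx_nth simp del: Ck.simps)
      from z[OF this] show "(LINT x|lebesgue_on \<Omega>. \<zeta> x $ S * \<psi> x) = 0"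
        by (simp add: L2_inner_def dx_def inner_axis mult.commute)
    qed
  qed
  then have "AE x in lebesgue_on \<Omega>. \<forall>S\<in>UNIV. \<zeta> x $ S = 0"
    by (intro AE_finite_allI) auto
  then show ?thesis unfolding eq_on_def by (simp add: vec_eq_iff)
qed

lemma has_weak_d_diff:
  assumes \<Omega>: "open \<Omega>" "bounded \<Omega>" and "has_weak_d \<Omega> k \<omega> \<eta>" "has_weak_d \<Omega> k \<omega>' \<eta>'"
  shows "has_weak_d \<Omega> k (\<lambda>x. \<omega> x - \<omega>' x) (\<lambda>x. \<eta> x - \<eta>' x)"
proof -
  note L = has_weak_d_L2[OF assms(3)] has_weak_d_L2[OF assms(4)]
  have "L2_inner \<Omega> (\<lambda>x. \<eta> x - \<eta>' x) \<phi> = L2_inner \<Omega> (\<lambda>x. \<omega> x - \<omega>' x) (codiff (k + 1) \<phi>)"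
    if \<phi>: "\<phi> \<in> test_forms \<Omega> (k + 1)" for \<phi>
    using L2_inner_diff_left[OF L(2,4) L2_test[OF \<phi> \<Omega>]] L2_inner_diff_left[OF L(1,3) L2_test[OF codiff_test[OF \<phi>] \<Omega>]]
      has_weak_dD[OF assms(3) \<phi>] has_weak_dD[OF assms(4) \<phi>] by simp
  then show ?thesis using L by (simp add: has_weak_d_def L2_diff)
qed

lemma has_weak_d_unique:
  assumes \<Omega>: "open \<Omega>" "bounded \<Omega>" and d: "has_weak_d \<Omega> k \<omega> \<eta>" "has_weak_d \<Omega> k \<omega>' \<eta>'"
    and e: "eq_on \<Omega> \<omega> \<omega>'"
  shows "eq_on \<Omega> \<eta> \<eta>'"
proof -
  note L = has_weak_d_L2[OF d(1)] has_weak_d_L2[OF d(2)]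
  have "eq_on \<Omega> (\<lambda>x. \<eta> x - \<eta>' x) (\<lambda>x. 0)"
  proof (rule L2_eq_zero[OF \<Omega> L2_diff[OF L(2,4)]])
    fix \<phi> assume \<phi>: "\<phi> \<in> test_forms \<Omega> (k + 1)"
    note C = L2_test[OF codiff_test[OF \<phi>] \<Omega>]
    have "L2_inner \<Omega> \<omega> (codiff (k + 1) \<phi>) = L2_inner \<Omega> \<omega>' (codiff (k + 1) \<phi>)"
      by (rule L2_inner_cong[OF e eq_on_refl L(1,3) C C])
    then show "L2_inner \<Omega> (\<lambda>x. \<eta> x - \<eta>' x) \<phi> = 0"
      using L2_inner_diff_left[OF L(2,4) L2_test[OF \<phi> \<Omega>]] has_weak_dD[OF d(1) \<phi>] has_weak_dD[OF d(2) \<phi>] by simp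
  qed
  then show ?thesis by (simp add: eq_on_def)
qed

lemma has_weak_d_cong:
  assumes \<Omega>: "open \<Omega>" "bounded \<Omega>" and d: "has_weak_d \<Omega> k \<omega> \<eta>"
    and e: "eq_on \<Omega> \<omega> \<omega>'" and \<omega>': "\<omega>' \<in> L2 \<Omega> k"
  shows "has_weak_d \<Omega> k \<omega>' \<eta>"
proof -
  note L = has_weak_d_L2[OF d]
  have "L2_inner \<Omega> \<eta> \<phi> = L2_inner \<Omega> \<omega>' (codiff (k + 1) \<phi>)" if \<phi>: "\<phi> \<in> test_forms \<Omega> (k + 1)" for \<phi>
    using L2_inner_cong[OF e eq_on_refl L(1) \<omega>' L2_test[OF codiff_test[OF \<phi>] \<Omega>] L2_test[OF codiff_test[OF \<phi>] \<Omega>]]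
      has_weak_dD[OF d \<phi>] by simp
  then show ?thesis using L \<omega>' by (simp add: has_weak_d_def)
qed

lemma has_weak_d_subset:
  assumes d: "has_weak_d \<Omega> k \<omega> \<eta>" and K: "K \<subseteq> \<Omega>" "open K" "open \<Omega>"
  shows "has_weak_d K k \<omega> \<eta>"
proof -
  have "L2_inner K \<eta> \<phi> = L2_inner K \<omega> (codiff (k + 1) \<phi>)" if \<phi>: "\<phi> \<in> test_forms K (k + 1)" for \<phi>
  proof -
    have "L2_inner K \<eta> \<phi> = L2_inner \<Omega> \<eta> \<phi>"
      by (rule L2_inner_supported[OF K(2,3,1) test_forms_zero[OF \<phi>]])
    also have "\<dots> = L2_inner \<Omega> \<omega> (codiff (k + 1) \<phi>)"
      using has_weak_dD[OF d] \<phi> test_forms_mono[OF K(1)] by blast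
    also have "\<dots> = L2_inner K \<omega> (codiff (k + 1) \<phi>)"
      by (rule L2_inner_supported[OF K(2,3,1) test_forms_zero[OF codiff_test[OF \<phi>]], symmetric])
    finally show ?thesis .
  qed
  then show ?thesis using has_weak_d_L2[OF d] L2_subset[OF _ K] by (simp add: has_weak_d_def)
qed

text \<open>
  The weak form of $d\circ d=0$, obtained by duality from $\delta\circ\delta=0$ on test forms.
\<close>

lemma has_weak_d_has_weak_d:
  assumes d: "has_weak_d \<Omega> k \<omega> \<eta>"
  shows "has_weak_d \<Omega> (k + 1) \<eta> (\<lambda>x. 0)"
proof -
  have "L2_inner \<Omega> \<eta> (codiff (k + 1 + 1) \<phi>) = 0" if \<phi>: "\<phi> \<in> test_forms \<Omega> (k + 1 + 1)" for \<phi>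
  proof -
    have "codiff (k + 1) (codiff (k + 1 + 1) \<phi>) = (\<lambda>x. 0)"
      using codiff_codiff[OF test_forms_Ck[OF \<phi>], of k] test_forms_Alt[OF \<phi>] by (simp add: fun_eq_iff numeral_2_eq_2)
    then show ?thesis using has_weak_dD[OF d codiff_test[OF \<phi>]] by (simp add: L2_inner_zero)
  qed
  then show ?thesis using has_weak_d_L2[OF d] L2_zero by (simp add: has_weak_d_def L2_inner_zero)
qed

lemma H_has_weak_d: "\<omega> \<in> H \<Omega> k \<Longrightarrow> has_weak_d \<Omega> k \<omega> (weak_d \<Omega> k \<omega>)"
  unfolding H_def weak_d_def by (simp add: someI_ex)

lemma H_L2: "\<omega> \<in> H \<Omega> k \<Longrightarrow> \<omega> \<in> L2 \<Omega> k"
  by (simp add: H_def)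

lemma H_I: "has_weak_d \<Omega> k \<omega> \<eta> \<Longrightarrow> \<omega> \<in> H \<Omega> k"
  unfolding H_def using has_weak_d_L2 by blast

lemma weak_d_eq_on:
  assumes \<Omega>: "open \<Omega>" "bounded \<Omega>" and d: "has_weak_d \<Omega> k \<omega> \<eta>"
  shows "eq_on \<Omega> (weak_d \<Omega> k \<omega>) \<eta>"
  by (rule has_weak_d_unique[OF \<Omega> H_has_weak_d[OF H_I[OF d]] d eq_on_refl])

lemma weak_d_L2: "\<omega> \<in> H \<Omega> k \<Longrightarrow> weak_d \<Omega> k \<omega> \<in> L2 \<Omega> (k + 1)"
  using has_weak_d_L2(2)[OF H_has_weak_d] .

lemma weak_d_H: "\<omega> \<in> H \<Omega> k \<Longrightarrow> weak_d \<Omega> k \<omega> \<in> H \<Omega> (k + 1)"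
  by (rule H_I[OF has_weak_d_has_weak_d[OF H_has_weak_d]])

lemma weak_d_weak_d:
  assumes "open \<Omega>" "bounded \<Omega>" "\<omega> \<in> H \<Omega> k"
  shows "eq_on \<Omega> (weak_d \<Omega> (k + 1) (weak_d \<Omega> k \<omega>)) (\<lambda>x. 0)"
  by (rule weak_d_eq_on[OF assms(1,2) has_weak_d_has_weak_d[OF H_has_weak_d[OF assms(3)]]])

section \<open>Weak codifferentials\<close>

lemma has_weak_codiff_L2:
  assumes "has_weak_codiff \<Omega> k \<mu> \<nu>"
  shows "\<mu> \<in> L2 \<Omega> k" "\<nu> \<in> L2 \<Omega> (k - 1)"
  using assms by (simp_all add: has_weak_codiff_def)

lemma has_weak_codiffE:
  fixes \<mu> :: "'n::{finite,linorder} form"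
  assumes "has_weak_codiff \<Omega> k \<mu> \<nu>"
  obtains \<eta> where "has_weak_d \<Omega> (CARD('n) - k) (\<lambda>x. hodge (\<mu> x)) \<eta>"
    "\<nu> = (\<lambda>x. codiff_sign TYPE('n) k *\<^sub>R hodge (\<eta> x))"
  using assms by (auto simp: has_weak_codiff_def)

lemma has_weak_codiffI:
  fixes \<mu> :: "'n::{finite,linorder} form"
  assumes "\<mu> \<in> L2 \<Omega> k" "1 \<le> k" "k \<le> CARD('n)"
    and d: "has_weak_d \<Omega> (CARD('n) - k) (\<lambda>x. hodge (\<mu> x)) \<eta>"
  shows "has_weak_codiff \<Omega> k \<mu> (\<lambda>x. codiff_sign TYPE('n) k *\<^sub>R hodge (\<eta> x))"
proof -
  have "CARD('n) - (CARD('n) - k + 1) = k - 1" using assms(2,3) by simp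
  then have "(\<lambda>x. codiff_sign TYPE('n) k *\<^sub>R hodge (\<eta> x)) \<in> L2 \<Omega> (k - 1)"
    using L2_scaleR[OF L2_hodge[OF has_weak_d_L2(2)[OF d]]] by simp
  then show ?thesis using assms(1) d by (auto simp: has_weak_codiff_def)
qed

lemma has_weak_codiff_unique:
  fixes \<mu> :: "'n::{finite,linorder} form"
  assumes \<Omega>: "open \<Omega>" "bounded \<Omega>"
    and d: "has_weak_codiff \<Omega> k \<mu> \<nu>" "has_weak_codiff \<Omega> k \<mu>' \<nu>'" and e: "eq_on \<Omega> \<mu> \<mu>'"
  shows "eq_on \<Omega> \<nu> \<nu>'"
proof -
  obtain \<eta> where \<eta>: "has_weak_d \<Omega> (CARD('n) - k) (\<lambda>x. hodge (\<mu> x)) \<eta>"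
    "\<nu> = (\<lambda>x. codiff_sign TYPE('n) k *\<^sub>R hodge (\<eta> x))" using d(1) by (rule has_weak_codiffE)
  obtain \<eta>' where \<eta>': "has_weak_d \<Omega> (CARD('n) - k) (\<lambda>x. hodge (\<mu>' x)) \<eta>'"
    "\<nu>' = (\<lambda>x. codiff_sign TYPE('n) k *\<^sub>R hodge (\<eta>' x))" using d(2) by (rule has_weak_codiffE)
  have "eq_on \<Omega> \<eta> \<eta>'" by (rule has_weak_d_unique[OF \<Omega> \<eta>(1) \<eta>'(1) eq_on_compose[OF e]])
  then show ?thesis unfolding \<eta>(2) \<eta>'(2) by (rule eq_on_compose)
qed

lemma Hstar_has_weak_codiff: "\<mu> \<in> Hstar \<Omega> k \<Longrightarrow> has_weak_codiff \<Omega> k \<mu> (weak_codiff \<Omega> k \<mu>)"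
  unfolding Hstar_def weak_codiff_def by (simp add: someI_ex)

lemma Hstar_I: "has_weak_codiff \<Omega> k \<mu> \<nu> \<Longrightarrow> \<mu> \<in> Hstar \<Omega> k"
  unfolding Hstar_def using has_weak_codiff_L2 by blast

lemma weak_codiff_eq_on:
  assumes \<Omega>: "open \<Omega>" "bounded \<Omega>" and d: "has_weak_codiff \<Omega> k \<mu> \<nu>"
  shows "eq_on \<Omega> (weak_codiff \<Omega> k \<mu>) \<nu>"
  by (rule has_weak_codiff_unique[OF \<Omega> Hstar_has_weak_codiff[OF Hstar_I[OF d]] d eq_on_refl])

lemma has_weak_codiff_diff:
  fixes \<mu> :: "'n::{finite,linorder} form"
  assumes \<Omega>: "open \<Omega>" "bounded \<Omega>"
    and d: "has_weak_codiff \<Omega> k \<mu> \<nu>" "has_weak_codiff \<Omega> k \<mu>' \<nu>'"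
  shows "has_weak_codiff \<Omega> k (\<lambda>x. \<mu> x - \<mu>' x) (\<lambda>x. \<nu> x - \<nu>' x)"
proof -
  obtain \<eta> where \<eta>: "has_weak_d \<Omega> (CARD('n) - k) (\<lambda>x. hodge (\<mu> x)) \<eta>"
    "\<nu> = (\<lambda>x. codiff_sign TYPE('n) k *\<^sub>R hodge (\<eta> x))" using d(1) by (rule has_weak_codiffE)
  obtain \<eta>' where \<eta>': "has_weak_d \<Omega> (CARD('n) - k) (\<lambda>x. hodge (\<mu>' x)) \<eta>'"
    "\<nu>' = (\<lambda>x. codiff_sign TYPE('n) k *\<^sub>R hodge (\<eta>' x))" using d(2) by (rule has_weak_codiffE)
  have "has_weak_d \<Omega> (CARD('n) - k) (\<lambda>x. hodge (\<mu> x - \<mu>' x)) (\<lambda>x. \<eta> x - \<eta>' x)"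
    using has_weak_d_diff[OF \<Omega> \<eta>(1) \<eta>'(1)] by (simp add: hodge_linear)
  moreover have "(\<lambda>x. \<nu> x - \<nu>' x) = (\<lambda>x. codiff_sign TYPE('n) k *\<^sub>R hodge (\<eta> x - \<eta>' x))"
    unfolding \<eta>(2) \<eta>'(2) by (simp add: hodge_linear scaleR_diff_right)
  ultimately show ?thesis
    unfolding has_weak_codiff_def
    using L2_diff[OF has_weak_codiff_L2(1)[OF d(1)] has_weak_codiff_L2(1)[OF d(2)]]
      L2_diff[OF has_weak_codiff_L2(2)[OF d(1)] has_weak_codiff_L2(2)[OF d(2)]] by blast
qed

lemma has_weak_codiff_smooth:
  fixes \<mu> :: "'n::{finite,linorder} form"
  assumes \<Omega>: "open \<Omega>" "bounded \<Omega>" and \<mu>: "Ck 1 \<mu>" "\<And>x. \<mu> x \<in> Alt k" and k: "1 \<le> k" "k \<le> CARD('n)"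
  shows "has_weak_codiff \<Omega> k \<mu> (codiff k \<mu>)"
proof -
  have "has_weak_d \<Omega> (CARD('n) - k) (\<lambda>x. hodge (\<mu> x)) (ext_deriv (\<lambda>x. hodge (\<mu> x)))"
    by (intro has_weak_d_smooth \<Omega> hodge_Alt \<mu> Ck_bounded_linear_compose[OF bounded_linear_hodge])
  from has_weak_codiffI[OF L2_continuous[OF Ck_continuous[OF \<mu>(1)] \<mu>(2) \<Omega>] k this]
  show ?thesis unfolding codiff_def[abs_def] .
qed

lemma has_weak_codiff_test:
  fixes \<phi> :: "'n::{finite,linorder} form"
  assumes \<Omega>: "open \<Omega>" "bounded \<Omega>" and \<phi>: "\<phi> \<in> test_forms \<Omega> k" and k: "1 \<le> k" "k \<le> CARD('n)"
  shows "has_weak_codiff \<Omega> k \<phi> (codiff k \<phi>)"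
  by (rule has_weak_codiff_smooth[OF \<Omega> test_forms_Ck[OF \<phi>] test_forms_Alt[OF \<phi>] k])

lemma has_weak_d_test:
  assumes \<Omega>: "open \<Omega>" "bounded \<Omega>" and \<phi>: "\<phi> \<in> test_forms \<Omega> k"
  shows "has_weak_d \<Omega> k \<phi> (ext_deriv \<phi>)"
  by (rule has_weak_d_smooth[OF \<Omega> test_forms_Ck[OF \<phi>] test_forms_Alt[OF \<phi>]])

text \<open>
  The weak codifferential is defined by conjugating the weak exterior derivative with the Hodge star.
  It is the adjoint of the exterior derivative on test forms, the two codifferential signs and the two
  applications of the squared Hodge star cancelling.
\<close>

lemma has_weak_codiffD:
  fixes \<mu> :: "'n::{finite,linorder} form"
  assumes d: "has_weak_codiff \<Omega> (k + 1) \<mu> \<nu>" and k: "k < CARD('n)" and \<phi>: "\<phi> \<in> test_forms \<Omega> k"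
  shows "L2_inner \<Omega> \<nu> \<phi> = L2_inner \<Omega> \<mu> (ext_deriv \<phi>)"
proof -
  let ?s = "(-1 :: real) ^ (k * (CARD('n) - k))"
  have kk: "CARD('n) - (k + 1) + 1 = CARD('n) - k" using k by simp
  obtain \<eta> where \<eta>: "has_weak_d \<Omega> (CARD('n) - (k + 1)) (\<lambda>x. hodge (\<mu> x)) \<eta>"
    "\<nu> = (\<lambda>x. codiff_sign TYPE('n) (k + 1) *\<^sub>R hodge (\<eta> x))" using d by (rule has_weak_codiffE)
  have hh: "hodge (hodge (\<phi> x)) = ?s *\<^sub>R \<phi> x" for x by (rule hodge_hodge[OF test_forms_Alt[OF \<phi>]])
  have s: "?s * ?s = 1" by (simp flip: power_mult_distrib)
  have cd: "codiff (CARD('n) - k) (\<lambda>x. hodge (\<phi> x)) = (\<lambda>x. (codiff_sign TYPE('n) (CARD('n) - k) * ?s) *\<^sub>R hodge (ext_deriv \<phi> x))"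
  proof
    fix x
    have "ext_deriv (\<lambda>y. ?s *\<^sub>R \<phi> y) x = ?s *\<^sub>R ext_deriv \<phi> x"
    proof -
      have "pderivative i (\<lambda>y. ?s *\<^sub>R \<phi> y) x = ?s *\<^sub>R pderivative i \<phi> x" for i
        using test_forms_Ck[OF \<phi>, of 1] by (intro pderivative_bounded_linear_compose bounded_linear_scaleR_right) simp
      then show ?thesis by (simp add: ext_deriv_eq wedge_dx_linear scaleR_sum_right)
    qed
    then show "codiff (CARD('n) - k) (\<lambda>x. hodge (\<phi> x)) x = (codiff_sign TYPE('n) (CARD('n) - k) * ?s) *\<^sub>R hodge (ext_deriv \<phi> x)"
      unfolding codiff_def hh by (simp add: hodge_linear)
  qed
  have "(\<lambda>x. hodge (\<phi> x)) \<in> test_forms \<Omega> (CARD('n) - (k + 1) + 1)"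
    unfolding kk by (rule hodge_test[OF \<phi>])
  from has_weak_dD[OF \<eta>(1) this]
  have "L2_inner \<Omega> \<eta> (\<lambda>x. hodge (\<phi> x)) = codiff_sign TYPE('n) (CARD('n) - k) * ?s * L2_inner \<Omega> \<mu> (ext_deriv \<phi>)"
    unfolding kk cd by (simp only: L2_inner_scaleR_right L2_inner_hodge)
  moreover have "L2_inner \<Omega> \<eta> (\<lambda>x. hodge (\<phi> x)) = ?s * L2_inner \<Omega> (\<lambda>x. hodge (\<eta> x)) \<phi>"
    using L2_inner_hodge[of \<Omega> \<eta> "\<lambda>x. hodge (\<phi> x)"] by (simp only: hh L2_inner_scaleR_right)
  ultimately have e: "?s * (?s * L2_inner \<Omega> (\<lambda>x. hodge (\<eta> x)) \<phi>) =
      ?s * ?s * (codiff_sign TYPE('n) (CARD('n) - k) * L2_inner \<Omega> \<mu> (ext_deriv \<phi>))" by simp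
  have e': "L2_inner \<Omega> (\<lambda>x. hodge (\<eta> x)) \<phi> = codiff_sign TYPE('n) (CARD('n) - k) * L2_inner \<Omega> \<mu> (ext_deriv \<phi>)"
    using e unfolding mult.assoc[symmetric] s by simp
  have "codiff_sign TYPE('n) (k + 1) * codiff_sign TYPE('n) (CARD('n) - k) = 1"
  proof -
    obtain m where m: "CARD('n) = k + m" using k less_imp_le_nat le_Suc_ex by blast
    show ?thesis unfolding codiff_sign_def m power_add[symmetric] by (auto simp: uminus_power_if)
  qed
  then have "codiff_sign TYPE('n) (k + 1) * (codiff_sign TYPE('n) (CARD('n) - k) * a) = a" for a
    by (simp flip: mult.assoc)
  then show ?thesis unfolding \<eta>(2) L2_inner_scaleR_left e' .
qed

section \<open>Green formulas by density of test forms\<close>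

lemma sqrt_add_less:
  fixes a b e :: real
  assumes "sqrt (a + b) < e" "0 \<le> a" "0 \<le> b"
  shows "a < e\<^sup>2" "b < e\<^sup>2"
proof -
  have "(sqrt (a + b))\<^sup>2 < e\<^sup>2" using assms by (intro power_strict_mono) auto
  then have "a + b < e\<^sup>2" using assms by simp
  then show "a < e\<^sup>2" "b < e\<^sup>2" using assms by linarith+
qed

text \<open>
  In the graph norm the chosen representative may be replaced by any weak derivative.
\<close>

lemma graph_norm_weak_d:
  assumes \<Omega>: "open \<Omega>" "bounded \<Omega>" and d: "has_weak_d \<Omega> k \<omega> \<eta>"
  shows "graph_norm \<Omega> (weak_d \<Omega> k) \<omega> = sqrt (L2_inner \<Omega> \<omega> \<omega> + L2_inner \<Omega> \<eta> \<eta>)"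
proof -
  note e = weak_d_eq_on[OF \<Omega> d] and L = weak_d_L2[OF H_I[OF d]] has_weak_d_L2(2)[OF d]
  show ?thesis unfolding graph_norm_def using L2_inner_cong[OF e e L L] by simp
qed

lemma graph_norm_weak_codiff:
  assumes \<Omega>: "open \<Omega>" "bounded \<Omega>" and d: "has_weak_codiff \<Omega> k \<mu> \<nu>"
  shows "graph_norm \<Omega> (weak_codiff \<Omega> k) \<mu> = sqrt (L2_inner \<Omega> \<mu> \<mu> + L2_inner \<Omega> \<nu> \<nu>)"
proof -
  note e = weak_codiff_eq_on[OF \<Omega> d]
    and L = has_weak_codiff_L2(2)[OF Hstar_has_weak_codiff[OF Hstar_I[OF d]]] has_weak_codiff_L2(2)[OF d]
  show ?thesis unfolding graph_norm_def using L2_inner_cong[OF e e L L] by simp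
qed

lemma H0_approx:
  assumes \<Omega>: "open \<Omega>" "bounded \<Omega>" and \<omega>: "\<omega> \<in> H0 \<Omega> k" and e: "0 < e"
  obtains \<phi> where "\<phi> \<in> test_forms \<Omega> k"
    "has_weak_d \<Omega> k (\<lambda>x. \<omega> x - \<phi> x) (\<lambda>x. weak_d \<Omega> k \<omega> x - ext_deriv \<phi> x)"
    "L2_inner \<Omega> (\<lambda>x. \<omega> x - \<phi> x) (\<lambda>x. \<omega> x - \<phi> x) < e\<^sup>2"
    "L2_inner \<Omega> (\<lambda>x. weak_d \<Omega> k \<omega> x - ext_deriv \<phi> x) (\<lambda>x. weak_d \<Omega> k \<omega> x - ext_deriv \<phi> x) < e\<^sup>2"
proof -
  obtain \<phi> where \<phi>: "\<phi> \<in> test_forms \<Omega> k" and n: "graph_norm \<Omega> (weak_d \<Omega> k) (\<lambda>x. \<omega> x - \<phi> x) < e"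
    using \<omega> e unfolding H0_def by blast
  have "\<omega> \<in> H \<Omega> k" using \<omega> by (simp add: H0_def)
  note d = has_weak_d_diff[OF \<Omega> H_has_weak_d[OF this] has_weak_d_test[OF \<Omega> \<phi>]]
  show ?thesis
    using that[OF \<phi> d] sqrt_add_less[OF n[unfolded graph_norm_weak_d[OF \<Omega> d]]] L2_inner_self_nonneg by blast
qed

lemma H0star_approx:
  fixes \<mu> :: "'n::{finite,linorder} form"
  assumes \<Omega>: "open \<Omega>" "bounded \<Omega>" and \<mu>: "\<mu> \<in> H0star \<Omega> k" and e: "0 < e" and k: "1 \<le> k" "k \<le> CARD('n)"
  obtains \<phi> where "\<phi> \<in> test_forms \<Omega> k"
    "has_weak_codiff \<Omega> k (\<lambda>x. \<mu> x - \<phi> x) (\<lambda>x. weak_codiff \<Omega> k \<mu> x - codiff k \<phi> x)"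
    "L2_inner \<Omega> (\<lambda>x. \<mu> x - \<phi> x) (\<lambda>x. \<mu> x - \<phi> x) < e\<^sup>2"
    "L2_inner \<Omega> (\<lambda>x. weak_codiff \<Omega> k \<mu> x - codiff k \<phi> x) (\<lambda>x. weak_codiff \<Omega> k \<mu> x - codiff k \<phi> x) < e\<^sup>2"
proof -
  obtain \<phi> where \<phi>: "\<phi> \<in> test_forms \<Omega> k" and n: "graph_norm \<Omega> (weak_codiff \<Omega> k) (\<lambda>x. \<mu> x - \<phi> x) < e"
    using \<mu> e unfolding H0star_def by blast
  have "\<mu> \<in> Hstar \<Omega> k" using \<mu> by (simp add: H0star_def)
  note d = has_weak_codiff_diff[OF \<Omega> Hstar_has_weak_codiff[OF this] has_weak_codiff_test[OF \<Omega> \<phi> k]]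
  show ?thesis
    using that[OF \<phi> d] sqrt_add_less[OF n[unfolded graph_norm_weak_codiff[OF \<Omega> d]]] L2_inner_self_nonneg by blast
qed

lemma eq_zero_if_small:
  fixes a M :: real
  assumes "\<And>e. 0 < e \<Longrightarrow> \<bar>a\<bar> \<le> e * M"
  shows "a = 0"
proof (rule ccontr)
  assume "a \<noteq> 0"
  then have a: "0 < \<bar>a\<bar>" by simp
  have "0 \<le> M" using assms[of 1] a by simp
  then have "\<bar>a\<bar> / (2 * (M + 1)) * M < \<bar>a\<bar>" using a \<open>0 \<le> M\<close> by (simp add: field_simps add_nonneg_pos)
  moreover have "\<bar>a\<bar> \<le> \<bar>a\<bar> / (2 * (M + 1)) * M" using a \<open>0 \<le> M\<close> by (intro assms) simp
  ultimately show False by simp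
qed

lemma L2_inner_small:
  assumes "\<omega> \<in> L2 \<Omega> j" "\<mu> \<in> L2 \<Omega> k" "0 < e" "L2_inner \<Omega> \<omega> \<omega> < e\<^sup>2"
  shows "2 * \<bar>L2_inner \<Omega> \<omega> \<mu>\<bar> \<le> e * (1 + L2_inner \<Omega> \<mu> \<mu>)"
proof -
  have "L2_inner \<Omega> \<omega> \<omega> / e \<le> e" using assms(3,4) by (simp add: field_simps power2_eq_square)
  then show ?thesis using L2_inner_Young[OF assms(1-3)] by (simp add: algebra_simps)
qed

text \<open>
  No boundary term appears when the second factor is a limit of test forms. No regularity of the
  boundary of \<open>\<Omega>\<close> is involved.
\<close>

lemma Green_H_H0star:
  fixes \<omega> :: "'n::{finite,linorder} form"
  assumes \<Omega>: "open \<Omega>" "bounded \<Omega>" and k: "k < CARD('n)" and \<omega>: "\<omega> \<in> H \<Omega> k" and \<mu>: "\<mu> \<in> H0star \<Omega> (k + 1)"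
  shows "L2_inner \<Omega> (weak_d \<Omega> k \<omega>) \<mu> = L2_inner \<Omega> \<omega> (weak_codiff \<Omega> (k + 1) \<mu>)"
proof -
  let ?d = "weak_d \<Omega> k \<omega>" and ?\<nu> = "weak_codiff \<Omega> (k + 1) \<mu>"
  let ?M = "1 + L2_inner \<Omega> ?d ?d + (1 + L2_inner \<Omega> \<omega> \<omega>)"
  have \<mu>': "has_weak_codiff \<Omega> (k + 1) \<mu> ?\<nu>" using \<mu> by (intro Hstar_has_weak_codiff) (simp add: H0star_def)
  note L = H_L2[OF \<omega>] weak_d_L2[OF \<omega>] has_weak_codiff_L2[OF \<mu>', unfolded add_diff_cancel_right']
  have "\<bar>L2_inner \<Omega> ?d \<mu> - L2_inner \<Omega> \<omega> ?\<nu>\<bar> \<le> e * ?M" if e: "0 < e" for e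
  proof -
    obtain \<phi> where \<phi>: "\<phi> \<in> test_forms \<Omega> (k + 1)"
      and hd: "has_weak_codiff \<Omega> (k + 1) (\<lambda>x. \<mu> x - \<phi> x) (\<lambda>x. ?\<nu> x - codiff (k + 1) \<phi> x)"
      and s: "L2_inner \<Omega> (\<lambda>x. \<mu> x - \<phi> x) (\<lambda>x. \<mu> x - \<phi> x) < e\<^sup>2"
        "L2_inner \<Omega> (\<lambda>x. ?\<nu> x - codiff (k + 1) \<phi> x) (\<lambda>x. ?\<nu> x - codiff (k + 1) \<phi> x) < e\<^sup>2"
      by (rule H0star_approx[OF \<Omega> \<mu> e]) (use k in auto)
    let ?\<mu> = "\<lambda>x. \<mu> x - \<phi> x" and ?\<delta> = "\<lambda>x. ?\<nu> x - codiff (k + 1) \<phi> x"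
    note T = L2_test[OF \<phi> \<Omega>] L2_test[OF codiff_test[OF \<phi>] \<Omega>]
    note L' = has_weak_codiff_L2[OF hd, unfolded add_diff_cancel_right']
    have "L2_inner \<Omega> ?d \<mu> - L2_inner \<Omega> \<omega> ?\<nu> = L2_inner \<Omega> ?\<mu> ?d - L2_inner \<Omega> ?\<delta> \<omega>"
      unfolding L2_inner_commute[of \<Omega> ?\<mu>] L2_inner_commute[of \<Omega> ?\<delta>]
        L2_inner_diff_right[OF L(3) T(1) L(2)] L2_inner_diff_right[OF L(4) T(2) L(1)]
      using has_weak_dD[OF H_has_weak_d[OF \<omega>] \<phi>] by simp
    then show ?thesis using L2_inner_small[OF L'(1) L(2) e s(1)] L2_inner_small[OF L'(2) L(1) e s(2)]
      by (simp add: algebra_simps)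
  qed
  from eq_zero_if_small[OF this] show ?thesis by simp
qed

lemma Green_H0_Hstar:
  fixes \<omega> :: "'n::{finite,linorder} form"
  assumes \<Omega>: "open \<Omega>" "bounded \<Omega>" and k: "k < CARD('n)" and \<omega>: "\<omega> \<in> H0 \<Omega> k" and \<mu>: "\<mu> \<in> Hstar \<Omega> (k + 1)"
  shows "L2_inner \<Omega> (weak_d \<Omega> k \<omega>) \<mu> = L2_inner \<Omega> \<omega> (weak_codiff \<Omega> (k + 1) \<mu>)"
proof -
  let ?d = "weak_d \<Omega> k \<omega>" and ?\<nu> = "weak_codiff \<Omega> (k + 1) \<mu>"
  let ?M = "1 + L2_inner \<Omega> \<mu> \<mu> + (1 + L2_inner \<Omega> ?\<nu> ?\<nu>)"
  have \<omega>': "\<omega> \<in> H \<Omega> k" using \<omega> by (simp add: H0_def)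
  note \<mu>' = Hstar_has_weak_codiff[OF \<mu>]
  note L = H_L2[OF \<omega>'] weak_d_L2[OF \<omega>'] has_weak_codiff_L2[OF \<mu>', unfolded add_diff_cancel_right']
  have "\<bar>L2_inner \<Omega> ?d \<mu> - L2_inner \<Omega> \<omega> ?\<nu>\<bar> \<le> e * ?M" if e: "0 < e" for e
  proof -
    obtain \<phi> where \<phi>: "\<phi> \<in> test_forms \<Omega> k"
      and hd: "has_weak_d \<Omega> k (\<lambda>x. \<omega> x - \<phi> x) (\<lambda>x. ?d x - ext_deriv \<phi> x)"
      and s: "L2_inner \<Omega> (\<lambda>x. \<omega> x - \<phi> x) (\<lambda>x. \<omega> x - \<phi> x) < e\<^sup>2"
        "L2_inner \<Omega> (\<lambda>x. ?d x - ext_deriv \<phi> x) (\<lambda>x. ?d x - ext_deriv \<phi> x) < e\<^sup>2"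
      by (rule H0_approx[OF \<Omega> \<omega> e])
    let ?\<omega> = "\<lambda>x. \<omega> x - \<phi> x" and ?\<delta> = "\<lambda>x. ?d x - ext_deriv \<phi> x"
    note T = L2_test[OF \<phi> \<Omega>] L2_test[OF ext_deriv_test[OF \<phi>] \<Omega>]
    note L' = has_weak_d_L2[OF hd]
    have "L2_inner \<Omega> ?d \<mu> - L2_inner \<Omega> \<omega> ?\<nu> = L2_inner \<Omega> ?\<delta> \<mu> - L2_inner \<Omega> ?\<omega> ?\<nu>"
      unfolding L2_inner_diff_left[OF L(2) T(2) L(3)] L2_inner_diff_left[OF L(1) T(1) L(4)]
      using has_weak_codiffD[OF \<mu>' k \<phi>] by (simp add: L2_inner_commute)
    then show ?thesis using L2_inner_small[OF L'(1) L(4) e s(1)] L2_inner_small[OF L'(2) L(3) e s(2)]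
      by (simp add: algebra_simps)
  qed
  from eq_zero_if_small[OF this] show ?thesis by simp
qed

lemma weak_d_H0:
  assumes \<Omega>: "open \<Omega>" "bounded \<Omega>" and \<omega>: "\<omega> \<in> H0 \<Omega> k"
  shows "weak_d \<Omega> k \<omega> \<in> H0 \<Omega> (k + 1)"
proof -
  let ?d = "weak_d \<Omega> k \<omega>"
  have "\<exists>\<psi>\<in>test_forms \<Omega> (k + 1). graph_norm \<Omega> (weak_d \<Omega> (k + 1)) (\<lambda>x. ?d x - \<psi> x) < e" if e: "0 < e" for e
  proof -
    obtain \<phi> where \<phi>: "\<phi> \<in> test_forms \<Omega> k"
      and hd: "has_weak_d \<Omega> k (\<lambda>x. \<omega> x - \<phi> x) (\<lambda>x. ?d x - ext_deriv \<phi> x)"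
      and s: "L2_inner \<Omega> (\<lambda>x. ?d x - ext_deriv \<phi> x) (\<lambda>x. ?d x - ext_deriv \<phi> x) < e\<^sup>2"
      by (rule H0_approx[OF \<Omega> \<omega> e])
    have "graph_norm \<Omega> (weak_d \<Omega> (k + 1)) (\<lambda>x. ?d x - ext_deriv \<phi> x) < e"
      unfolding graph_norm_weak_d[OF \<Omega> has_weak_d_has_weak_d[OF hd]] L2_inner_zero
      using s e by (simp add: real_less_lsqrt L2_inner_self_nonneg)
    then show ?thesis using ext_deriv_test[OF \<phi>] by blast
  qed
  moreover have "\<omega> \<in> H \<Omega> k" using \<omega> by (simp add: H0_def)
  ultimately show ?thesis using weak_d_H by (simp add: H0_def)
qed

section \<open>Tensor product polynomials\<close>

lemma tensor_polyI: "(\<And>i. degree (p i) \<le> r i) \<Longrightarrow> (\<lambda>x. \<Prod>i\<in>UNIV. poly (p i) (x $ i)) \<in> tensor_poly r"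
  unfolding tensor_poly_def by (intro CollectI exI[of _ "1::nat"] exI[of _ "\<lambda>_. p"]) simp

lemma tensor_polyE:
  assumes "f \<in> tensor_poly r"
  obtains m p where "\<And>j i. j < (m::nat) \<Longrightarrow> degree (p j i) \<le> r i"
    "f = (\<lambda>x. \<Sum>j<m. \<Prod>i\<in>UNIV. poly (p j i) (x $ i))"
  using assms unfolding tensor_poly_def by blast

lemma tensor_poly_zero: "(\<lambda>x. 0) \<in> tensor_poly r"
  unfolding tensor_poly_def by (intro CollectI exI[of _ "0::nat"]) simp

lemma tensor_poly_add:
  assumes "f \<in> tensor_poly r" "g \<in> tensor_poly r"
  shows "(\<lambda>x. f x + g x) \<in> tensor_poly r"
proof -
  obtain m :: nat and p where p: "\<And>j i. j < m \<Longrightarrow> degree (p j i) \<le> r i"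
    and f: "f = (\<lambda>x. \<Sum>j<m. \<Prod>i\<in>UNIV. poly (p j i) (x $ i))" using assms(1) by (rule tensor_polyE) blast
  obtain m' :: nat and p' where p': "\<And>j i. j < m' \<Longrightarrow> degree (p' j i) \<le> r i"
    and g: "g = (\<lambda>x. \<Sum>j<m'. \<Prod>i\<in>UNIV. poly (p' j i) (x $ i))" using assms(2) by (rule tensor_polyE) blast
  let ?p = "\<lambda>j. if j < m then p j else p' (j - m)"
  have split: "(\<Sum>j<m + n. h j) = (\<Sum>j<m. h j) + (\<Sum>j<n. h (m + j))" for n and h :: "nat \<Rightarrow> real"
    by (induction n) (simp_all add: add_ac)
  have "(\<lambda>x. f x + g x) = (\<lambda>x. \<Sum>j<m + m'. \<Prod>i\<in>UNIV. poly (?p j i) (x $ i))"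
    unfolding f g split by simp
  moreover have "\<forall>j<m + m'. \<forall>i. degree (?p j i) \<le> r i" using p p' by auto
  ultimately show ?thesis
    unfolding tensor_poly_def by (intro CollectI exI[of _ "m + m'"] exI[of _ ?p] conjI)
qed

lemma tensor_poly_sum:
  assumes "\<And>a. a \<in> A \<Longrightarrow> f a \<in> tensor_poly r"
  shows "(\<lambda>x. \<Sum>a\<in>A. f a x) \<in> tensor_poly r"
  using assms by (induction A rule: infinite_finite_induct) (auto intro: tensor_poly_zero tensor_poly_add)

lemma tensor_poly_mult:
  assumes "f \<in> tensor_poly r" "g \<in> tensor_poly r'"
  shows "(\<lambda>x. f x * g x) \<in> tensor_poly (\<lambda>i. r i + r' i)"
proof -
  obtain m :: nat and p where p: "\<And>j i. j < m \<Longrightarrow> degree (p j i) \<le> r i"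
    and f: "f = (\<lambda>x. \<Sum>j<m. \<Prod>i\<in>UNIV. poly (p j i) (x $ i))" using assms(1) by (rule tensor_polyE) blast
  obtain m' :: nat and p' where p': "\<And>j i. j < m' \<Longrightarrow> degree (p' j i) \<le> r' i"
    and g: "g = (\<lambda>x. \<Sum>j<m'. \<Prod>i\<in>UNIV. poly (p' j i) (x $ i))" using assms(2) by (rule tensor_polyE) blast
  have "(\<lambda>x. f x * g x) = (\<lambda>x. \<Sum>j<m. \<Sum>l<m'. \<Prod>i\<in>UNIV. poly (p j i * p' l i) (x $ i))"
    unfolding f g by (simp add: sum_product prod.distrib)
  also have "\<dots> \<in> tensor_poly (\<lambda>i. r i + r' i)"
  proof (intro tensor_poly_sum tensor_polyI)
    fix j l i assume "j \<in> {..<m}" "l \<in> {..<m'}"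
    then show "degree (p j i * p' l i) \<le> r i + r' i"
      using p[of j i] p'[of l i] degree_mult_le[of "p j i" "p' l i"] by simp
  qed
  finally show ?thesis .
qed

lemma tensor_poly_mono:
  assumes "f \<in> tensor_poly r" "\<And>i. r i \<le> r' i"
  shows "f \<in> tensor_poly r'"
proof -
  obtain m :: nat and p where p: "\<And>j i. j < m \<Longrightarrow> degree (p j i) \<le> r i"
    and f: "f = (\<lambda>x. \<Sum>j<m. \<Prod>i\<in>UNIV. poly (p j i) (x $ i))" using assms(1) by (rule tensor_polyE) blast
  show ?thesis unfolding f
  proof (intro tensor_poly_sum tensor_polyI)
    fix j i assume "j \<in> {..<m}"
    then show "degree (p j i) \<le> r' i" using p[of j i] assms(2)[of i] by simp
  qed
qed

lemma tensor_poly_coordinate: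
  assumes "1 \<le> r i"
  shows "(\<lambda>x. x $ i) \<in> tensor_poly r"
proof -
  have "(\<lambda>x :: real ^ 'a. x $ i) = (\<lambda>x. \<Prod>j\<in>UNIV. poly (if j = i then [:0, 1:] else 1) (x $ j))"
    by (simp add: if_distrib[of "\<lambda>p. poly p _"] cong: if_cong)
  also have "\<dots> \<in> tensor_poly r" by (intro tensor_polyI) (use assms in simp)
  finally show ?thesis .
qed

lemma tensor_poly_const: "(\<lambda>x. a) \<in> tensor_poly r"
proof -
  fix i0 :: 'a
  have "(\<lambda>x :: real ^ 'a. a) = (\<lambda>x. \<Prod>j\<in>UNIV. poly (if j = i0 then [:a:] else 1) (x $ j))"
    by (simp add: if_distrib[of "\<lambda>p. poly p _"] cong: if_cong)
  also have "\<dots> \<in> tensor_poly r" by (intro tensor_polyI) simp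
  finally show ?thesis .
qed

lemma tensor_poly_cmul: "f \<in> tensor_poly r \<Longrightarrow> (\<lambda>x. a * f x) \<in> tensor_poly r"
  using tensor_poly_mult[OF tensor_poly_const[of a "\<lambda>_. 0"]] by simp

lemma Ck_poly_coordinate: "Ck m (\<lambda>x :: real ^ 'n::finite. poly p (x $ i))"
proof (induction p)
  case 0
  show ?case using Ck_const[of m 0] by simp
next
  case (pCons a p)
  have "Ck m (\<lambda>x :: real ^ 'n. a + x $ i * poly p (x $ i))"
    by (intro Ck_add Ck_const Ck_mult pCons.IH Ck_bounded_linear[OF bounded_linear_vec_nth])
  then show ?case by simp
qed

lemma Ck_tensor_poly: "f \<in> tensor_poly r \<Longrightarrow> Ck m f"
  by (erule tensor_polyE) (simp only:, intro Ck_sum Ck_prod Ck_poly_coordinate)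

lemma pderivative_sum:
  assumes "\<And>a. a \<in> A \<Longrightarrow> f a differentiable (at x)"
  shows "pderivative i (\<lambda>y. \<Sum>a\<in>A. f a y) x = (\<Sum>a\<in>A. pderivative i (f a) x)"
proof -
  have "((\<lambda>y. \<Sum>a\<in>A. f a y) has_derivative (\<lambda>v. \<Sum>a\<in>A. frechet_derivative (f a) (at x) v)) (at x)"
    by (intro has_derivative_sum) (use assms in \<open>simp add: frechet_derivative_works\<close>)
  then show ?thesis by (simp add: pderivative_def frechet_derivativeI)
qed

lemma pderivative_prod_poly:
  "pderivative i (\<lambda>x. \<Prod>j\<in>UNIV. poly (p j) (x $ j)) x = (\<Prod>j\<in>UNIV. poly (if j = i then pderiv (p j) else p j) (x $ j))"
proof -
  have d: "((\<lambda>x :: real ^ 'a. poly (p j) (x $ j)) has_derivative (\<lambda>v. poly (pderiv (p j)) (x $ j) * v $ j)) (at x)" for j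
    using has_derivative_compose[OF bounded_linear_imp_has_derivative[OF bounded_linear_vec_nth]
        poly_DERIV[unfolded has_field_derivative_def]] .
  have "((\<lambda>x. \<Prod>j\<in>UNIV. poly (p j) (x $ j)) has_derivative
      (\<lambda>v. \<Sum>j\<in>UNIV. (poly (pderiv (p j)) (x $ j) * v $ j) * (\<Prod>l\<in>UNIV - {j}. poly (p l) (x $ l)))) (at x)"
    by (rule has_derivative_prod) (rule d)
  then have "pderivative i (\<lambda>x. \<Prod>j\<in>UNIV. poly (p j) (x $ j)) x =
      (\<Sum>j\<in>UNIV. (poly (pderiv (p j)) (x $ j) * (axis i 1 :: real ^ 'a) $ j) * (\<Prod>l\<in>UNIV - {j}. poly (p l) (x $ l)))"
    by (simp add: pderivative_def frechet_derivativeI)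
  also have "\<dots> = (\<Sum>j\<in>UNIV. if j = i then poly (pderiv (p j)) (x $ j) * (\<Prod>l\<in>UNIV - {j}. poly (p l) (x $ l)) else 0)"
    by (intro sum.cong) (auto simp: axis_def)
  also have "\<dots> = poly (pderiv (p i)) (x $ i) * (\<Prod>l\<in>UNIV - {i}. poly (p l) (x $ l))" by simp
  also have "\<dots> = (\<Prod>j\<in>UNIV. poly (if j = i then pderiv (p j) else p j) (x $ j))"
    by (subst prod.remove[of UNIV i]) auto
  finally show ?thesis .
qed

lemma pderivative_tensor_poly:
  assumes "f \<in> tensor_poly r"
  shows "pderivative i f \<in> tensor_poly (\<lambda>j. if j = i then r j - 1 else r j)"
proof -
  obtain m :: nat and p where p: "\<And>j i. j < m \<Longrightarrow> degree (p j i) \<le> r i"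
    and f: "f = (\<lambda>x. \<Sum>j<m. \<Prod>i\<in>UNIV. poly (p j i) (x $ i))" using assms by (rule tensor_polyE) blast
  have "Ck 1 (\<lambda>x :: real ^ 'a. \<Prod>i\<in>UNIV. poly (p j i) (x $ i))" for j
    by (intro Ck_prod Ck_poly_coordinate)
  then have "pderivative i f = (\<lambda>x. \<Sum>j<m. \<Prod>l\<in>UNIV. poly (if l = i then pderiv (p j l) else p j l) (x $ l))"
    unfolding f by (intro ext) (simp add: pderivative_sum pderivative_prod_poly)
  also have "\<dots> \<in> tensor_poly (\<lambda>j. if j = i then r j - 1 else r j)"
  proof (intro tensor_poly_sum tensor_polyI)
    fix j l assume "j \<in> {..<m}"
    then show "degree (if l = i then pderiv (p j l) else p j l) \<le> (if l = i then r l - 1 else r l)"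
      using p[of j l] by (cases "l = i") (simp_all add: degree_pderiv diff_le_mono)
  qed
  finally show ?thesis .
qed

section \<open>Midpoint quadrature on a box\<close>

text \<open>
  Lebesgue measure is invariant under the reflection that replaces the coordinate \<open>x $ j\<close> by
  \<open>s - x $ j\<close>.
\<close>

lemma integral_reflect_lborel:
  fixes h :: "real ^ 'n::finite \<Rightarrow> real" and s :: real
  assumes "h \<in> borel_measurable borel"
  shows "(\<integral>x. h (x + (s - 2 * x $ j) *\<^sub>R axis j 1) \<partial>lborel) = (\<integral>x. h x \<partial>lborel)"
proof -
  let ?e = "axis j 1 :: real ^ 'n"
  \<comment> \<open>The reflection is the affine map with diagonal entries \<open>-1\<close> in direction \<open>j\<close> and \<open>1\<close> elsewhere.\<close>
  define c where "c k = (if k = ?e then -1 else 1 :: real)" for k :: "real ^ 'n"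
  define T where "T x = s *\<^sub>R ?e + (\<Sum>k\<in>Basis. (c k * (x \<bullet> k)) *\<^sub>R k)" for x
  have e: "?e \<in> Basis" by (simp add: axis_in_Basis_iff)
  have T: "T x = x + (s - 2 * x $ j) *\<^sub>R ?e" for x
  proof -
    have "(\<Sum>k\<in>Basis. (c k * (x \<bullet> k)) *\<^sub>R k) = (\<Sum>k\<in>Basis. (x \<bullet> k) *\<^sub>R k + (if k = ?e then (- 2 * (x \<bullet> k)) *\<^sub>R k else 0))"
      by (intro sum.cong) (auto simp: c_def algebra_simps simp flip: scaleR_left_distrib)
    also have "\<dots> = x + (- 2 * (x \<bullet> ?e)) *\<^sub>R ?e"
      using e by (simp add: sum.distrib euclidean_representation)
    finally show ?thesis by (simp add: T_def inner_axis algebra_simps)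
  qed
  have "lborel = density (distr lborel borel T) (\<lambda>_. ennreal (\<Prod>k\<in>Basis. \<bar>c k\<bar>))"
    unfolding T_def by (rule lborel_affine_euclidean) (simp add: c_def)
  moreover have "(\<Prod>k\<in>Basis. \<bar>c k\<bar>) = 1" by (intro prod.neutral) (simp add: c_def)
  ultimately have "lborel = distr lborel borel T" by (simp add: density_1)
  then have "(\<integral>x. h x \<partial>lborel) = (\<integral>x. h x \<partial>distr lborel borel T)" by simp
  also have "\<dots> = (\<integral>x. h (T x) \<partial>lborel)"
    by (rule integral_distr) (use assms in \<open>auto simp: T_def[abs_def]\<close>)
  finally show ?thesis by (simp add: T)
qed

text \<open>
  \<open>K\<close> is a nonempty open box with centre \<open>c\<close>.
\<close>

definition box_centre :: "'n::finite space set \<Rightarrow> 'n space \<Rightarrow> bool" where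
  "box_centre K c \<longleftrightarrow> K \<noteq> {} \<and> (\<exists>a b. K = box a b \<and> (\<forall>i. 2 * c $ i = a $ i + b $ i))"

lemma box_centre_open: "box_centre K c \<Longrightarrow> open K"
  and box_centre_bounded: "box_centre K c \<Longrightarrow> bounded K"
  by (auto simp: box_centre_def)

lemma box_centre_reflect:
  assumes "box_centre K c"
  shows "x + (2 * c $ j - 2 * x $ j) *\<^sub>R axis j 1 \<in> K \<longleftrightarrow> x \<in> K"
proof -
  obtain a b where K: "K = box a b" and c: "\<And>i. 2 * c $ i = a $ i + b $ i" using assms by (auto simp: box_centre_def)
  have "(a $ i < (x + (2 * c $ j - 2 * x $ j) *\<^sub>R axis j 1) $ i \<and> (x + (2 * c $ j - 2 * x $ j) *\<^sub>R axis j 1) $ i < b $ i)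
     \<longleftrightarrow> (a $ i < x $ i \<and> x $ i < b $ i)" for i
    using c[of i] by (cases "i = j") (auto simp: axis_def)
  then show ?thesis unfolding K mem_box_cart by simp
qed

lemma integral_odd_eq_0:
  fixes g :: "real ^ 'n::finite \<Rightarrow> real"
  assumes K: "box_centre K c" and g: "continuous_on UNIV g"
    and odd: "\<And>x. g (x + (2 * c $ j - 2 * x $ j) *\<^sub>R axis j 1) = - g x"
  shows "(LINT x|lebesgue_on K. g x) = 0"
proof -
  have m: "(\<lambda>x. indicator K x * g x) \<in> borel_measurable borel"
    using borel_measurable_continuous_onI[OF g] box_centre_open[OF K] by simp
  have "(LINT x|lebesgue_on K. g x) = (LINT x|lebesgue. indicator K x * g x)"
    using box_centre_open[OF K] by (subst integral_restrict_space) auto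
  also have "\<dots> = (LINT x|lborel. indicator K x * g x)"
    using m by (intro integral_completion) simp
  also have "\<dots> = (LINT x|lborel. indicator K (x + (2 * c $ j - 2 * x $ j) *\<^sub>R axis j 1) * g (x + (2 * c $ j - 2 * x $ j) *\<^sub>R axis j 1))"
    by (rule integral_reflect_lborel[OF m, symmetric])
  also have "\<dots> = (LINT x|lborel. - (indicator K x * g x))"
    unfolding odd using box_centre_reflect[OF K] by (simp add: indicator_def cong: if_cong)
  also have "\<dots> = - (LINT x|lborel. indicator K x * g x)" by simp
  also have "\<dots> = - (LINT x|lebesgue. indicator K x * g x)"
    using m by (subst integral_completion) simp_all
  also have "\<dots> = - (LINT x|lebesgue_on K. g x)"
    using box_centre_open[OF K] by (subst integral_restrict_space) auto
  finally show ?thesis by simp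
qed

lemma poly_midpoint:
  assumes "degree p \<le> 1"
  shows "poly p (2 * c - t) + poly p t = 2 * poly p (c :: real)"
proof -
  obtain a b where "p = [:a, b:]"
  proof -
    obtain a q where q: "p = pCons a q" by (cases p)
    obtain b q' where q': "q = pCons b q'" by (cases q)
    have "q' = 0" using assms unfolding q q' by (auto split: if_splits)
    then show ?thesis using that q q' by simp
  qed
  then show ?thesis by (simp add: algebra_simps)
qed

text \<open>
  The midpoint rule is exact for functions that are affine in each coordinate. The coordinates are
  replaced by those of the centre one at a time; each replacement changes the integrand by a function
  that is odd under the reflection of this coordinate.
\<close>

lemma integral_tensor_poly:
  assumes K: "box_centre K c" and f: "f \<in> tensor_poly (\<lambda>i. 1)"
  shows "(LINT x|lebesgue_on K. f x) = measure lebesgue K * f c"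
proof -
  note oK = box_centre_open[OF K] and bK = box_centre_bounded[OF K]
  obtain m :: nat and p where p: "\<And>j i. j < m \<Longrightarrow> degree (p j i) \<le> 1"
    and f: "f = (\<lambda>x. \<Sum>j<m. \<Prod>i\<in>UNIV. poly (p j i) (x $ i))" using f by (rule tensor_polyE) blast
  have single: "(LINT x|lebesgue_on K. (\<Prod>i\<in>UNIV. poly (q i) (x $ i))) = measure lebesgue K * (\<Prod>i\<in>UNIV. poly (q i) (c $ i))"
    if q: "\<And>i. degree (q i) \<le> 1" for q
  proof -
    \<comment> \<open>The product in which the coordinates in \<open>J\<close> have been replaced by those of the centre.\<close>
    define P where "P J x = (\<Prod>i\<in>UNIV. poly (q i) (if i \<in> J then c $ i else x $ i))" for J x
    have contP: "continuous_on UNIV (P J)" for J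
      unfolding P_def
    proof (intro continuous_on_prod continuous_on_poly)
      show "continuous_on UNIV (\<lambda>x. if i \<in> J then c $ i else x $ i)" for i
        by (cases "i \<in> J") (simp_all add: continuous_on_component)
    qed
    have "finite J \<Longrightarrow> (LINT x|lebesgue_on K. P {} x) = (LINT x|lebesgue_on K. P J x)" for J
    proof (induction J rule: finite_induct)
      case (insert j J)
      define A where "A x = (\<Prod>i\<in>UNIV - {j}. poly (q i) (if i \<in> J then c $ i else x $ i))" for x
      have PJ: "P J x = poly (q j) (x $ j) * A x" for x
        unfolding P_def A_def using insert(2) by (subst prod.remove[of UNIV j]) auto
      have PjJ: "P (insert j J) x = poly (q j) (c $ j) * A x" for x
        unfolding P_def A_def by (subst prod.remove[of UNIV j]) (auto intro!: prod.cong)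
      have AR: "A (x + (2 * c $ j - 2 * x $ j) *\<^sub>R axis j 1) = A x" for x
        unfolding A_def by (intro prod.cong) (auto simp: axis_def)
      have "(LINT x|lebesgue_on K. P J x - P (insert j J) x) = 0"
      proof (rule integral_odd_eq_0[OF K, where j = j])
        show "continuous_on UNIV (\<lambda>x. P J x - P (insert j J) x)" by (intro continuous_on_diff contP)
        fix x
        have "(x + (2 * c $ j - 2 * x $ j) *\<^sub>R axis j 1) $ j = 2 * c $ j - x $ j" by (simp add: axis_def)
        moreover have "poly (q j) (2 * c $ j - x $ j) = 2 * poly (q j) (c $ j) - poly (q j) (x $ j)"
          using poly_midpoint[OF q, of j "c $ j" "x $ j"] by linarith
        ultimately show "P J (x + (2 * c $ j - 2 * x $ j) *\<^sub>R axis j 1) - P (insert j J) (x + (2 * c $ j - 2 * x $ j) *\<^sub>R axis j 1)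
            = - (P J x - P (insert j J) x)"
          unfolding PJ PjJ AR by (simp only:) (simp add: algebra_simps)
      qed
      moreover have "(LINT x|lebesgue_on K. P J x - P (insert j J) x) = (LINT x|lebesgue_on K. P J x) - (LINT x|lebesgue_on K. P (insert j J) x)"
        by (intro Bochner_Integration.integral_diff continuous_bounded_integrable contP oK bK)
      ultimately show ?case using insert.IH by simp
    qed simp
    from this[of UNIV] show ?thesis
      using bounded_open_lmeasurable[OF oK bK] oK
      by (simp add: P_def measure_restrict_space space_restrict_space)
  qed
  have "(LINT x|lebesgue_on K. f x) = (\<Sum>j<m. (LINT x|lebesgue_on K. (\<Prod>i\<in>UNIV. poly (p j i) (x $ i))))"
    unfolding f by (intro Bochner_Integration.integral_sum continuous_bounded_integrable oK bK continuous_on_prod continuous_on_poly)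
      (simp add: continuous_on_component)
  also have "\<dots> = measure lebesgue K * f c"
    unfolding f sum_distrib_left by (intro sum.cong single p) auto
  finally show ?thesis .
qed

lemma measure_box_centre_pos: "box_centre K c \<Longrightarrow> 0 < measure lebesgue K"
  using negligible_iff_measure0 open_not_negligible bounded_open_lmeasurable
  by (metis box_centre_bounded box_centre_def box_centre_open zero_less_measure_iff)

section \<open>The local spaces\<close>

lemma form_expansion: "\<omega> x = (\<Sum>S\<in>UNIV. \<omega> x $ S *\<^sub>R dx S)" for \<omega> :: "'n::finite form"
  by (simp add: vec_eq_iff sum_component dx_nth if_distrib cong: if_cong)

lemma Ck_componentwise:
  fixes \<omega> :: "'n::finite form"
  assumes "\<And>S. Ck m (\<lambda>x. \<omega> x $ S)"
  shows "Ck m \<omega>"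
proof -
  have "Ck m (\<lambda>x. \<Sum>S\<in>UNIV. \<omega> x $ S *\<^sub>R (dx S :: 'n ext))"
    by (intro Ck_sum Ck_scaleR assms Ck_const)
  then show ?thesis by (simp flip: form_expansion)
qed

lemma Q1minus_Alt: "q \<in> Q1minus k \<Longrightarrow> q x \<in> Alt k"
  by (simp add: Q1minus_def)

lemma Q1minus_component:
  assumes "q \<in> Q1minus k"
  shows "(\<lambda>x. q x $ S) \<in> tensor_poly (\<lambda>i. 1 - (if i \<in> S then 1 else 0))"
proof (cases "card S = k")
  case False
  then have "(\<lambda>x. q x $ S) = (\<lambda>x. 0)" using Q1minus_Alt[OF assms] by (simp add: Alt_def)
  then show ?thesis by (simp only: tensor_poly_zero)
qed (use assms in \<open>simp add: Q1minus_def\<close>)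

lemma Q1minus_Ck: "q \<in> Q1minus k \<Longrightarrow> Ck m q"
  by (intro Ck_componentwise Ck_tensor_poly[OF Q1minus_component])

lemma Q1minus_scaleR: "q \<in> Q1minus k \<Longrightarrow> (\<lambda>x. a *\<^sub>R q x) \<in> Q1minus k"
  unfolding Q1minus_def by (auto intro: tensor_poly_cmul Alt_closed)

lemma Q1minus_const: "u \<in> Alt k \<Longrightarrow> (\<lambda>x. u) \<in> Q1minus k"
  unfolding Q1minus_def by (simp add: tensor_poly_const)

lemma P1minus_Q1minus:
  assumes "p \<in> P1minus k"
  shows "p \<in> Q1minus k"
proof -
  obtain u v where p: "p = (\<lambda>x. u + koszul x v)" and u: "u \<in> Alt k" and v: "v \<in> Alt (k + 1)"
    using assms by (auto simp: P1minus_def)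
  have "(\<lambda>x. p x $ S) \<in> tensor_poly (\<lambda>i. 1 - (if i \<in> S then 1 else 0))" for S
  proof -
    have "(\<lambda>x. p x $ S) = (\<lambda>x. u $ S + (\<Sum>i\<in>UNIV. (if i \<in> S then 0 else isgn i S * v $ insert i S) * (if i \<in> S then 0 else x $ i)))"
      unfolding p koszul_eq by (intro ext) (auto simp: sum_component contr_nth intro!: sum.cong)
    also have "\<dots> \<in> tensor_poly (\<lambda>i. 1 - (if i \<in> S then 1 else 0))"
    proof (intro tensor_poly_add tensor_poly_const tensor_poly_sum tensor_poly_cmul)
      fix i
      show "(\<lambda>x. if i \<in> S then 0 else x $ i) \<in> tensor_poly (\<lambda>i. 1 - (if i \<in> S then 1 else 0))"
        by (cases "i \<in> S") (simp_all add: tensor_poly_zero tensor_poly_coordinate)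
    qed
    finally show ?thesis .
  qed
  then show ?thesis using u v unfolding p Q1minus_def by (auto intro!: Alt_closed koszul_Alt)
qed

lemma pderivative_component:
  fixes \<omega> :: "'n::finite form"
  assumes "Ck 1 \<omega>"
  shows "pderivative i \<omega> x $ S = pderivative i (\<lambda>y. \<omega> y $ S) x"
  using assms by (simp add: pderivative_bounded_linear_compose[OF bounded_linear_vec_nth])

lemma ext_deriv_Q1minus:
  assumes q: "q \<in> Q1minus k"
  shows "ext_deriv q \<in> Q1minus (k + 1)"
proof -
  have "(\<lambda>x. ext_deriv q x $ T) \<in> tensor_poly (\<lambda>i. 1 - (if i \<in> T then 1 else 0))" for T
  proof -
    have "(\<lambda>x. ext_deriv q x $ T) = (\<lambda>x. \<Sum>i\<in>UNIV. (if i \<in> T then isgn i (T - {i}) else 0) * (if i \<in> T then pderivative i (\<lambda>y. q y $ (T - {i})) x else 0))"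
      unfolding ext_deriv_eq
      by (intro ext) (auto simp: sum_component wedge_dx_nth pderivative_component[OF Q1minus_Ck[OF q]] intro!: sum.cong)
    also have "\<dots> \<in> tensor_poly (\<lambda>i. 1 - (if i \<in> T then 1 else 0))"
    proof (intro tensor_poly_sum tensor_poly_cmul)
      fix i
      show "(\<lambda>x. if i \<in> T then pderivative i (\<lambda>y. q y $ (T - {i})) x else 0) \<in> tensor_poly (\<lambda>i. 1 - (if i \<in> T then 1 else 0))"
      proof (cases "i \<in> T")
        case True
        have "pderivative i (\<lambda>y. q y $ (T - {i})) \<in> tensor_poly (\<lambda>i. 1 - (if i \<in> T then 1 else 0))"
          by (rule tensor_poly_mono[OF pderivative_tensor_poly[OF Q1minus_component[OF q]]]) auto
        then show ?thesis using True by simp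
      qed (simp add: tensor_poly_zero)
    qed
    finally show ?thesis .
  qed
  then show ?thesis unfolding Q1minus_def using ext_deriv_Alt[OF Q1minus_Ck[OF q] Q1minus_Alt[OF q]] by simp
qed

lemma Q1starE:
  fixes m :: "'n::{finite,linorder} form"
  assumes "m \<in> Q1star k"
  obtains q where "q \<in> Q1minus (CARD('n) - k)" "m = (\<lambda>x. hodge (q x))"
  using assms by (auto simp: Q1star_def)

lemma Q1star_Ck: "m \<in> Q1star k \<Longrightarrow> Ck j m"
  by (erule Q1starE) (simp only: Ck_bounded_linear_compose[OF bounded_linear_hodge] Q1minus_Ck)

lemma Q1star_Alt:
  fixes m :: "'n::{finite,linorder} form"
  assumes "m \<in> Q1star k" "k \<le> CARD('n)"
  shows "m x \<in> Alt k"
proof -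
  obtain q where q: "q \<in> Q1minus (CARD('n) - k)" "m = (\<lambda>x. hodge (q x))" using assms(1) by (rule Q1starE)
  show ?thesis using hodge_Alt[OF Q1minus_Alt[OF q(1)], of x] assms(2) by (simp add: q(2))
qed

lemma Q1star_component:
  fixes m :: "'n::{finite,linorder} form"
  assumes "m \<in> Q1star k"
  shows "(\<lambda>x. m x $ S) \<in> tensor_poly (\<lambda>i. if i \<in> S then 1 else 0)"
proof -
  obtain q where q: "q \<in> Q1minus (CARD('n) - k)" "m = (\<lambda>x. hodge (q x))" using assms by (rule Q1starE)
  have "(\<lambda>x. m x $ S) = (\<lambda>x. shuffle_sign (- S) S * q x $ (- S))"
    by (simp add: q(2) hodge_nth mult.commute)
  also have "\<dots> \<in> tensor_poly (\<lambda>i. 1 - (if i \<in> - S then 1 else 0))"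
    by (rule tensor_poly_cmul[OF Q1minus_component[OF q(1)]])
  finally show ?thesis by (rule tensor_poly_mono) simp
qed

lemma hodge_Q1star:
  fixes m :: "'n::{finite,linorder} form"
  assumes "m \<in> Q1star k"
  shows "(\<lambda>x. hodge (m x)) \<in> Q1minus (CARD('n) - k)"
proof -
  obtain q where q: "q \<in> Q1minus (CARD('n) - k)" "m = (\<lambda>x. hodge (q x))" using assms by (rule Q1starE)
  then show ?thesis using Q1minus_scaleR[OF q(1)] by (simp add: hodge_hodge[OF Q1minus_Alt[OF q(1)]])
qed

lemma codiff_Q1star:
  fixes m :: "'n::{finite,linorder} form"
  assumes "m \<in> Q1star (k + 1)" "k < CARD('n)"
  shows "codiff (k + 1) m \<in> Q1star k"
proof -
  have e: "CARD('n) - (k + 1) + 1 = CARD('n) - k" using assms(2) by simp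
  have "codiff (k + 1) m = (\<lambda>x. hodge (codiff_sign TYPE('n) (k + 1) *\<^sub>R ext_deriv (\<lambda>y. hodge (m y)) x))"
    by (simp add: codiff_def[abs_def] hodge_linear)
  moreover have "(\<lambda>x. codiff_sign TYPE('n) (k + 1) *\<^sub>R ext_deriv (\<lambda>y. hodge (m y)) x) \<in> Q1minus (CARD('n) - k)"
    using Q1minus_scaleR[OF ext_deriv_Q1minus[OF hodge_Q1star[OF assms(1)]]] unfolding e .
  ultimately show ?thesis unfolding Q1star_def by (rule image_eqI)
qed

lemma P1star_Q1star: "m \<in> P1star k \<Longrightarrow> m \<in> Q1star k"
  unfolding P1star_def Q1star_def using P1minus_Q1minus by blast

text \<open>
  The coefficients of $dx^S$ in \<open>q\<close> and \<open>m\<close> are affine in the coordinates outside \<open>S\<close> and in \<open>S\<close>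
  respectively, so the midpoint rule is exact for their product.
\<close>

lemma L2_inner_Q1minus_Q1star:
  assumes K: "box_centre K c" and q: "q \<in> Q1minus k" and m: "m \<in> Q1star j"
  shows "L2_inner K q m = measure lebesgue K * (q c \<bullet> m c)"
proof -
  have "(\<lambda>x. q x $ S * m x $ S) \<in> tensor_poly (\<lambda>i. 1)" for S
    by (rule tensor_poly_mono[OF tensor_poly_mult[OF Q1minus_component[OF q] Q1star_component[OF m]]]) simp
  then have "(\<lambda>x. q x \<bullet> m x) \<in> tensor_poly (\<lambda>i. 1)"
    unfolding inner_vec_def inner_real_def by (intro tensor_poly_sum)
  then show ?thesis unfolding L2_inner_def by (rule integral_tensor_poly[OF K])
qed

lemma ext_deriv_koszul:
  assumes v: "v \<in> Alt (k + 1)"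
  shows "ext_deriv (\<lambda>y. u + koszul y v) x = real (k + 1) *\<^sub>R v"
proof -
  have "((\<lambda>y. y $ i *\<^sub>R contr i v) has_derivative (\<lambda>h. h $ i *\<^sub>R contr i v)) (at x)" for i
    by (rule has_derivative_scaleR_left[OF bounded_linear_imp_has_derivative[OF bounded_linear_vec_nth]])
  then have "((\<lambda>y. u + (\<Sum>i\<in>UNIV. y $ i *\<^sub>R contr i v)) has_derivative
      (\<lambda>h. 0 + (\<Sum>i\<in>UNIV. h $ i *\<^sub>R contr i v))) (at x)"
    by (intro has_derivative_add has_derivative_const has_derivative_sum)
  then have "pderivative i (\<lambda>y. u + koszul y v) x = contr i v" for i
    unfolding koszul_eq
    by (simp add: pderivative_def frechet_derivativeI axis_def if_distrib[of "\<lambda>a. a *\<^sub>R _"] cong: if_cong)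
  then show ?thesis unfolding ext_deriv_eq using sum_wedge_contr[OF v] by simp
qed

text \<open>
  A Whitney form is determined by its value at one point and its exterior derivative, which is
  constant.
\<close>

lemma P1minus_deriv:
  assumes "p \<in> P1minus k"
  obtains v where "v \<in> Alt (k + 1)" "\<And>x c. p x = p c + koszul (x - c) v" "\<And>x. ext_deriv p x = real (k + 1) *\<^sub>R v"
proof -
  obtain u v where p: "p = (\<lambda>x. u + koszul x v)" and v: "v \<in> Alt (k + 1)"
    using assms by (auto simp: P1minus_def)
  have "p x = p c + koszul (x - c) v" for x c
    unfolding p koszul_eq by (simp add: scaleR_diff_left sum_subtractf)
  then show ?thesis using that[OF v] ext_deriv_koszul[OF v] unfolding p by blast
qed

lemma P1minus_ext_deriv_const:
  assumes "p \<in> P1minus k"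
  shows "ext_deriv p = (\<lambda>x. ext_deriv p c)"
  using P1minus_deriv[OF assms] by metis

lemma P1minus_eqI:
  assumes "p \<in> P1minus k" "p' \<in> P1minus k" "p c = p' c" "ext_deriv p c = ext_deriv p' c"
  shows "p = p'"
proof -
  obtain v where v: "\<And>x c. p x = p c + koszul (x - c) v" "\<And>x. ext_deriv p x = real (k + 1) *\<^sub>R v"
    using assms(1) by (rule P1minus_deriv) blast
  obtain v' where v': "\<And>x c. p' x = p' c + koszul (x - c) v'" "\<And>x. ext_deriv p' x = real (k + 1) *\<^sub>R v'"
    using assms(2) by (rule P1minus_deriv) blast
  have "v = v'" using assms(4) unfolding v(2) v'(2) by simp
  then show ?thesis using assms(3) v(1)[of _ c] v'(1)[of _ c] by (intro ext) metis
qed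

lemma P1minus_exists:
  assumes u: "u \<in> Alt k" and w: "w \<in> Alt (k + 1)"
  obtains p where "p \<in> P1minus k" "p c = u" "\<And>x. ext_deriv p x = w"
proof -
  let ?v = "inverse (real (k + 1)) *\<^sub>R w"
  let ?p = "\<lambda>x. (u - koszul c ?v) + koszul x ?v"
  have v: "?v \<in> Alt (k + 1)" using w by (intro Alt_closed)
  have p: "?p \<in> P1minus k"
    unfolding P1minus_def using u v koszul_Alt[OF v] by (intro CollectI exI[of _ "u - koszul c ?v"] exI[of _ ?v]) (auto intro: Alt_closed)
  have "ext_deriv ?p x = w" for x unfolding ext_deriv_koszul[OF v] by simp
  then show ?thesis using that[OF p] by simp
qed

lemma P0_P1minus: "u \<in> Alt k \<Longrightarrow> (\<lambda>x. u) \<in> P1minus k"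
  unfolding P1minus_def by (intro CollectI exI[of _ u] exI[of _ 0]) (auto simp: koszul_eq contr_linear intro: Alt_closed)

lemma ext_deriv_const: "ext_deriv (\<lambda>x. u) = (\<lambda>x. 0)"
  by (simp add: ext_deriv_eq pderivative_def frechet_derivative_const wedge_dx_linear fun_eq_iff)

lemma hodge_surj:
  fixes u :: "'n::{finite,linorder} ext"
  assumes "u \<in> Alt k" "k \<le> CARD('n)"
  obtains w where "w \<in> Alt (CARD('n) - k)" "hodge w = u"
proof
  let ?s = "(-1 :: real) ^ (k * (CARD('n) - k))"
  show "?s *\<^sub>R hodge u \<in> Alt (CARD('n) - k)" by (intro Alt_closed hodge_Alt assms)
  have "?s * ?s = 1" by (simp flip: power_mult_distrib)
  then show "hodge (?s *\<^sub>R hodge u) = u" by (simp only: hodge_linear hodge_hodge[OF assms(1)] scaleR_scaleR scaleR_one)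
qed

lemma P1star_const:
  fixes w :: "'n::{finite,linorder} ext"
  assumes "w \<in> Alt k" "k \<le> CARD('n)"
  shows "(\<lambda>x. w) \<in> P1star k"
proof -
  obtain w' where "w' \<in> Alt (CARD('n) - k)" "hodge w' = w" using assms by (rule hodge_surj)
  then show ?thesis unfolding P1star_def using P0_P1minus by fast
qed

lemma codiff_const: "codiff k (\<lambda>x. w) = (\<lambda>x. 0)"
  by (simp add: codiff_def[abs_def] ext_deriv_const hodge_linear)

text \<open>
  Together with the constant forms, these dual Whitney forms show that \<open>P1star (k + 1)\<close> is large enough
  to determine the interpolant.
\<close>

lemma P1star_codiff_surj:
  fixes u :: "'n::{finite,linorder} ext"
  assumes u: "u \<in> Alt k" and k: "k < CARD('n)"
  obtains m where "m \<in> P1star (k + 1)" "\<And>x. codiff (k + 1) m x = u" "m c = 0"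
proof -
  let ?s = "(-1 :: real) ^ ((CARD('n) - (k + 1)) * (CARD('n) - (CARD('n) - (k + 1))))"
  let ?t = "codiff_sign TYPE('n) (k + 1)"
  have e: "CARD('n) - (k + 1) + 1 = CARD('n) - k" using k by simp
  obtain w where w: "w \<in> Alt (CARD('n) - k)" "hodge w = u" using u k by (rule hodge_surj[OF _ less_imp_le])
  have "(?t * ?s) *\<^sub>R w \<in> Alt (CARD('n) - (k + 1) + 1)" unfolding e using w(1) by (rule Alt_closed)
  then obtain p where p: "p \<in> P1minus (CARD('n) - (k + 1))" "p c = 0" "\<And>x. ext_deriv p x = (?t * ?s) *\<^sub>R w"
    by (rule P1minus_exists[OF Alt_closed(1)]) blast
  have Q: "p \<in> Q1minus (CARD('n) - (k + 1))" by (rule P1minus_Q1minus[OF p(1)])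
  show ?thesis
  proof
    show "(\<lambda>x. hodge (p x)) \<in> P1star (k + 1)" unfolding P1star_def using p(1) by (rule imageI)
    show "hodge (p c) = 0" by (simp add: p(2) hodge_linear)
    fix x
    \<comment> \<open>The signs \<open>?s\<close> of the squared star and \<open>?t\<close> of the codifferential were built into the derivative of \<open>p\<close>.\<close>
    have hh: "(\<lambda>y. hodge (hodge (p y))) = (\<lambda>y. ?s *\<^sub>R p y)" using hodge_hodge[OF Q1minus_Alt[OF Q]] by blast
    have "pderivative i (\<lambda>y. ?s *\<^sub>R p y) x = ?s *\<^sub>R pderivative i p x" for i
      using Q1minus_Ck[OF Q, of 1] by (intro pderivative_bounded_linear_compose bounded_linear_scaleR_right) simp
    then have "ext_deriv (\<lambda>y. ?s *\<^sub>R p y) x = ?s *\<^sub>R ext_deriv p x"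
      by (simp add: ext_deriv_eq wedge_dx_linear scaleR_sum_right)
    then have "codiff (k + 1) (\<lambda>x. hodge (p x)) x = (?t * (?s * (?t * ?s))) *\<^sub>R u"
      unfolding codiff_def hh p(3) w(2)[symmetric] by (simp only: hodge_linear scaleR_scaleR)
    moreover have "?t * (?s * (?t * ?s)) = 1"
    proof -
      have "?s * ?s = 1" by (simp flip: power_mult_distrib)
      moreover have "?t * (?s * (?t * ?s)) = (?t * ?t) * (?s * ?s)" by (simp only: mult_ac)
      ultimately show ?thesis by (simp only: codiff_sign_sq mult_1)
    qed
    ultimately show "codiff (k + 1) (\<lambda>x. hodge (p x)) x = u" by (simp only: scaleR_one)
  qed
qed

section \<open>The local interpolant\<close>

lemma L2_Q1minus: "q \<in> Q1minus k \<Longrightarrow> open K \<Longrightarrow> bounded K \<Longrightarrow> q \<in> L2 K k"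
  by (rule L2_continuous[OF Ck_continuous[OF Q1minus_Ck] Q1minus_Alt])

lemma L2_Q1star:
  fixes m :: "'n::{finite,linorder} form"
  shows "m \<in> Q1star k \<Longrightarrow> k \<le> CARD('n) \<Longrightarrow> open K \<Longrightarrow> bounded K \<Longrightarrow> m \<in> L2 K k"
  by (rule L2_continuous[OF Ck_continuous[OF Q1star_Ck] Q1star_Alt])

lemma weak_d_Q1minus:
  assumes K: "open K" "bounded K" and q: "q \<in> Q1minus k" and \<omega>: "\<omega> \<in> L2 K k" "eq_on K \<omega> q"
  shows "has_weak_d K k \<omega> (ext_deriv q)"
  by (rule has_weak_d_cong[OF K has_weak_d_smooth[OF K Q1minus_Ck[OF q] Q1minus_Alt[OF q]] eq_on_sym[OF \<omega>(2)] \<omega>(1)])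

lemma has_weak_codiff_Q1star:
  fixes m :: "'n::{finite,linorder} form"
  assumes K: "open K" "bounded K" and m: "m \<in> Q1star (k + 1)" and k: "k < CARD('n)"
  shows "has_weak_codiff K (k + 1) m (codiff (k + 1) m)"
  by (rule has_weak_codiff_smooth[OF K Q1star_Ck[OF m] Q1star_Alt[OF m]]) (use k in auto)

text \<open>
  The pairing depends only on the values at the centre of \<open>q\<close>, \<open>m\<close> and their derivatives. The forms
  \<open>\<omega>\<close>, \<open>\<eta>\<close>, \<open>\<mu>\<close>, \<open>\<nu>\<close> are representatives up to null sets on the cell; in particular \<open>\<nu>\<close> may be the
  weak codifferential on a larger domain.
\<close>

lemma cell_pairing:
  fixes q :: "'n::{finite,linorder} form"
  assumes K: "box_centre K c" and k: "k < CARD('n)" and q: "q \<in> Q1minus k" and m: "m \<in> Q1star (k + 1)"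
    and \<omega>: "\<omega> \<in> L2 K k" "eq_on K \<omega> q" and \<eta>: "\<eta> \<in> L2 K (k + 1)" "eq_on K \<eta> (ext_deriv q)"
    and \<mu>: "\<mu> \<in> L2 K (k + 1)" "eq_on K \<mu> m" and \<nu>: "\<nu> \<in> L2 K k" "eq_on K \<nu> (codiff (k + 1) m)"
  shows "L2_inner K \<eta> \<mu> - L2_inner K \<omega> \<nu> =
    measure lebesgue K * (ext_deriv q c \<bullet> m c - q c \<bullet> codiff (k + 1) m c)"
proof -
  note o = box_centre_open[OF K] box_centre_bounded[OF K]
  note dq = ext_deriv_Q1minus[OF q] and dm = codiff_Q1star[OF m k]
  have "L2_inner K \<eta> \<mu> = L2_inner K (ext_deriv q) m"
    by (rule L2_inner_cong[OF \<eta>(2) \<mu>(2) \<eta>(1) L2_Q1minus[OF dq o] \<mu>(1) L2_Q1star[OF m _ o]]) (use k in simp)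
  moreover have "L2_inner K \<omega> \<nu> = L2_inner K q (codiff (k + 1) m)"
    by (rule L2_inner_cong[OF \<omega>(2) \<nu>(2) \<omega>(1) L2_Q1minus[OF q o] \<nu>(1) L2_Q1star[OF dm _ o]]) (use k in simp)
  ultimately show ?thesis
    using L2_inner_Q1minus_Q1star[OF K dq m] L2_inner_Q1minus_Q1star[OF K q dm] by (simp add: right_diff_distrib)
qed

lemma weak_d_cell_pairing:
  fixes q :: "'n::{finite,linorder} form"
  assumes K: "box_centre K c" and k: "k < CARD('n)" and q: "q \<in> Q1minus k" and m: "m \<in> Q1star (k + 1)"
    and \<omega>: "\<omega> \<in> L2 K k" "eq_on K \<omega> q"
    and \<mu>: "\<mu> \<in> L2 K (k + 1)" "eq_on K \<mu> m" and \<nu>: "\<nu> \<in> L2 K k" "eq_on K \<nu> (codiff (k + 1) m)"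
  shows "L2_inner K (weak_d K k \<omega>) \<mu> - L2_inner K \<omega> \<nu> =
    measure lebesgue K * (ext_deriv q c \<bullet> m c - q c \<bullet> codiff (k + 1) m c)"
proof -
  note o = box_centre_open[OF K] box_centre_bounded[OF K]
  note d = weak_d_Q1minus[OF o q \<omega>]
  show ?thesis
    by (rule cell_pairing[OF K k q m \<omega> weak_d_L2[OF H_I[OF d]] weak_d_eq_on[OF o d] \<mu> \<nu>])
qed

text \<open>
  The interpolant of a form in \<open>Q1minus k\<close> is the Whitney form with the same value and the same exterior
  derivative at the centre of the cell.
\<close>

lemma local_interp_characterisation:
  fixes q :: "'n::{finite,linorder} form"
  assumes K: "box_centre K c" and k: "k < CARD('n)" and q: "q \<in> Q1minus k"
    and \<omega>: "\<omega> \<in> L2 K k" "eq_on K \<omega> q"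
  shows "local_interp k K \<omega> \<in> P1minus k" "local_interp k K \<omega> c = q c"
    "ext_deriv (local_interp k K \<omega>) c = ext_deriv q c"
proof -
  note o = box_centre_open[OF K] box_centre_bounded[OF K]
  let ?B = "\<lambda>\<omega> \<mu>. L2_inner K (weak_d K k \<omega>) \<mu> - L2_inner K \<omega> (weak_codiff K (k + 1) \<mu>)"
  have B: "?B \<omega> \<mu> = measure lebesgue K * (ext_deriv q c \<bullet> \<mu> c - q c \<bullet> codiff (k + 1) \<mu> c)"
    if q: "q \<in> Q1minus k" and \<omega>: "\<omega> \<in> L2 K k" "eq_on K \<omega> q" and \<mu>: "\<mu> \<in> P1star (k + 1)" for q \<omega> \<mu>
  proof -
    note m = P1star_Q1star[OF \<mu>]
    note d = has_weak_codiff_Q1star[OF o m k]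
    have "weak_codiff K (k + 1) \<mu> \<in> L2 K k"
      using has_weak_codiff_L2(2)[OF Hstar_has_weak_codiff[OF Hstar_I[OF d]]] by simp
    moreover have "\<mu> \<in> L2 K (k + 1)" by (rule has_weak_codiff_L2(1)[OF d])
    ultimately show ?thesis
      by (rule weak_d_cell_pairing[OF K k q m \<omega> _ eq_on_refl _ weak_codiff_eq_on[OF o d], rotated])
  qed
  have Bp: "?B p \<mu> = measure lebesgue K * (ext_deriv p c \<bullet> \<mu> c - p c \<bullet> codiff (k + 1) \<mu> c)"
    if "p \<in> P1minus k" "\<mu> \<in> P1star (k + 1)" for p \<mu>
    by (rule B[OF P1minus_Q1minus[OF that(1)] L2_Q1minus[OF P1minus_Q1minus[OF that(1)] o] eq_on_refl that(2)])
  obtain p where p: "p \<in> P1minus k" "p c = q c" "\<And>x. ext_deriv p x = ext_deriv q c"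
    using P1minus_exists[OF Q1minus_Alt[OF q] Q1minus_Alt[OF ext_deriv_Q1minus[OF q]]] by blast
  let ?C = "\<lambda>p. p \<in> P1minus k \<and> (\<forall>\<mu>\<in>P1star (k + 1). ?B p \<mu> = ?B \<omega> \<mu>)"
  have "(THE p. ?C p) = p"
  proof (rule the_equality)
    show "?C p" using p(1) Bp[OF p(1)] B[OF q \<omega>] by (simp add: p(2,3))
    fix p' assume p': "?C p'"
    have eq: "ext_deriv p' c \<bullet> \<mu> c - p' c \<bullet> codiff (k + 1) \<mu> c = ext_deriv p c \<bullet> \<mu> c - p c \<bullet> codiff (k + 1) \<mu> c"
      if \<mu>: "\<mu> \<in> P1star (k + 1)" for \<mu>
    proof -
      have "?B p' \<mu> = ?B \<omega> \<mu>" using p' \<mu> by blast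
      moreover have "p' \<in> P1minus k" using p' by blast
      ultimately have "measure lebesgue K * (ext_deriv p' c \<bullet> \<mu> c - p' c \<bullet> codiff (k + 1) \<mu> c) =
          measure lebesgue K * (ext_deriv q c \<bullet> \<mu> c - q c \<bullet> codiff (k + 1) \<mu> c)"
        using Bp[OF _ \<mu>, of p'] B[OF q \<omega> \<mu>] by simp
      then show ?thesis using measure_box_centre_pos[OF K] by (simp add: p(2,3))
    qed
    have P': "p' \<in> P1minus k" using p' by blast
    show "p' = p"
    proof (rule P1minus_eqI[OF P' p(1)])
      \<comment> \<open>Constant dual forms have codifferential zero, so testing with one of them isolates the derivative.\<close>
      let ?w = "ext_deriv p' c - ext_deriv p c"
      have "?w \<in> Alt (k + 1)"
        by (intro Alt_closed Q1minus_Alt[OF ext_deriv_Q1minus[OF P1minus_Q1minus]] P' p(1))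
      then have "(\<lambda>x. ?w) \<in> P1star (k + 1)" by (rule P1star_const) (use k in simp)
      from eq[OF this] have "?w \<bullet> ?w = 0" by (simp add: codiff_const inner_diff_left)
      then show "ext_deriv p' c = ext_deriv p c" by simp
      \<comment> \<open>A dual form that vanishes at the centre and has constant codifferential isolates the value.\<close>
      let ?u = "p' c - p c"
      have "?u \<in> Alt k" by (intro Alt_closed Q1minus_Alt[OF P1minus_Q1minus] P' p(1))
      then obtain m where m: "m \<in> P1star (k + 1)" "\<And>x. codiff (k + 1) m x = ?u" "m c = 0"
        using k by (rule P1star_codiff_surj[where c = c]) blast
      have "?u \<bullet> ?u = 0" using eq[OF m(1)] unfolding m(2,3) by (simp add: inner_diff_left)
      then show "p' c = p c" by simp
    qed
  qed
  then have "local_interp k K \<omega> = p" using k by (simp add: local_interp_def)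
  then show "local_interp k K \<omega> \<in> P1minus k" "local_interp k K \<omega> c = q c"
    "ext_deriv (local_interp k K \<omega>) c = ext_deriv q c" using p by simp_all
qed

lemma local_interp_top:
  fixes q :: "'n::{finite,linorder} form"
  assumes K: "box_centre K c" and q: "q \<in> Q1minus CARD('n)"
    and \<omega>: "\<omega> \<in> L2 K CARD('n)" "eq_on K \<omega> q"
  shows "local_interp CARD('n) K \<omega> = (\<lambda>x. q c)"
proof -
  note o = box_centre_open[OF K] box_centre_bounded[OF K]
  have P0: "p \<in> Q1minus CARD('n) \<and> p \<in> Q1star CARD('n)" if "p \<in> P0 CARD('n)" for p :: "'n form"
    using that Q1minus_const P1star_Q1star[OF P1star_const] by (auto simp: P0_def)
  have B: "L2_inner K \<omega> p = measure lebesgue K * (q c \<bullet> p c)" if p: "p \<in> P0 CARD('n)" for p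
  proof -
    have "L2_inner K \<omega> p = L2_inner K q p"
      using P0[OF p] by (intro L2_inner_cong[OF \<omega>(2) eq_on_refl \<omega>(1) L2_Q1minus[OF q o]] L2_Q1minus o) auto
    then show ?thesis using L2_inner_Q1minus_Q1star[OF K q P0[OF p, THEN conjunct2]] by simp
  qed
  have C: "L2_inner K p p' = measure lebesgue K * (p c \<bullet> p' c)" if "p \<in> P0 CARD('n)" "p' \<in> P0 CARD('n)" for p p' :: "'n form"
    using L2_inner_Q1minus_Q1star[OF K] P0 that by blast
  have "(THE p. p \<in> P0 CARD('n) \<and> (\<forall>q\<in>P0 CARD('n). L2_inner K p q = L2_inner K \<omega> q)) = (\<lambda>x. q c)"
  proof (rule the_equality)
    have "(\<lambda>x. q c) \<in> P0 CARD('n)" using Q1minus_Alt[OF q] by (auto simp: P0_def)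
    then show "(\<lambda>x. q c) \<in> P0 CARD('n) \<and> (\<forall>p\<in>P0 CARD('n). L2_inner K (\<lambda>x. q c) p = L2_inner K \<omega> p)"
      using B C by simp
    fix p assume p: "p \<in> P0 CARD('n) \<and> (\<forall>q\<in>P0 CARD('n). L2_inner K p q = L2_inner K \<omega> q)"
    then obtain u where u: "p = (\<lambda>x. u)" "u \<in> Alt CARD('n)" by (auto simp: P0_def)
    have "u - q c \<in> Alt CARD('n)" using u(2) Q1minus_Alt[OF q] by (intro Alt_closed)
    then have w: "(\<lambda>x. u - q c) \<in> P0 CARD('n)" by (auto simp: P0_def)
    have "measure lebesgue K * (u \<bullet> (u - q c)) = measure lebesgue K * (q c \<bullet> (u - q c))"
      using p w B[OF w] C[of p, OF _ w] u(1) by auto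
    then have "(u - q c) \<bullet> (u - q c) = 0" using measure_box_centre_pos[OF K] by (simp add: inner_diff_left)
    then show "p = (\<lambda>x. q c)" by (simp add: u(1))
  qed
  then show ?thesis by (simp add: local_interp_def)
qed

text \<open>
  Since $d\circ d=0$ in the weak sense, $ddq$ vanishes almost everywhere on the cell; pairing it with the
  constant form $ddq(c)$ shows that it vanishes at the centre.
\<close>

lemma ext_deriv_ext_deriv_centre:
  fixes q :: "'n::{finite,linorder} form"
  assumes K: "box_centre K c" and q: "q \<in> Q1minus k"
  shows "ext_deriv (ext_deriv q) c = 0"
proof (cases "k + 2 \<le> CARD('n)")
  case False
  have "ext_deriv (ext_deriv q) c \<in> Alt (k + 1 + 1)" by (intro Q1minus_Alt ext_deriv_Q1minus q)
  then show ?thesis by (rule Alt_trivial) (use False in simp)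
next
  case True
  note o = box_centre_open[OF K] box_centre_bounded[OF K]
  note d = has_weak_d_smooth[OF o Q1minus_Ck[OF q] Q1minus_Alt[OF q]]
  note q1 = ext_deriv_Q1minus[OF q]
  note q2 = ext_deriv_Q1minus[OF q1]
  let ?w = "ext_deriv (ext_deriv q) c"
  have e: "eq_on K (ext_deriv (ext_deriv q)) (\<lambda>x. 0)"
    by (rule has_weak_d_unique[OF o has_weak_d_smooth[OF o Q1minus_Ck[OF q1] Q1minus_Alt[OF q1]] has_weak_d_has_weak_d[OF d] eq_on_refl])
  have w: "?w \<in> Alt (k + 1 + 1)" by (rule Q1minus_Alt[OF q2])
  have s: "(\<lambda>x. ?w) \<in> Q1star (k + 1 + 1)" by (rule P1star_Q1star[OF P1star_const[OF w]]) (use True in simp)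
  have "measure lebesgue K * (?w \<bullet> ?w) = L2_inner K (ext_deriv (ext_deriv q)) (\<lambda>x. ?w)"
    by (rule L2_inner_Q1minus_Q1star[OF K q2 s, symmetric])
  also have "\<dots> = L2_inner K (\<lambda>x. 0) (\<lambda>x. ?w)"
    using L2_Q1minus[OF Q1minus_const[OF w] o]
    by (rule L2_inner_cong[OF e eq_on_refl L2_Q1minus[OF q2 o] L2_zero, rotated]) (rule L2_Q1minus[OF Q1minus_const[OF w] o])
  also have "\<dots> = 0" by (rule L2_inner_zero)
  finally show ?thesis using measure_box_centre_pos[OF K] by simp
qed

section \<open>The dual complex\<close>

lemma has_weak_d_scaleR:
  assumes "has_weak_d \<Omega> k \<omega> \<eta>"
  shows "has_weak_d \<Omega> k (\<lambda>x. a *\<^sub>R \<omega> x) (\<lambda>x. a *\<^sub>R \<eta> x)"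
  using assms unfolding has_weak_d_def by (simp add: L2_scaleR L2_inner_scaleR_left)

text \<open>
  The weak form of $\delta\circ\delta=0$.
\<close>

lemma has_weak_codiff_has_weak_codiff:
  fixes \<mu> :: "'n::{finite,linorder} form"
  assumes d: "has_weak_codiff \<Omega> (k + 2) \<mu> \<nu>" and k: "k + 2 \<le> CARD('n)"
    and \<Omega>: "open \<Omega>" "bounded \<Omega>"
  shows "has_weak_codiff \<Omega> (k + 1) \<nu> (\<lambda>x. 0)"
proof -
  let ?t = "codiff_sign TYPE('n) (k + 2)"
  let ?j = "CARD('n) - (k + 2) + 1"
  let ?s = "(-1 :: real) ^ (?j * (CARD('n) - ?j))"
  have j: "CARD('n) - (k + 1) = ?j" using k by simp
  obtain \<eta> where \<eta>: "has_weak_d \<Omega> (CARD('n) - (k + 2)) (\<lambda>x. hodge (\<mu> x)) \<eta>"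
    "\<nu> = (\<lambda>x. ?t *\<^sub>R hodge (\<eta> x))" using d by (rule has_weak_codiffE)
  have \<nu>: "\<nu> \<in> L2 \<Omega> (k + 1)" using has_weak_codiff_L2(2)[OF d] by simp
  have e: "eq_on \<Omega> (\<lambda>x. (?t * ?s) *\<^sub>R \<eta> x) (\<lambda>x. hodge (\<nu> x))"
  proof (rule eq_onI[OF \<Omega>(1)])
    fix x assume "x \<in> \<Omega>"
    then have "\<eta> x \<in> Alt ?j" using L2_Alt[OF has_weak_d_L2(2)[OF \<eta>(1)]] by blast
    then show "(?t * ?s) *\<^sub>R \<eta> x = hodge (\<nu> x)"
      unfolding \<eta>(2) by (simp only: hodge_linear hodge_hodge scaleR_scaleR)
  qed
  have "(\<lambda>x. hodge (\<nu> x)) \<in> L2 \<Omega> ?j" using L2_hodge[OF \<nu>] unfolding j .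
  from has_weak_d_cong[OF \<Omega> has_weak_d_scaleR[OF has_weak_d_has_weak_d[OF \<eta>(1)]] e this]
  have "has_weak_d \<Omega> (CARD('n) - (k + 1)) (\<lambda>x. hodge (\<nu> x)) (\<lambda>x. 0)"
    unfolding j by simp
  from has_weak_codiffI[OF \<nu> _ _ this] show ?thesis using k by (simp add: hodge_linear)
qed

lemma has_weak_codiff_subset:
  assumes d: "has_weak_codiff \<Omega> k \<mu> \<nu>" and K: "K \<subseteq> \<Omega>" "open K" "open \<Omega>"
  shows "has_weak_codiff K k \<mu> \<nu>"
  using d has_weak_d_subset[OF _ K] L2_subset[OF _ K] unfolding has_weak_codiff_def by blast

lemma weak_codiff_L2: "\<mu> \<in> Hstar \<Omega> (k + 1) \<Longrightarrow> weak_codiff \<Omega> (k + 1) \<mu> \<in> L2 \<Omega> k"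
  using has_weak_codiff_L2(2)[OF Hstar_has_weak_codiff] by fastforce

lemma weak_codiff_H0star:
  fixes \<mu> :: "'n::{finite,linorder} form"
  assumes \<Omega>: "open \<Omega>" "bounded \<Omega>" and k: "k + 2 \<le> CARD('n)" and \<mu>: "\<mu> \<in> H0star \<Omega> (k + 2)"
  shows "weak_codiff \<Omega> (k + 2) \<mu> \<in> H0star \<Omega> (k + 1)"
proof -
  let ?\<nu> = "weak_codiff \<Omega> (k + 2) \<mu>"
  have "\<exists>\<psi>\<in>test_forms \<Omega> (k + 1). graph_norm \<Omega> (weak_codiff \<Omega> (k + 1)) (\<lambda>x. ?\<nu> x - \<psi> x) < e" if e: "0 < e" for e
  proof -
    obtain \<phi> where \<phi>: "\<phi> \<in> test_forms \<Omega> (k + 2)"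
      and hd: "has_weak_codiff \<Omega> (k + 2) (\<lambda>x. \<mu> x - \<phi> x) (\<lambda>x. ?\<nu> x - codiff (k + 2) \<phi> x)"
      and s: "L2_inner \<Omega> (\<lambda>x. ?\<nu> x - codiff (k + 2) \<phi> x) (\<lambda>x. ?\<nu> x - codiff (k + 2) \<phi> x) < e\<^sup>2"
      by (rule H0star_approx[OF \<Omega> \<mu> e _ k]) auto
    have "graph_norm \<Omega> (weak_codiff \<Omega> (k + 1)) (\<lambda>x. ?\<nu> x - codiff (k + 2) \<phi> x) < e"
      unfolding graph_norm_weak_codiff[OF \<Omega> has_weak_codiff_has_weak_codiff[OF hd k \<Omega>]] L2_inner_zero
      using s e by (simp add: real_less_lsqrt L2_inner_self_nonneg)
    moreover have "codiff (k + 2) \<phi> \<in> test_forms \<Omega> (k + 1)"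
      using codiff_test[of \<phi> \<Omega> "k + 1"] \<phi> by simp
    ultimately show ?thesis by blast
  qed
  moreover have "has_weak_codiff \<Omega> (k + 2) \<mu> ?\<nu>"
    using \<mu> by (intro Hstar_has_weak_codiff) (simp add: H0star_def)
  ultimately show ?thesis
    using Hstar_I[OF has_weak_codiff_has_weak_codiff[OF _ k \<Omega>]] by (simp add: H0star_def)
qed

section \<open>Cells of a mesh\<close>

lemma cell_box:
  assumes "cubical_mesh \<Omega> G" "K \<in> G"
  obtains a b where "K = box a b" "K \<noteq> {}"
proof -
  have "K \<noteq> {} \<and> (\<exists>a b. K = box a b)" using assms unfolding cubical_mesh_def by blast
  then show ?thesis using that by blast
qed

lemma cell_centre:
  assumes "cubical_mesh \<Omega> G" "K \<in> G"
  obtains c where "box_centre K c"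
proof -
  obtain a b where "K = box a b" "K \<noteq> {}" using assms by (rule cell_box)
  then have "box_centre K (\<chi> i. (a $ i + b $ i) / 2)" unfolding box_centre_def
    by (intro conjI exI[of _ a] exI[of _ b]) auto
  then show ?thesis by (rule that)
qed

lemma cell_subset: "cubical_mesh \<Omega> G \<Longrightarrow> K \<in> G \<Longrightarrow> K \<subseteq> \<Omega>"
  by (simp add: cubical_mesh_def)

lemma cell_open: "cubical_mesh \<Omega> G \<Longrightarrow> K \<in> G \<Longrightarrow> open K"
  by (erule (1) cell_centre) (rule box_centre_open)

lemma cell_bounded: "cubical_mesh \<Omega> G \<Longrightarrow> K \<in> G \<Longrightarrow> bounded K"
  by (erule (1) cell_centre) (rule box_centre_bounded)

lemma mesh_finite: "cubical_mesh \<Omega> G \<Longrightarrow> finite G"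
  by (simp add: cubical_mesh_def)

lemma cells_unique: "cubical_mesh \<Omega> G \<Longrightarrow> K \<in> G \<Longrightarrow> L \<in> G \<Longrightarrow> x \<in> K \<Longrightarrow> x \<in> L \<Longrightarrow> K = L"
  by (auto simp: cubical_mesh_def pairwise_def disjnt_def)

text \<open>
  Almost every point of the domain lies in an open cell: the closed cells cover it, and the boundary of a
  box is a null set.
\<close>

lemma AE_in_cells:
  fixes \<Omega> :: "'n::finite space set"
  assumes G: "cubical_mesh \<Omega> G"
  shows "AE x in lebesgue. x \<in> \<Omega> \<longrightarrow> x \<in> \<Union>G"
proof -
  have "negligible (closure K - K)" if K: "K \<in> G" for K
  proof -
    obtain a b where K': "K = box a b" "K \<noteq> {}" using G K by (rule cell_box)
    then have "closure K = cbox a b" by (simp add: closure_box)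
    then show ?thesis unfolding K'(1) by (simp add: negligible_frontier_interval)
  qed
  then have "negligible (\<Union>K\<in>G. closure K - K)"
    using mesh_finite[OF G] by (intro negligible_Union) auto
  then have N: "(\<Union>K\<in>G. closure K - K) \<in> null_sets lebesgue" by (simp add: negligible_iff_null_sets)
  have "x \<in> (\<Union>K\<in>G. closure K - K)" if "x \<in> \<Omega>" "x \<notin> \<Union>G" for x
  proof -
    have "x \<in> closure \<Omega>" using that(1) closure_subset by (rule subsetD[rotated])
    then have "x \<in> \<Union> (closure ` G)" using G by (simp add: cubical_mesh_def)
    then show ?thesis using that(2) by auto
  qed
  then show ?thesis by (intro AE_I'[OF N]) auto
qed

lemma eq_on_cells:
  assumes G: "cubical_mesh \<Omega> G" and \<Omega>: "open \<Omega>" and e: "\<And>K. K \<in> G \<Longrightarrow> eq_on K \<omega> \<eta>"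
  shows "eq_on \<Omega> \<omega> \<eta>"
proof -
  have "AE x in lebesgue. \<forall>K\<in>G. x \<in> K \<longrightarrow> \<omega> x = \<eta> x"
    using e cell_open[OF G] by (intro AE_finite_allI mesh_finite[OF G]) (simp flip: eq_on_iff)
  then show ?thesis unfolding eq_on_iff[OF \<Omega>]
    by (rule AE_mp) (rule AE_mp[OF AE_in_cells[OF G]], rule AE_I2, auto)
qed

lemma L2_inner_cells:
  assumes G: "cubical_mesh \<Omega> G" and \<Omega>: "open \<Omega>" and L: "\<omega> \<in> L2 \<Omega> j" "\<mu> \<in> L2 \<Omega> k"
  shows "L2_inner \<Omega> \<omega> \<mu> = (\<Sum>K\<in>G. L2_inner K \<omega> \<mu>)"
proof -
  let ?f = "\<lambda>x. \<omega> x \<bullet> \<mu> x"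
  have i: "integrable lebesgue (\<lambda>x. indicat_real \<Omega> x *\<^sub>R ?f x)"
    using L2_inner_integrable[OF L] \<Omega> by (subst (asm) integrable_restrict_space) auto
  have iK: "integrable lebesgue (\<lambda>x. indicat_real K x *\<^sub>R ?f x)" if K: "K \<in> G" for K
    using integrable_lebesgue_on_subset[OF L2_inner_integrable[OF L] cell_subset[OF G K] cell_open[OF G K] \<Omega>]
      cell_open[OF G K] by (subst (asm) integrable_restrict_space) auto
  have pt: "indicat_real \<Omega> x *\<^sub>R ?f x = (\<Sum>K\<in>G. indicat_real K x *\<^sub>R ?f x)" if x: "x \<in> \<Omega> \<longrightarrow> x \<in> \<Union>G" for x
  proof (cases "x \<in> \<Omega>")
    case True
    then obtain K where K: "K \<in> G" "x \<in> K" using x by blast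
    have "(\<Sum>L\<in>G. indicat_real L x *\<^sub>R ?f x) = (\<Sum>L\<in>G. if L = K then ?f x else 0)"
      using K cells_unique[OF G] by (intro sum.cong) (auto simp: indicator_def)
    then show ?thesis using True K mesh_finite[OF G] by simp
  next
    case False
    then have "x \<notin> K" if "K \<in> G" for K using cell_subset[OF G that] by blast
    then show ?thesis using False by simp
  qed
  have "L2_inner \<Omega> \<omega> \<mu> = (LINT x|lebesgue. indicat_real \<Omega> x *\<^sub>R ?f x)"
    unfolding L2_inner_def using \<Omega> by (subst integral_restrict_space) auto
  also have "\<dots> = (LINT x|lebesgue. (\<Sum>K\<in>G. indicat_real K x *\<^sub>R ?f x))"
  proof (rule integral_cong_AE)
    show "AE x in lebesgue. indicat_real \<Omega> x *\<^sub>R ?f x = (\<Sum>K\<in>G. indicat_real K x *\<^sub>R ?f x)"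
      using AE_in_cells[OF G] by (rule AE_mp) (rule AE_I2, use pt in blast)
  qed (use i iK in \<open>auto intro!: borel_measurable_sum\<close>)
  also have "\<dots> = (\<Sum>K\<in>G. (LINT x|lebesgue. indicat_real K x *\<^sub>R ?f x))"
    by (rule Bochner_Integration.integral_sum) (rule iK)
  also have "\<dots> = (\<Sum>K\<in>G. L2_inner K \<omega> \<mu>)"
    unfolding L2_inner_def using cell_open[OF G] by (intro sum.cong refl) (subst integral_restrict_space, auto)
  finally show ?thesis .
qed

lemma cellwise_on_cell:
  assumes G: "cubical_mesh \<Omega> G" and K: "K \<in> G" "x \<in> K"
  shows "cellwise G F \<omega> x = F K \<omega> x"
proof -
  have "cellwise G F \<omega> x = (\<Sum>L\<in>G. if L = K then F K \<omega> x else 0)"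
    unfolding cellwise_def using K cells_unique[OF G] by (intro sum.cong) (auto simp: indicator_def)
  then show ?thesis using K mesh_finite[OF G] by simp
qed

lemma eq_on_cellwise:
  assumes "cubical_mesh \<Omega> G" "K \<in> G"
  shows "eq_on K (cellwise G F \<omega>) (F K \<omega>)"
  by (rule eq_onI[OF cell_open[OF assms]]) (rule cellwise_on_cell[OF assms])

lemma L2_extend_by_zero:
  assumes "\<omega> \<in> L2 K k" "open K" "K \<subseteq> \<Omega>" "open \<Omega>"
  shows "(\<lambda>x. indicat_real K x *\<^sub>R \<omega> x) \<in> L2 \<Omega> k"
proof -
  have "(\<lambda>x. indicat_real K x *\<^sub>R \<omega> x) \<in> borel_measurable lebesgue"
    using L2_measurable[OF assms(1)] assms(2) by (subst (asm) borel_measurable_restrict_space_iff) auto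
  then have m: "(\<lambda>x. indicat_real K x *\<^sub>R \<omega> x) \<in> borel_measurable (lebesgue_on \<Omega>)"
    by (rule measurable_restrict_space1)
  have "integrable lebesgue (\<lambda>x. indicat_real K x *\<^sub>R (norm (\<omega> x))\<^sup>2)"
    using assms(1,2) unfolding L2_def by (subst (asm) integrable_restrict_space) auto
  then have "integrable lebesgue (\<lambda>x. indicat_real \<Omega> x *\<^sub>R (norm (indicat_real K x *\<^sub>R \<omega> x))\<^sup>2)"
    by (rule Bochner_Integration.integrable_cong[THEN iffD1, rotated -1])
      (use assms(3) in \<open>auto simp: indicator_def\<close>)
  then have "integrable (lebesgue_on \<Omega>) (\<lambda>x. (norm (indicat_real K x *\<^sub>R \<omega> x))\<^sup>2)"
    using assms(4) by (subst integrable_restrict_space) auto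
  moreover have "indicat_real K x *\<^sub>R \<omega> x \<in> Alt k" for x
    using L2_Alt[OF assms(1), of x] by (cases "x \<in> K") (auto intro: Alt_closed)
  ultimately show ?thesis using m unfolding L2_def by blast
qed

lemma cellwise_L2:
  assumes G: "cubical_mesh \<Omega> G" and \<Omega>: "open \<Omega>" and L: "\<And>K. K \<in> G \<Longrightarrow> F K \<omega> \<in> L2 K k"
  shows "cellwise G F \<omega> \<in> L2 \<Omega> k"
proof -
  have "(\<lambda>x. \<Sum>K\<in>G'. indicat_real K x *\<^sub>R F K \<omega> x) \<in> L2 \<Omega> k" if "G' \<subseteq> G" for G'
    using finite_subset[OF that mesh_finite[OF G]] that
  proof (induction G' rule: finite_induct)
    case (insert K G')
    then have K: "K \<in> G" and IH: "(\<lambda>x. \<Sum>K\<in>G'. indicat_real K x *\<^sub>R F K \<omega> x) \<in> L2 \<Omega> k" by auto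
    from L2_add[OF L2_extend_by_zero[OF L[OF K] cell_open[OF G K] cell_subset[OF G K] \<Omega>] IH]
    show ?case unfolding sum.insert[OF insert(1,2)] .
  qed (simp add: L2_zero)
  then show ?thesis unfolding cellwise_def[abs_def] by blast
qed

section \<open>Conforming complexes\<close>

lemma top_degree_eq_0:
  fixes \<eta> :: "'n::{finite,linorder} form"
  assumes "\<eta> \<in> L2 \<Omega> (CARD('n) + 1)" "open \<Omega>"
  shows "eq_on \<Omega> \<eta> (\<lambda>x. 0)"
  by (rule eq_onI[OF assms(2)]) (rule Alt_trivial[OF L2_Alt[OF assms(1)]], simp_all)

lemma weak_d_cell:
  fixes \<Omega> :: "'n::{finite,linorder} space set"
  assumes G: "cubical_mesh \<Omega> G" and \<Omega>: "open \<Omega>" and K: "K \<in> G" and \<omega>: "\<omega> \<in> H \<Omega> k"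
  shows "eq_on K (weak_d \<Omega> k \<omega>) (weak_d K k \<omega>)"
  by (rule eq_on_sym[OF weak_d_eq_on[OF cell_open[OF G K] cell_bounded[OF G K]
    has_weak_d_subset[OF H_has_weak_d[OF \<omega>] cell_subset[OF G K] cell_open[OF G K] \<Omega>]]])

lemma weak_d_restr_in:
  fixes \<Omega> :: "'n::{finite,linorder} space set"
  assumes G: "cubical_mesh \<Omega> G" and \<Omega>: "open \<Omega>" and K: "K \<in> G" and \<omega>: "\<omega> \<in> H \<Omega> k"
    and q: "q \<in> Q1minus k" "eq_on K \<omega> q"
  shows "eq_on K (weak_d \<Omega> k \<omega>) (ext_deriv q)"
proof -
  note o = cell_open[OF G K] cell_bounded[OF G K]
  have "eq_on K (weak_d K k \<omega>) (ext_deriv q)"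
    by (rule weak_d_eq_on[OF o weak_d_Q1minus[OF o q(1) L2_subset[OF H_L2[OF \<omega>] cell_subset[OF G K] o(1) \<Omega>] q(2)]])
  then show ?thesis by (rule eq_on_trans[OF weak_d_cell[OF G \<Omega> K \<omega>]])
qed

lemma weak_codiff_restr_in:
  fixes \<Omega> :: "'n::{finite,linorder} space set"
  assumes G: "cubical_mesh \<Omega> G" and \<Omega>: "open \<Omega>" and K: "K \<in> G" and k: "k < CARD('n)"
    and \<mu>: "\<mu> \<in> Hstar \<Omega> (k + 1)" and m: "m \<in> Q1star (k + 1)" "eq_on K \<mu> m"
  shows "eq_on K (weak_codiff \<Omega> (k + 1) \<mu>) (codiff (k + 1) m)"
proof -
  note o = cell_open[OF G K] cell_bounded[OF G K]
  show ?thesis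
    by (rule has_weak_codiff_unique[OF o has_weak_codiff_subset[OF Hstar_has_weak_codiff[OF \<mu>] cell_subset[OF G K] o(1) \<Omega>]
      has_weak_codiff_Q1star[OF o m(1) k] m(2)])
qed

lemma weak_d_VQ:
  assumes G: "cubical_mesh \<Omega> G" and \<Omega>: "open \<Omega>" and \<omega>: "\<omega> \<in> VQ \<Omega> G k"
  shows "weak_d \<Omega> k \<omega> \<in> VQ \<Omega> G (k + 1)"
proof -
  have H: "\<omega> \<in> H \<Omega> k" using \<omega> by (simp add: VQ_def)
  have "restr_in K (weak_d \<Omega> k \<omega>) (Q1minus (k + 1))" if K: "K \<in> G" for K
  proof -
    obtain q where q: "q \<in> Q1minus k" "eq_on K \<omega> q" using \<omega> K by (auto simp: VQ_def restr_in_def)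
    then show ?thesis unfolding restr_in_def
      using ext_deriv_Q1minus[OF q(1)] weak_d_restr_in[OF G \<Omega> K H q] by blast
  qed
  then show ?thesis using weak_d_H[OF H] by (simp add: VQ_def)
qed

lemma VQ0_VQ: "VQ0 \<Omega> G k \<subseteq> VQ \<Omega> G k"
  by (auto simp: VQ0_def VQ_def H0_def)

lemma weak_d_VQ0:
  assumes G: "cubical_mesh \<Omega> G" and \<Omega>: "open \<Omega>" "bounded \<Omega>" and \<omega>: "\<omega> \<in> VQ0 \<Omega> G k"
  shows "weak_d \<Omega> k \<omega> \<in> VQ0 \<Omega> G (k + 1)"
  using weak_d_VQ[OF G \<Omega>(1)] VQ0_VQ[of \<Omega> G k] weak_d_H0[OF \<Omega>] \<omega> by (auto simp: VQ0_def VQ_def)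

lemma VQ0star_VQstar: "VQ0star \<Omega> G k \<subseteq> VQstar \<Omega> G k"
  by (auto simp: VQ0star_def VQstar_def H0star_def)

lemma weak_codiff_VQstar:
  fixes \<Omega> :: "'n::{finite,linorder} space set"
  assumes G: "cubical_mesh \<Omega> G" and \<Omega>: "open \<Omega>" "bounded \<Omega>" and k: "k + 2 \<le> CARD('n)"
    and \<mu>: "\<mu> \<in> VQstar \<Omega> G (k + 2)"
  shows "weak_codiff \<Omega> (k + 2) \<mu> \<in> VQstar \<Omega> G (k + 1)"
proof -
  have H: "\<mu> \<in> Hstar \<Omega> (k + 2)" using \<mu> by (simp add: VQstar_def)
  have "restr_in K (weak_codiff \<Omega> (k + 2) \<mu>) (Q1star (k + 1))" if K: "K \<in> G" for K
  proof -
    obtain m where m: "m \<in> Q1star (k + 1 + 1)" "eq_on K \<mu> m" using \<mu> K by (auto simp: VQstar_def restr_in_def)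
    have "codiff (k + 1 + 1) m \<in> Q1star (k + 1)" using k by (intro codiff_Q1star m) simp
    moreover have "eq_on K (weak_codiff \<Omega> (k + 1 + 1) \<mu>) (codiff (k + 1 + 1) m)"
      using H k by (intro weak_codiff_restr_in[OF G \<Omega>(1) K _ _ m]) simp_all
    ultimately show ?thesis unfolding restr_in_def by auto
  qed
  then show ?thesis
    using Hstar_I[OF has_weak_codiff_has_weak_codiff[OF Hstar_has_weak_codiff[OF H] k \<Omega>]] by (simp add: VQstar_def)
qed

lemma weak_codiff_VQ0star:
  fixes \<Omega> :: "'n::{finite,linorder} space set"
  assumes G: "cubical_mesh \<Omega> G" and \<Omega>: "open \<Omega>" "bounded \<Omega>" and k: "k + 2 \<le> CARD('n)"
    and \<mu>: "\<mu> \<in> VQ0star \<Omega> G (k + 2)"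
  shows "weak_codiff \<Omega> (k + 2) \<mu> \<in> VQ0star \<Omega> G (k + 1)"
  using weak_codiff_VQstar[OF G \<Omega> k, of \<mu>] VQ0star_VQstar[of \<Omega> G "k + 2"] weak_codiff_H0star[OF \<Omega> k, of \<mu>] \<mu>
  by (auto simp: VQ0star_def VQstar_def)

lemma is_complex_weak_d:
  fixes \<Omega> :: "'n::{finite,linorder} space set"
  assumes \<Omega>: "open \<Omega>" "bounded \<Omega>" and H: "\<And>k. V k \<subseteq> H \<Omega> k"
    and d: "\<And>k \<omega>. \<omega> \<in> V k \<Longrightarrow> weak_d \<Omega> k \<omega> \<in> V (k + 1)"
  shows "is_complex \<Omega> V (weak_d \<Omega>)"
proof -
  have "eq_on \<Omega> (weak_d \<Omega> CARD('n) \<omega>) (\<lambda>x. 0)" if "\<omega> \<in> V CARD('n)" for \<omega>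
    using H that by (intro top_degree_eq_0 weak_d_L2 \<Omega>) blast
  moreover have "eq_on \<Omega> (weak_d \<Omega> (k + 1) (weak_d \<Omega> k \<omega>)) (\<lambda>x. 0)" if "\<omega> \<in> V k" for k \<omega>
    using H that by (intro weak_d_weak_d \<Omega>) blast
  ultimately show ?thesis unfolding is_complex_def using d by auto
qed

lemma const_form_Alt: "c *\<^sub>R dx {} \<in> Alt 0"
  by (auto simp: Alt_def dx_nth)

lemma const_form_has_weak_d:
  assumes \<Omega>: "open \<Omega>" "bounded \<Omega>"
  shows "has_weak_d \<Omega> 0 (const_form c) (\<lambda>x. 0)"
  using has_weak_d_smooth[OF \<Omega>, of "const_form c" 0] Ck_const[of 1] const_form_Alt
  unfolding const_form_def ext_deriv_const by blast

lemma const_form_VQ: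
  assumes \<Omega>: "open \<Omega>" "bounded \<Omega>"
  shows "const_form c \<in> VQ \<Omega> G 0"
  using H_I[OF const_form_has_weak_d[OF \<Omega>]] Q1minus_const[OF const_form_Alt] eq_on_refl
  unfolding VQ_def restr_in_def const_form_def by blast

section \<open>Nonconforming complexes and interpolation\<close>

lemma P1minus_h_weak_d:
  fixes \<Omega> :: "'n::{finite,linorder} space set"
  assumes G: "cubical_mesh \<Omega> G" and \<Omega>: "open \<Omega>" and K: "K \<in> G" and \<omega>: "\<omega> \<in> P1minus_h \<Omega> G k"
  obtains w where "w \<in> Alt (k + 1)" "has_weak_d K k \<omega> (\<lambda>x. w)"
proof -
  note o = cell_open[OF G K] cell_bounded[OF G K]
  obtain p where p: "p \<in> P1minus k" "eq_on K \<omega> p" using \<omega> K by (auto simp: P1minus_h_def restr_in_def)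
  have L: "\<omega> \<in> L2 K k" using \<omega> by (intro L2_subset[OF _ cell_subset[OF G K] o(1) \<Omega>]) (simp add: P1minus_h_def)
  note q = P1minus_Q1minus[OF p(1)]
  fix c :: "'n space"
  have "has_weak_d K k \<omega> (\<lambda>x. ext_deriv p c)"
    using weak_d_Q1minus[OF o q L p(2)] P1minus_ext_deriv_const[OF p(1), of c] by simp
  moreover have "ext_deriv p c \<in> Alt (k + 1)" by (rule Q1minus_Alt[OF ext_deriv_Q1minus[OF q]])
  ultimately show ?thesis using that by blast
qed

lemma d_h_cell:
  fixes \<Omega> :: "'n::{finite,linorder} space set"
  assumes G: "cubical_mesh \<Omega> G" and K: "K \<in> G" and d: "has_weak_d K k \<omega> \<eta>"
  shows "eq_on K (d_h G k \<omega>) \<eta>"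
proof -
  have "eq_on K (d_h G k \<omega>) (weak_d K k \<omega>)" unfolding d_h_def by (rule eq_on_cellwise[OF G K])
  also have "eq_on K (weak_d K k \<omega>) \<eta>"
    by (rule weak_d_eq_on[OF cell_open[OF G K] cell_bounded[OF G K] d])
  finally show ?thesis .
qed

lemma d_h_P1minus_h:
  fixes \<Omega> :: "'n::{finite,linorder} space set"
  assumes G: "cubical_mesh \<Omega> G" and \<Omega>: "open \<Omega>" and \<omega>: "\<omega> \<in> P1minus_h \<Omega> G k"
  shows "d_h G k \<omega> \<in> P1minus_h \<Omega> G (k + 1)"
proof -
  have "d_h G k \<omega> \<in> L2 \<Omega> (k + 1)" unfolding d_h_def
  proof (rule cellwise_L2[OF G \<Omega>])
    fix K assume "K \<in> G"
    then obtain w where "has_weak_d K k \<omega> (\<lambda>x. w)" by (rule P1minus_h_weak_d[OF G \<Omega> _ \<omega>])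
    then show "weak_d K k \<omega> \<in> L2 K (k + 1)" by (rule weak_d_L2[OF H_I])
  qed
  moreover have "restr_in K (d_h G k \<omega>) (P1minus (k + 1))" if K: "K \<in> G" for K
  proof -
    obtain w where w: "w \<in> Alt (k + 1)" "has_weak_d K k \<omega> (\<lambda>x. w)" using K by (rule P1minus_h_weak_d[OF G \<Omega> _ \<omega>])
    show ?thesis unfolding restr_in_def using d_h_cell[OF G K w(2)] P0_P1minus[OF w(1)] by blast
  qed
  ultimately show ?thesis by (simp add: P1minus_h_def)
qed

lemma d_h_has_weak_d:
  fixes \<Omega> :: "'n::{finite,linorder} space set"
  assumes G: "cubical_mesh \<Omega> G" and \<Omega>: "open \<Omega>" and \<omega>: "\<omega> \<in> P1minus_h \<Omega> G k" and K: "K \<in> G"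
  shows "has_weak_d K (k + 1) (d_h G k \<omega>) (\<lambda>x. 0)"
proof -
  note o = cell_open[OF G K] cell_bounded[OF G K]
  obtain w where w: "has_weak_d K k \<omega> (\<lambda>x. w)" using K by (rule P1minus_h_weak_d[OF G \<Omega> _ \<omega>])
  have "d_h G k \<omega> \<in> L2 K (k + 1)"
    using d_h_P1minus_h[OF G \<Omega> \<omega>] by (intro L2_subset[OF _ cell_subset[OF G K] o(1) \<Omega>]) (simp add: P1minus_h_def)
  then show ?thesis
    by (rule has_weak_d_cong[OF o has_weak_d_has_weak_d[OF w] eq_on_sym[OF d_h_cell[OF G K w]]])
qed

text \<open>
  The forms in \<open>V (k + 1)\<close> are those tested against in the definition of \<open>W_of \<Omega> G V k\<close>. Beyond being
  piecewise polynomial, these spaces only have to be mapped to each other by the codifferential.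
\<close>

lemma is_complex_d_h:
  fixes \<Omega> :: "'n::{finite,linorder} space set"
  assumes G: "cubical_mesh \<Omega> G" and \<Omega>: "open \<Omega>" "bounded \<Omega>"
    and V: "\<And>k. V k \<subseteq> VQstar \<Omega> G k"
    and \<delta>: "\<And>k \<mu>. k + 2 \<le> CARD('n) \<Longrightarrow> \<mu> \<in> V (k + 2) \<Longrightarrow> weak_codiff \<Omega> (k + 2) \<mu> \<in> V (k + 1)"
  shows "is_complex \<Omega> (W_of \<Omega> G V) (d_h G)"
proof -
  have dd: "eq_on \<Omega> (d_h G (k + 1) (d_h G k \<omega>)) (\<lambda>x. 0)" if "\<omega> \<in> W_of \<Omega> G V k" for k \<omega>
    using that by (intro eq_on_cells[OF G \<Omega>(1)] d_h_cell[OF G _ d_h_has_weak_d[OF G \<Omega>(1)]]) (auto simp: W_of_def)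
  have top: "eq_on \<Omega> (d_h G CARD('n) \<omega>) (\<lambda>x. 0)" if "\<omega> \<in> W_of \<Omega> G V CARD('n)" for \<omega>
  proof (rule top_degree_eq_0[OF _ \<Omega>(1)])
    have "\<omega> \<in> P1minus_h \<Omega> G CARD('n)" using that by (simp add: W_of_def)
    from d_h_P1minus_h[OF G \<Omega>(1) this] show "d_h G CARD('n) \<omega> \<in> L2 \<Omega> (CARD('n) + 1)"
      by (simp add: P1minus_h_def)
  qed
  have maps: "d_h G k \<omega> \<in> W_of \<Omega> G V (k + 1)" if k: "k < CARD('n)" and \<omega>: "\<omega> \<in> W_of \<Omega> G V k" for k \<omega>
  proof -
    have P: "\<omega> \<in> P1minus_h \<Omega> G k" using \<omega> by (simp add: W_of_def)
    have "(\<Sum>K\<in>G. L2_inner K (weak_d K (k + 1) (d_h G k \<omega>)) \<mu> - L2_inner K (d_h G k \<omega>) (weak_codiff \<Omega> (k + 2) \<mu>)) = 0"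
      if k2: "k + 1 < CARD('n)" and \<mu>: "\<mu> \<in> V (k + 2)" for \<mu>
    proof -
      let ?\<nu> = "weak_codiff \<Omega> (k + 2) \<mu>"
      have k2': "k + 2 \<le> CARD('n)" using k2 by simp
      have \<nu>: "?\<nu> \<in> V (k + 1)" by (rule \<delta>[OF k2' \<mu>])
      have H\<mu>: "\<mu> \<in> Hstar \<Omega> (k + 2)" using V \<mu> by (auto simp: VQstar_def)
      note hd2 = has_weak_codiff_has_weak_codiff[OF Hstar_has_weak_codiff[OF H\<mu>] k2' \<Omega>]
      have cell: "L2_inner K (weak_d K (k + 1) (d_h G k \<omega>)) \<mu> - L2_inner K (d_h G k \<omega>) ?\<nu> =
          - (L2_inner K (weak_d K k \<omega>) ?\<nu> - L2_inner K \<omega> (weak_codiff \<Omega> (k + 1) ?\<nu>))" if K: "K \<in> G" for K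
      proof -
        note o = cell_open[OF G K] cell_bounded[OF G K]
        note sub = L2_subset[OF _ cell_subset[OF G K] o(1) \<Omega>(1)]
        have L: "\<mu> \<in> L2 K (k + 2)" "?\<nu> \<in> L2 K (k + 1)" "weak_codiff \<Omega> (k + 1) ?\<nu> \<in> L2 K k" "\<omega> \<in> L2 K k" "d_h G k \<omega> \<in> L2 K (k + 1)"
          using sub[OF has_weak_codiff_L2(1)[OF Hstar_has_weak_codiff[OF H\<mu>]]] sub[OF has_weak_codiff_L2(1)[OF hd2]]
            sub[OF weak_codiff_L2[OF Hstar_I[OF hd2]]] sub[of \<omega> k] P d_h_P1minus_h[OF G \<Omega>(1) P] sub[of "d_h G k \<omega>" "k + 1"]
          by (simp_all add: P1minus_h_def)
        note hd = d_h_has_weak_d[OF G \<Omega>(1) P K]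
        have 1: "L2_inner K (weak_d K (k + 1) (d_h G k \<omega>)) \<mu> = L2_inner K (\<lambda>x. 0) \<mu>"
          by (rule L2_inner_cong[OF weak_d_eq_on[OF o hd] eq_on_refl weak_d_L2[OF H_I[OF hd]] L2_zero L(1) L(1)])
        have 2: "L2_inner K \<omega> (weak_codiff \<Omega> (k + 1) ?\<nu>) = L2_inner K \<omega> (\<lambda>x. 0)"
          by (rule L2_inner_cong[OF eq_on_refl eq_on_subset[OF weak_codiff_eq_on[OF \<Omega> hd2] cell_subset[OF G K] o(1) \<Omega>(1)] L(4) L(4) L(3) L2_zero])
        obtain w where w: "has_weak_d K k \<omega> (\<lambda>x. w)" using K by (rule P1minus_h_weak_d[OF G \<Omega>(1) _ P])
        have 3: "L2_inner K (d_h G k \<omega>) ?\<nu> = L2_inner K (weak_d K k \<omega>) ?\<nu>"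
          by (rule L2_inner_cong[OF _ eq_on_refl L(5) weak_d_L2[OF H_I[OF w]] L(2) L(2)]) (unfold d_h_def, rule eq_on_cellwise[OF G K])
        show ?thesis unfolding 1 2 3 L2_inner_zero by simp
      qed
      have 0: "(\<Sum>K\<in>G. L2_inner K (weak_d K k \<omega>) ?\<nu> - L2_inner K \<omega> (weak_codiff \<Omega> (k + 1) ?\<nu>)) = 0"
        using \<omega> k \<nu> unfolding W_of_def by blast
      have "(\<Sum>K\<in>G. L2_inner K (weak_d K (k + 1) (d_h G k \<omega>)) \<mu> - L2_inner K (d_h G k \<omega>) ?\<nu>) =
          (\<Sum>K\<in>G. - (L2_inner K (weak_d K k \<omega>) ?\<nu> - L2_inner K \<omega> (weak_codiff \<Omega> (k + 1) ?\<nu>)))"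
        by (rule sum.cong[OF refl cell])
      then show ?thesis unfolding sum_negf 0 by (simp only: minus_zero)
    qed
    then show ?thesis using d_h_P1minus_h[OF G \<Omega>(1) P] by (simp add: W_of_def)
  qed
  show ?thesis unfolding is_complex_def using dd top maps by auto
qed

text \<open>
  Green's formula on the whole domain, written as a sum over the cells.
\<close>

lemma sum_pairing_eq_0:
  fixes \<Omega> :: "'n::{finite,linorder} space set"
  assumes G: "cubical_mesh \<Omega> G" and \<Omega>: "open \<Omega>" and \<omega>: "\<omega> \<in> H \<Omega> k" and \<mu>: "\<mu> \<in> Hstar \<Omega> (k + 1)"
    and Green: "L2_inner \<Omega> (weak_d \<Omega> k \<omega>) \<mu> = L2_inner \<Omega> \<omega> (weak_codiff \<Omega> (k + 1) \<mu>)"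
  shows "(\<Sum>K\<in>G. L2_inner K (weak_d K k \<omega>) \<mu> - L2_inner K \<omega> (weak_codiff \<Omega> (k + 1) \<mu>)) = 0"
proof -
  have L: "\<mu> \<in> L2 \<Omega> (k + 1)" using \<mu> by (simp add: Hstar_def)
  have "L2_inner K (weak_d K k \<omega>) \<mu> = L2_inner K (weak_d \<Omega> k \<omega>) \<mu>" if K: "K \<in> G" for K
  proof -
    note sub = cell_subset[OF G K] cell_open[OF G K] \<Omega>
    note d = has_weak_d_subset[OF H_has_weak_d[OF \<omega>] sub]
    show ?thesis
      by (rule L2_inner_cong[OF eq_on_sym[OF weak_d_cell[OF G \<Omega> K \<omega>]] eq_on_refl weak_d_L2[OF H_I[OF d]]
        has_weak_d_L2(2)[OF d] L2_subset[OF L sub] L2_subset[OF L sub]])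
  qed
  then have "(\<Sum>K\<in>G. L2_inner K (weak_d K k \<omega>) \<mu> - L2_inner K \<omega> (weak_codiff \<Omega> (k + 1) \<mu>)) =
      (\<Sum>K\<in>G. L2_inner K (weak_d \<Omega> k \<omega>) \<mu>) - (\<Sum>K\<in>G. L2_inner K \<omega> (weak_codiff \<Omega> (k + 1) \<mu>))"
    by (simp add: sum_subtractf)
  also have "\<dots> = 0"
    using L2_inner_cells[OF G \<Omega> weak_d_L2[OF \<omega>] L] L2_inner_cells[OF G \<Omega> H_L2[OF \<omega>] weak_codiff_L2[OF \<mu>]] Green by simp
  finally show ?thesis .
qed

text \<open>
  The only relation needed between the conforming spaces \<open>U\<close> and the dual test spaces \<open>V\<close> is Green's
  formula without boundary term.
\<close>

lemma is_cochain_map_interp: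
  fixes \<Omega> :: "'n::{finite,linorder} space set"
  assumes G: "cubical_mesh \<Omega> G" and \<Omega>: "open \<Omega>" "bounded \<Omega>"
    and U: "\<And>k. U k \<subseteq> VQ \<Omega> G k" and V: "\<And>k. V k \<subseteq> VQstar \<Omega> G k"
    and Green: "\<And>k \<omega> \<mu>. k < CARD('n) \<Longrightarrow> \<omega> \<in> U k \<Longrightarrow> \<mu> \<in> V (k + 1) \<Longrightarrow>
      L2_inner \<Omega> (weak_d \<Omega> k \<omega>) \<mu> = L2_inner \<Omega> \<omega> (weak_codiff \<Omega> (k + 1) \<mu>)"
  shows "is_cochain_map \<Omega> U (weak_d \<Omega>) (W_of \<Omega> G V) (d_h G) (interp G)"
proof -
  have UH: "\<omega> \<in> H \<Omega> k" if "\<omega> \<in> U k" for \<omega> k using U that by (auto simp: VQ_def)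
  have UL: "\<omega> \<in> L2 K k" if "\<omega> \<in> U k" "K \<in> G" for \<omega> k K
    using L2_subset[OF H_L2[OF UH[OF that(1)]] cell_subset[OF G that(2)] cell_open[OF G that(2)] \<Omega>(1)] .
  have Uq: "\<exists>q\<in>Q1minus k. eq_on K \<omega> q" if "\<omega> \<in> U k" "K \<in> G" for \<omega> k K
    using U that by (auto simp: VQ_def restr_in_def)
  have iP: "local_interp k K \<omega> \<in> P1minus k" if k: "k \<le> CARD('n)" and \<omega>: "\<omega> \<in> U k" and K: "K \<in> G" for k K \<omega>
  proof -
    obtain c where c: "box_centre K c" using G K by (rule cell_centre)
    obtain q where q: "q \<in> Q1minus k" "eq_on K \<omega> q" using Uq[OF \<omega> K] by blast
    show ?thesis
    proof (cases "k < CARD('n)")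
      case True
      then show ?thesis by (rule local_interp_characterisation(1)[OF c _ q(1) UL[OF \<omega> K] q(2)])
    next
      case False
      then have k': "k = CARD('n)" using k by simp
      show ?thesis using local_interp_top[OF c q(1)[unfolded k'] UL[OF \<omega> K, unfolded k'] q(2)]
          P0_P1minus[OF Q1minus_Alt[OF q(1)], of c] by (simp add: k')
    qed
  qed
  have iL: "local_interp k K \<omega> \<in> L2 K k" if "k \<le> CARD('n)" "\<omega> \<in> U k" "K \<in> G" for k K \<omega>
    by (rule L2_Q1minus[OF P1minus_Q1minus[OF iP[OF that]] cell_open[OF G that(3)] cell_bounded[OF G that(3)]])
  have iPh: "interp G k \<omega> \<in> P1minus_h \<Omega> G k" if "k \<le> CARD('n)" "\<omega> \<in> U k" for k \<omega>
    unfolding P1minus_h_def interp_def restr_in_def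
    using cellwise_L2[OF G \<Omega>(1), of "local_interp k" \<omega> k] iL[OF that] iP[OF that] eq_on_cellwise[OF G, of _ "local_interp k" \<omega>] by blast
  have maps: "interp G k \<omega> \<in> W_of \<Omega> G V k" if k: "k \<le> CARD('n)" and \<omega>: "\<omega> \<in> U k" for k \<omega>
  proof -
    have "(\<Sum>K\<in>G. L2_inner K (weak_d K k (interp G k \<omega>)) \<mu> - L2_inner K (interp G k \<omega>) (weak_codiff \<Omega> (k + 1) \<mu>)) = 0"
      if k': "k < CARD('n)" and \<mu>: "\<mu> \<in> V (k + 1)" for \<mu>
    proof -
      have H\<mu>: "\<mu> \<in> Hstar \<Omega> (k + 1)" using V \<mu> by (auto simp: VQstar_def)
      have "L2_inner K (weak_d K k (interp G k \<omega>)) \<mu> - L2_inner K (interp G k \<omega>) (weak_codiff \<Omega> (k + 1) \<mu>) =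
          L2_inner K (weak_d K k \<omega>) \<mu> - L2_inner K \<omega> (weak_codiff \<Omega> (k + 1) \<mu>)" if K: "K \<in> G" for K
      proof -
        note sub = cell_subset[OF G K] cell_open[OF G K] \<Omega>(1)
        obtain c where c: "box_centre K c" using G K by (rule cell_centre)
        obtain q where q: "q \<in> Q1minus k" "eq_on K \<omega> q" using Uq[OF \<omega> K] by blast
        have "restr_in K \<mu> (Q1star (k + 1))" using V[of "k + 1"] \<mu> K by (auto simp: VQstar_def)
        then obtain m where m: "m \<in> Q1star (k + 1)" "eq_on K \<mu> m" unfolding restr_in_def by blast
        note p = local_interp_characterisation[OF c k' q(1) UL[OF \<omega> K] q(2)]
        have \<mu>L: "\<mu> \<in> L2 K (k + 1)" using H\<mu> by (intro L2_subset[OF _ sub]) (simp add: Hstar_def)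
        note \<nu> = L2_subset[OF weak_codiff_L2[OF H\<mu>] sub] weak_codiff_restr_in[OF G \<Omega>(1) K k' H\<mu> m]
        have iLK: "interp G k \<omega> \<in> L2 K k"
          using iPh[OF k \<omega>] by (intro L2_subset[OF _ sub]) (simp add: P1minus_h_def)
        have ie: "eq_on K (interp G k \<omega>) (local_interp k K \<omega>)"
          unfolding interp_def by (rule eq_on_cellwise[OF G K])
        show ?thesis
          using weak_d_cell_pairing[OF c k' P1minus_Q1minus[OF p(1)] m(1) iLK ie \<mu>L m(2) \<nu>]
            weak_d_cell_pairing[OF c k' q(1) m(1) UL[OF \<omega> K] q(2) \<mu>L m(2) \<nu>] by (simp add: p(2,3))
      qed
      then show ?thesis using sum_pairing_eq_0[OF G \<Omega>(1) UH[OF \<omega>] H\<mu> Green[OF k' \<omega> \<mu>]] by (simp cong: sum.cong)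
    qed
    then show ?thesis using iPh[OF k \<omega>] by (simp add: W_of_def)
  qed
  have comm: "eq_on \<Omega> (interp G (k + 1) (weak_d \<Omega> k \<omega>)) (d_h G k (interp G k \<omega>))" if k: "k < CARD('n)" and \<omega>: "\<omega> \<in> U k" for k \<omega>
  proof (rule eq_on_cells[OF G \<Omega>(1)])
    fix K assume K: "K \<in> G"
    note o = cell_open[OF G K] cell_bounded[OF G K]
    note sub = cell_subset[OF G K] cell_open[OF G K] \<Omega>(1)
    obtain c where c: "box_centre K c" using G K by (rule cell_centre)
    obtain q where q: "q \<in> Q1minus k" "eq_on K \<omega> q" using Uq[OF \<omega> K] by blast
    note p = local_interp_characterisation[OF c k q(1) UL[OF \<omega> K] q(2)]
    note dq = ext_deriv_Q1minus[OF q(1)]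
    have d\<omega>: "weak_d \<Omega> k \<omega> \<in> L2 K (k + 1)" "eq_on K (weak_d \<Omega> k \<omega>) (ext_deriv q)"
      using L2_subset[OF weak_d_L2[OF UH[OF \<omega>]] sub] weak_d_restr_in[OF G \<Omega>(1) K UH[OF \<omega>] q] by auto
    have "local_interp (k + 1) K (weak_d \<Omega> k \<omega>) = (\<lambda>x. ext_deriv q c)"
    \<comment> \<open>In top degree the interpolant is the projection onto constants, and \<open>ext_deriv q\<close> is itself constant.\<close>
    proof (cases "k + 1 < CARD('n)")
      case True
      note p' = local_interp_characterisation[OF c True dq d\<omega>]
      show ?thesis
      proof (rule P1minus_eqI[OF p'(1) P0_P1minus[OF Q1minus_Alt[OF dq]], where c = c])
        show "local_interp (k + 1) K (weak_d \<Omega> k \<omega>) c = ext_deriv q c" by (rule p'(2))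
        show "ext_deriv (local_interp (k + 1) K (weak_d \<Omega> k \<omega>)) c = ext_deriv (\<lambda>x. ext_deriv q c) c"
          unfolding p'(3) ext_deriv_const by (rule ext_deriv_ext_deriv_centre[OF c q(1)])
      qed
    next
      case False
      then have k': "k + 1 = CARD('n)" using k by simp
      show ?thesis using local_interp_top[OF c dq[unfolded k'] d\<omega>[unfolded k']] unfolding k' .
    qed
    moreover have "ext_deriv (local_interp k K \<omega>) = (\<lambda>x. ext_deriv q c)"
      using P1minus_ext_deriv_const[OF p(1), of c] by (simp add: p(3))
    ultimately have e: "local_interp (k + 1) K (weak_d \<Omega> k \<omega>) = ext_deriv (local_interp k K \<omega>)" by simp
    have iLK: "interp G k \<omega> \<in> L2 K k"
      using iPh[OF less_imp_le[OF k] \<omega>] by (intro L2_subset[OF _ sub]) (simp add: P1minus_h_def)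
    have ie: "eq_on K (interp G k \<omega>) (local_interp k K \<omega>)"
      unfolding interp_def by (rule eq_on_cellwise[OF G K])
    have "eq_on K (interp G (k + 1) (weak_d \<Omega> k \<omega>)) (ext_deriv (local_interp k K \<omega>))"
      unfolding interp_def e[symmetric] by (rule eq_on_cellwise[OF G K])
    also have "eq_on K (ext_deriv (local_interp k K \<omega>)) (d_h G k (interp G k \<omega>))"
      by (rule eq_on_sym[OF d_h_cell[OF G K weak_d_Q1minus[OF o P1minus_Q1minus[OF p(1)] iLK ie]]])
    finally show "eq_on K (interp G (k + 1) (weak_d \<Omega> k \<omega>)) (d_h G k (interp G k \<omega>))" .
  qed
  show ?thesis unfolding is_cochain_map_def using maps comm by auto
qed

theorem theorem4p7:
  fixes \<Omega> :: "'n::{finite,linorder} space set" and G :: "'n space set set"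
  assumes "open \<Omega>" and "connected \<Omega>" and "\<Omega> \<noteq> {}" and "bounded \<Omega>"
    and "cubical_mesh \<Omega> G"
  shows "(is_complex \<Omega> (VQ \<Omega> G) (weak_d \<Omega>) \<and> is_augmented \<Omega> (VQ \<Omega> G) (weak_d \<Omega>) \<and>
          is_complex \<Omega> (Wdef \<Omega> G) (d_h G) \<and> is_augmented \<Omega> (Wdef \<Omega> G) (d_h G) \<and>
          is_cochain_map \<Omega> (VQ \<Omega> G) (weak_d \<Omega>) (Wdef \<Omega> G) (d_h G) (interp G)) \<and>
         (is_complex \<Omega> (VQ0 \<Omega> G) (weak_d \<Omega>) \<and>
          is_complex \<Omega> (Wdef0 \<Omega> G) (d_h G) \<and>
          is_cochain_map \<Omega> (VQ0 \<Omega> G) (weak_d \<Omega>) (Wdef0 \<Omega> G) (d_h G) (interp G))"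
proof -
  note \<Omega> = assms(1,4) and G = assms(5)
  have Green: "L2_inner \<Omega> (weak_d \<Omega> k \<omega>) \<mu> = L2_inner \<Omega> \<omega> (weak_codiff \<Omega> (k + 1) \<mu>)"
    if "k < CARD('n)" "\<omega> \<in> VQ \<Omega> G k" "\<mu> \<in> VQ0star \<Omega> G (k + 1)" for k \<omega> \<mu>
    using that by (intro Green_H_H0star[OF \<Omega>]) (auto simp: VQ_def VQ0star_def)
  have Green0: "L2_inner \<Omega> (weak_d \<Omega> k \<omega>) \<mu> = L2_inner \<Omega> \<omega> (weak_codiff \<Omega> (k + 1) \<mu>)"
    if "k < CARD('n)" "\<omega> \<in> VQ0 \<Omega> G k" "\<mu> \<in> VQstar \<Omega> G (k + 1)" for k \<omega> \<mu>
    using that by (intro Green_H0_Hstar[OF \<Omega>]) (auto simp: VQ0_def VQstar_def)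
  have c1: "is_complex \<Omega> (VQ \<Omega> G) (weak_d \<Omega>)"
    by (rule is_complex_weak_d[OF \<Omega> _ weak_d_VQ[OF G \<Omega>(1)]]) (auto simp: VQ_def)
  have c2: "is_complex \<Omega> (VQ0 \<Omega> G) (weak_d \<Omega>)"
    by (rule is_complex_weak_d[OF \<Omega> _ weak_d_VQ0[OF G \<Omega>]]) (auto simp: VQ0_def H0_def)
  have c3: "is_complex \<Omega> (Wdef \<Omega> G) (d_h G)"
    unfolding Wdef_def by (rule is_complex_d_h[OF G \<Omega> VQ0star_VQstar weak_codiff_VQ0star[OF G \<Omega>]])
  have c4: "is_complex \<Omega> (Wdef0 \<Omega> G) (d_h G)"
    unfolding Wdef0_def by (rule is_complex_d_h[OF G \<Omega> subset_refl weak_codiff_VQstar[OF G \<Omega>]])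
  have m1: "is_cochain_map \<Omega> (VQ \<Omega> G) (weak_d \<Omega>) (Wdef \<Omega> G) (d_h G) (interp G)"
    unfolding Wdef_def by (rule is_cochain_map_interp[OF G \<Omega> subset_refl VQ0star_VQstar Green])
  have m2: "is_cochain_map \<Omega> (VQ0 \<Omega> G) (weak_d \<Omega>) (Wdef0 \<Omega> G) (d_h G) (interp G)"
    unfolding Wdef0_def by (rule is_cochain_map_interp[OF G \<Omega> VQ0_VQ subset_refl Green0])
  have a1: "is_augmented \<Omega> (VQ \<Omega> G) (weak_d \<Omega>)"
    unfolding is_augmented_def using const_form_VQ[OF \<Omega>] weak_d_eq_on[OF \<Omega> const_form_has_weak_d[OF \<Omega>]] by blast
  have a2: "is_augmented \<Omega> (Wdef \<Omega> G) (d_h G)"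
    unfolding is_augmented_def
  proof (intro allI conjI)
    fix c
    have d: "has_weak_d K 0 (const_form c :: 'n form) (\<lambda>x. 0)" if "K \<in> G" for K
      by (rule const_form_has_weak_d[OF cell_open[OF G that] cell_bounded[OF G that]])
    show "eq_on \<Omega> (d_h G 0 (const_form c)) (\<lambda>x. 0)"
      by (rule eq_on_cells[OF G \<Omega>(1)]) (rule d_h_cell[OF G _ d])
    have V: "const_form c \<in> VQ \<Omega> G 0" by (rule const_form_VQ[OF \<Omega>])
    have "const_form c \<in> P1minus_h \<Omega> G 0"
      using has_weak_d_L2(1)[OF const_form_has_weak_d[OF \<Omega>]] P0_P1minus[OF const_form_Alt] eq_on_refl
      unfolding P1minus_h_def restr_in_def const_form_def by blast
    moreover have "(\<Sum>K\<in>G. L2_inner K (weak_d K 0 (const_form c)) \<mu> - L2_inner K (const_form c) (weak_codiff \<Omega> (0 + 1) \<mu>)) = 0"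
      if \<mu>: "\<mu> \<in> VQ0star \<Omega> G (0 + 1)" for \<mu>
    proof (rule sum_pairing_eq_0[OF G \<Omega>(1)])
      show "const_form c \<in> H \<Omega> 0" using V by (simp add: VQ_def)
      show "\<mu> \<in> Hstar \<Omega> (0 + 1)" using \<mu> by (simp add: VQ0star_def H0star_def)
      show "L2_inner \<Omega> (weak_d \<Omega> 0 (const_form c)) \<mu> = L2_inner \<Omega> (const_form c) (weak_codiff \<Omega> (0 + 1) \<mu>)"
        by (rule Green[OF _ V \<mu>]) simp
    qed
    ultimately show "const_form c \<in> Wdef \<Omega> G 0" unfolding Wdef_def W_of_def by blast
  qed
  show ?thesis using c1 c2 c3 c4 m1 m2 a1 a2 by blast
qed

end
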